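(* Let $\Gamma$ be a lattice in $\mathbb{R}^n$, and let $S\subset\Gamma$ be a subset whose (natural) autocorrelation coefficients $\nu_S(z)=\mathrm{dens}\big(S\cap(z+S)\big)$ exist for all $z\in\mathbb{R}^n$. Put $S'=\Gamma\setminus S$. Then the following holds. (1) The autocorrelation coefficients $\nu_{S'}(z)=\mathrm{dens}\big(S'\cap(z+S')\big)$ of the complement set $S'$ also exist. They are $\nu_{S'}(z)=0$ for all $z\notin\Gamma$ and otherwise, for $z=t\in\Gamma$, satisfy the relation $$\nu_{S'}(t)-\mathrm{dens}(S')=\nu_S(t)-\mathrm{dens}(S).$$ (2) If, in addition, $\mathrm{dens}(S)=\mathrm{dens}(\Gamma)/2$, then the sets $S$ and $S'=\Gamma\setminus S$ are homometric. (3) The diffraction spectra of the sets $S$ and $S'$ are related by $$\hat\gamma_{S'}=\hat\gamma_S+\big(\mathrm{dens}(S')-\mathrm{dens}(S)\big)\,\mathrm{dens}(\Gamma)\,\delta_{\Gamma^*}.$$ In particular, $\hat\gamma_{S'}=\hat\gamma_S$ if $\mathrm{dens}(S')=\mathrm{dens}(S)$. (4) The diffraction measure $\hat\gamma_{S'}$ is pure point if and only if $\hat\gamma_S$ is pure point.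
   Context: A lattice in $\mathbb{R}^n$ is the integer span of $n$ vectors linearly independent over $\mathbb{R}$. The dual lattice is $\Gamma^*=\{u\in\mathbb{R}^n\mid uv\in\mathbb{Z}\text{ for all }v\in\Gamma\}$, with $uv$ the Euclidean scalar product. For $A\subset\mathbb{R}^n$ locally finite, the natural density is $\mathrm{dens}(A)=\lim_{r\to\infty}\frac{|A\cap B_r(0)|}{\mathrm{vol}(B_r(0))}$ when the limit exists, $B_r(0)$ being the open ball of radius $r$ around $0$. $\delta_x$ is the unit point measure at $x$ and $\delta_A=\sum_{x\in A}\delta_x$. For $A\subset\Gamma$ with existing autocorrelation coefficients $\nu_A(z)=\mathrm{dens}(A\cap(z+A))$, the (natural) autocorrelation is the measure $\gamma_A=\sum_{t\in\Gamma}\nu_A(t)\,\delta_t$; equivalently it is the vague limit, as $r\to\infty$, of $\frac{\omega_r*\tilde\omega_r}{\mathrm{vol}(B_r(0))}$, where $\omega_r=\delta_{A\cap B_r(0)}$ and $\tilde\omega_r=\delta_{-(A\cap B_r(0))}$. Its Fourier transform $\hat\gamma_A$ (as a tempered measure, with $\hat\varphi(x)=\int e^{-2\pi i xy}\varphi(y)\,dy$ for Schwartz functions and $\hat\mu(\varphi)=\mu(\hat\varphi)$) is a positive measure, called the diffraction measure or diffraction spectrum of $A$. Two point sets are homometric if they share the same natural autocorrelation. *)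

theory Defs
  imports "HOL-Analysis.Analysis"
begin

section \<open>Lattices and natural density\<close>

definition is_lattice :: "(real ^ 'n) set \<Rightarrow> bool" where
  "is_lattice L \<longleftrightarrow>
    (\<exists>B. independent B \<and> card B = CARD('n) \<and>
         L = {\<Sum>b\<in>B. of_int (k b) *\<^sub>R b | k :: real ^ 'n \<Rightarrow> int. True})"

definition dual_lattice :: "(real ^ 'n) set \<Rightarrow> (real ^ 'n) set" where
  "dual_lattice L = {u. \<forall>v\<in>L. u \<bullet> v \<in> \<int>}"

text \<open>Finiteness in every ball (local finiteness) is required explicitly because
  \<^const>\<open>card\<close> of an infinite set is 0.\<close>

definition has_dens :: "(real ^ 'n) set \<Rightarrow> real \<Rightarrow> bool" where
  "has_dens A d \<longleftrightarrow>
    (\<forall>r. finite (A \<inter> ball 0 r)) \<and>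
    ((\<lambda>r. real (card (A \<inter> ball 0 r)) / measure lborel (ball (0 :: real ^ 'n) r)) \<longlongrightarrow> d) at_top"

definition dens_exists :: "(real ^ 'n) set \<Rightarrow> bool" where
  "dens_exists A \<longleftrightarrow> (\<exists>d. has_dens A d)"

definition dens :: "(real ^ 'n) set \<Rightarrow> real" where
  "dens A = (THE d. has_dens A d)"


section \<open>Autocorrelation\<close>

definition autocorr_coeff_exists :: "(real ^ 'n) set \<Rightarrow> real ^ 'n \<Rightarrow> bool" where
  "autocorr_coeff_exists A z \<longleftrightarrow> dens_exists (A \<inter> (\<lambda>x. z + x) ` A)"

definition autocorr_coeff :: "(real ^ 'n) set \<Rightarrow> real ^ 'n \<Rightarrow> real" where
  "autocorr_coeff A z = dens (A \<inter> (\<lambda>x. z + x) ` A)"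

text \<open>The Borel measure \<open>\<Sum>t\<in>L. w t \<cdot> \<delta>\<^sub>t\<close>, for a nonnegative weight \<open>w\<close>.\<close>

definition weighted_comb :: "(real ^ 'n) set \<Rightarrow> (real ^ 'n \<Rightarrow> real) \<Rightarrow> (real ^ 'n) measure" where
  "weighted_comb L w = distr (density (count_space L) (\<lambda>t. ennreal (w t))) borel (\<lambda>t. t)"

definition dirac_comb :: "(real ^ 'n) set \<Rightarrow> (real ^ 'n) measure" where
  "dirac_comb A = weighted_comb A (\<lambda>_. 1)"

text \<open>Intended for \<open>A \<subseteq> L\<close> all of whose autocorrelation coefficients exist.\<close>

definition autocorrelation :: "(real ^ 'n) set \<Rightarrow> (real ^ 'n) set \<Rightarrow> (real ^ 'n) measure" where
  "autocorrelation L A = weighted_comb L (autocorr_coeff A)"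

definition homometric :: "(real ^ 'n) set \<Rightarrow> (real ^ 'n) set \<Rightarrow> (real ^ 'n) set \<Rightarrow> bool" where
  "homometric L A B \<longleftrightarrow>
    (\<forall>z. autocorr_coeff_exists A z) \<and> (\<forall>z. autocorr_coeff_exists B z) \<and>
    autocorrelation L A = autocorrelation L B"


section \<open>Fourier transform of tempered measures and diffraction\<close>

fun iter_partial :: "'n list \<Rightarrow> (real ^ 'n \<Rightarrow> complex) \<Rightarrow> real ^ 'n \<Rightarrow> complex" where
  "iter_partial [] f = f"
| "iter_partial (i # is) f = (\<lambda>x. frechet_derivative (iter_partial is f) (at x) (axis i 1))"

definition schwartz :: "(real ^ 'n \<Rightarrow> complex) \<Rightarrow> bool" where
  "schwartz f \<longleftrightarrow>
    (\<forall>is. (\<forall>x. iter_partial is f differentiable (at x)) \<and>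
          (\<forall>k :: nat. bounded (range (\<lambda>x. norm x ^ k *\<^sub>R iter_partial is f x))))"

definition fourier :: "(real ^ 'n \<Rightarrow> complex) \<Rightarrow> real ^ 'n \<Rightarrow> complex" where
  "fourier f x = integral\<^sup>L lborel (\<lambda>y. exp (- 2 * of_real pi * \<i> * of_real (x \<bullet> y)) * f y)"

text \<open>A positive measure defines a tempered distribution as soon as it integrates all Schwartz
  functions: continuity of the resulting functional is then automatic.\<close>

definition tempered_measure :: "(real ^ 'n) measure \<Rightarrow> bool" where
  "tempered_measure M \<longleftrightarrow> sets M = sets borel \<and> (\<forall>f. schwartz f \<longrightarrow> integrable M f)"

definition is_fourier_transform :: "(real ^ 'n) measure \<Rightarrow> (real ^ 'n) measure \<Rightarrow> bool" where
  "is_fourier_transform M N \<longleftrightarrow>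
    tempered_measure M \<and> tempered_measure N \<and>
    (\<forall>f. schwartz f \<longrightarrow> integral\<^sup>L N f = integral\<^sup>L M (fourier f))"

text \<open>A tempered measure is determined by its integrals of Schwartz functions, so there is at most
  one such \<open>N\<close>. For positive definite \<open>M\<close>, in particular for an autocorrelation, it exists by the
  Bochner--Schwartz theorem.\<close>

definition measure_fourier :: "(real ^ 'n) measure \<Rightarrow> (real ^ 'n) measure" where
  "measure_fourier M = (THE N. is_fourier_transform M N)"

definition diffraction :: "(real ^ 'n) set \<Rightarrow> (real ^ 'n) set \<Rightarrow> (real ^ 'n) measure" where
  "diffraction L A = measure_fourier (autocorrelation L A)"

definition pure_point :: "(real ^ 'n) measure \<Rightarrow> bool" where
  "pure_point M \<longleftrightarrow>
    (\<forall>B \<in> sets borel. emeasure M B = (\<integral>\<^sup>+x. emeasure M {x} \<partial>count_space B))"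

text \<open>The identity \<open>N = M + c \<cdot> D\<close> of locally finite measures. The real factor \<open>c\<close> may be negative,
  so the right-hand side is a signed measure, which has real values on the bounded Borel sets and
  is determined by them.\<close>

definition measure_eq_plus_scaled ::
    "(real ^ 'n) measure \<Rightarrow> (real ^ 'n) measure \<Rightarrow> real \<Rightarrow> (real ^ 'n) measure \<Rightarrow> bool" where
  "measure_eq_plus_scaled N M c D \<longleftrightarrow>
    (\<forall>B \<in> sets borel. bounded B \<longrightarrow>
       emeasure N B < \<infinity> \<and> emeasure M B < \<infinity> \<and> emeasure D B < \<infinity> \<and>
       measure N B = measure M B + c * measure D B)"

end

theory Submission
  imports Defs "HOL-Probability.Probability"
begin

text \<open>
  Counting gives \<open>\<nu>\<^bsub>S'\<^esub> = \<nu>\<^bsub>S\<^esub> + (dens S' - dens S)\<close> on the lattice \<open>\<Gamma>\<close>, so everything about the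
  diffraction follows from the Poisson summation formula, once the Fourier transforms are known to
  exist and to be unique. For existence, the power spectra
  \<open>|\<Sum>\<^bsub>t \<in> S \<inter> B r\<^esub> exp (-2 \<pi> i t x)|\<^sup>2\<close> are nonnegative trigonometric polynomials that are
  periodic under the dual lattice \<open>\<Gamma>\<^sup>*\<close>. Normalized on a fundamental cell of \<open>\<Gamma>\<^sup>*\<close> they are
  probability measures; a weak limit \<open>\<mu>\<close> has the Fourier coefficients \<open>\<nu>\<^bsub>S\<^esub> / dens S\<close>, and the
  periodization of \<open>\<mu>\<close> along \<open>\<Gamma>\<^sup>*\<close> is, up to a factor, the diffraction measure. For \<open>S = \<Gamma>\<close> all
  Fourier coefficients of \<open>\<mu>\<close> are \<open>1\<close>, which forces \<open>\<mu>\<close> to live on \<open>\<Gamma>\<^sup>*\<close>: this is the Poisson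
  summation formula. Uniqueness holds because indicators of open boxes are increasing limits of
  smooth bump functions.
\<close>

section \<open>Weak compactness for measures with bounded support\<close>

text \<open>\<open>measure_fourier\<close> is a definite description, so nothing about diffraction
  can be read off before a Fourier transform has been exhibited; this is why the spectra are
  constructed. Being periodic, they have infinite mass on the whole space as soon as they are
  nonzero; on one bounded cell of the dual lattice no mass can escape, so weak limits exist.
  Truncating S to a ball disturbs only a boundary shell of fixed width, which has density 0, so the
  coefficients of the truncated sets converge to \<nu>. The factor dens \<Gamma> in the final
  formula is the volume of the dual cell: the charts of the two lattices are the inverse and the
  transpose of the same basis matrix. Finally, dens S' - dens S may be negative while measures take
  values in [0, infinity]. Identities are therefore proved in the form N = M + c D with c \<ge> 0,
  the denser set providing N, and are read backwards only on bounded sets, where all values are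
  finite.\<close>

definition ternary_value :: "(nat \<Rightarrow> real) \<Rightarrow> real" where
  "ternary_value e = (\<Sum>j. 2 * e j / 3 ^ Suc j)"

lemma ternary_geometric: "(\<lambda>j. 2 / 3 ^ Suc j :: real) sums 1"
proof -
  have "(\<lambda>j. 2 / 3 * (1 / 3) ^ j :: real) sums (2 / 3 * (1 / (1 - 1 / 3)))"
    by (intro sums_mult geometric_sums) auto
  then show ?thesis by (simp add: power_one_over field_simps)
qed

lemma ternary_summable:
  fixes e :: "nat \<Rightarrow> real"
  assumes "\<And>j. e j \<in> {0..1}"
  shows "summable (\<lambda>j. 2 * e j / 3 ^ Suc j)"
proof (rule summable_comparison_test'[of "\<lambda>j. 2 / 3 ^ Suc j" 0])
  show "summable (\<lambda>j. 2 / 3 ^ Suc j :: real)"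
    using ternary_geometric by (rule sums_summable)
  show "norm (2 * e j / 3 ^ Suc j) \<le> 2 / 3 ^ Suc j" for j
    using assms[of j] by (auto simp: field_simps)
qed

lemma ternary_value_bounds:
  assumes "\<And>j. e j \<in> {0..1}"
  shows "ternary_value e \<in> {0..1}"
proof -
  have "ternary_value e \<le> (\<Sum>j. 2 / 3 ^ Suc j)"
    unfolding ternary_value_def
    using assms by (intro suminf_le ternary_summable sums_summable[OF ternary_geometric])
      (auto simp: field_simps)
  moreover have "0 \<le> ternary_value e"
    unfolding ternary_value_def
    using assms by (intro suminf_nonneg ternary_summable) auto
  ultimately show ?thesis
    using sums_unique[OF ternary_geometric] by simp
qed

text \<open>Tripling shifts the ternary expansion by one place and moves the leading digit, which is
  twice \<open>e 0\<close>, in front of the point.\<close>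

lemma ternary_value_rec:
  assumes "\<And>j. e j \<in> {0..1}"
  shows "3 * ternary_value e = 2 * e 0 + ternary_value (\<lambda>j. e (Suc j))"
proof -
  have "ternary_value e = (\<Sum>j. 2 * e (Suc j) / 3 ^ Suc (Suc j)) + 2 * e 0 / 3"
    unfolding ternary_value_def using suminf_split_head[OF ternary_summable[of e]] assms by simp
  moreover have "ternary_value (\<lambda>j. e (Suc j)) = (\<Sum>j. 3 * (2 * e (Suc j) / 3 ^ Suc (Suc j)))"
    unfolding ternary_value_def by simp
  moreover have "\<dots> = 3 * (\<Sum>j. 2 * e (Suc j) / 3 ^ Suc (Suc j))"
    using ternary_summable[of e] assms
    by (intro suminf_mult) (subst summable_Suc_iff[of "\<lambda>j. 2 * e j / 3 ^ Suc j"], auto)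
  ultimately show ?thesis by simp
qed

section \<open>A periodic wave that reads off ternary digits\<close>

text \<open>A clipped cosine instead of Schoenberg's piecewise linear wave. As cos(pi/3) = 1/2 and
  cos(2 pi/3) = -1/2, it is 0 on [0, 1/3] and 1 on [2/3, 1], the intervals that hold the Cantor
  points with leading digit 0 and 2. Since the digit 1 never occurs, the gap between them leaves
  room for a continuous switch.\<close>

definition digit_wave :: "real \<Rightarrow> real" where
  "digit_wave t = max 0 (min 1 (1 / 2 - cos (pi * t)))"

lemma digit_wave_range: "digit_wave t \<in> {0..1}"
  by (auto simp: digit_wave_def)

lemma continuous_digit_wave: "continuous_on UNIV digit_wave"
  unfolding digit_wave_def by (intro continuous_intros)

lemma digit_wave_shift: "digit_wave (t + 2 * of_int k) = digit_wave t"
proof -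
  have "cos (pi * (t + 2 * of_int k)) = cos (pi * t + of_int k * (2 * pi))"
    by (simp add: algebra_simps)
  also have "\<dots> = cos (pi * t)"
    using cos.plus_of_int[of "pi * t" k] by (simp add: mult.commute mult.assoc)
  finally show ?thesis by (simp add: digit_wave_def)
qed

lemma digit_wave_0:
  assumes "0 \<le> t" "t \<le> 1 / 3" shows "digit_wave t = 0"
proof -
  have "cos (pi / 3) \<le> cos (pi * t)"
    using assms by (intro cos_monotone_0_pi_le) auto
  then show ?thesis by (simp add: digit_wave_def cos_60)
qed

lemma digit_wave_1:
  assumes "2 / 3 \<le> t" "t \<le> 1" shows "digit_wave t = 1"
proof -
  have "cos (pi * t) \<le> cos (pi * (2 / 3))"
    using assms by (intro cos_monotone_0_pi_le) auto
  moreover have "cos (pi * (2 / 3)) = - 1 / 2"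
    using cos_120 by (simp add: mult.commute)
  ultimately show ?thesis by (simp add: digit_wave_def)
qed

text \<open>The first m digits, moved in front of the point, form an even integer because each of
  them is 0 or 2. The period 2 removes it, and the wave sees the digit belonging to
  \<open>e m\<close> in leading position.\<close>

lemma digit_wave_ternary_value:
  assumes "\<And>j. e j \<in> {0, 1}"
  shows "digit_wave (3 ^ m * ternary_value e) = e m"
  using assms
proof (induction m arbitrary: e)
  case 0
  have e: "e j \<in> {0..1}" for j using 0[of j] by auto
  have "ternary_value (\<lambda>j. e (Suc j)) \<in> {0..1}" using e by (intro ternary_value_bounds)
  then show ?case
    using 0[of 0] ternary_value_rec[of e] e by (auto intro!: digit_wave_0 digit_wave_1)
next
  case (Suc m)
  have e: "e j \<in> {0..1}" for j using Suc.prems[of j] by auto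
  have "3 ^ Suc m * ternary_value e = 3 ^ m * (3 * ternary_value e)" by simp
  also have "\<dots> = 3 ^ m * ternary_value (\<lambda>j. e (Suc j)) + 2 * (3 ^ m * e 0)"
    using e by (subst ternary_value_rec) (auto simp: algebra_simps)
  \<comment> \<open>\<open>e 0\<close> is 0 or 1, so the shift is twice an integer, as
    \<open>digit_wave_shift\<close> requires.\<close>
  also have "3 ^ m * e 0 = of_int (if e 0 = 0 then 0 else 3 ^ m)"
    using Suc.prems[of 0] by auto
  finally have "digit_wave (3 ^ Suc m * ternary_value e) = digit_wave (3 ^ m * ternary_value (\<lambda>j. e (Suc j)))"
    by (simp only: digit_wave_shift)
  then show ?case using Suc by simp
qed

section \<open>Binary expansions and the space-filling curve\<close>

text \<open>The binary digit of x at place k + 1 after the point; where two expansions exist, the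
  floor selects the one that ends in zeros.\<close>

definition binary_digit :: "nat \<Rightarrow> real \<Rightarrow> real" where
  "binary_digit k x = of_int (\<lfloor>2 ^ Suc k * x\<rfloor> - 2 * \<lfloor>2 ^ k * x\<rfloor>)"

lemma binary_digit_range: "binary_digit k x \<in> {0, 1}"
proof -
  define y where "y = 2 ^ k * x"
  have "2 * \<lfloor>y\<rfloor> \<le> \<lfloor>2 * y\<rfloor>" "\<lfloor>2 * y\<rfloor> < 2 * \<lfloor>y\<rfloor> + 2" by linarith+
  then have "\<lfloor>2 * y\<rfloor> - 2 * \<lfloor>y\<rfloor> = 0 \<or> \<lfloor>2 * y\<rfloor> - 2 * \<lfloor>y\<rfloor> = 1" by linarith
  then show ?thesis unfolding binary_digit_def power_Suc y_def[symmetric] mult.assoc by auto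
qed

text \<open>The partial sums telescope to floor(2^n x) / 2^n; the integer part, which the digits
  ignore, is 0 on [0, 1).\<close>

lemma binary_digit_sums:
  assumes "0 \<le> x" "x < 1"
  shows "(\<lambda>k. binary_digit k x / 2 ^ Suc k) sums x"
proof -
  have part: "(\<Sum>k<n. binary_digit k x / 2 ^ Suc k) = of_int \<lfloor>2 ^ n * x\<rfloor> / 2 ^ n" for n
  proof (induction n)
    case 0
    have "\<lfloor>x\<rfloor> = 0" using assms by linarith
    then show ?case by simp
  next
    case (Suc n)
    then show ?case by (simp add: binary_digit_def field_simps)
  qed
  have "(\<lambda>n. of_int \<lfloor>2 ^ n * x\<rfloor> / 2 ^ n) \<longlonglongrightarrow> x"
  proof (rule LIM_zero_cancel, rule Lim_null_comparison)
    have "\<bar>of_int \<lfloor>2 ^ n * x\<rfloor> - 2 ^ n * x\<bar> \<le> 1" for n by linarith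
    then have "\<bar>(of_int \<lfloor>2 ^ n * x\<rfloor> - 2 ^ n * x) / 2 ^ n\<bar> \<le> (1 / 2) ^ n" for n
      using divide_right_mono[of "\<bar>of_int \<lfloor>2 ^ n * x\<rfloor> - 2 ^ n * x\<bar>" 1 "2 ^ n" for n]
      by (simp add: abs_divide power_one_over)
    then show "\<forall>\<^sub>F n in sequentially. norm (of_int \<lfloor>2 ^ n * x\<rfloor> / 2 ^ n - x) \<le> (1 / 2) ^ n"
      by (simp add: diff_divide_distrib)
    show "(\<lambda>n. (1 / 2 :: real) ^ n) \<longlonglongrightarrow> 0"
      by (intro LIMSEQ_power_zero) auto
  qed
  then show ?thesis unfolding sums_def part .
qed

lemma measurable_binary_digit [measurable]: "binary_digit k \<in> borel_measurable borel"
  unfolding binary_digit_def by simp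

lemma binary_geometric: "(\<lambda>k. 1 / 2 ^ Suc k :: real) sums 1"
  using power_half_series by (simp add: power_one_over)

text \<open>Schoenberg's variant of the Peano curve. The section reads the binary digits of all
  coordinates into the ternary digits of one real number.\<close>

lemma space_filling_curve:
  obtains h :: "real \<Rightarrow> real ^ 'n" and s :: "real ^ 'n \<Rightarrow> real"
  where "continuous_on UNIV h" "\<And>t i. h t $ i \<in> {0..1}"
    "s \<in> borel_measurable borel" "\<And>x. s x \<in> {0..1}"
    "\<And>x. (\<And>i. 0 \<le> x $ i \<and> x $ i < 1) \<Longrightarrow> h (s x) = x"
proof -
  obtain idx :: "'n \<Rightarrow> nat" where idx: "bij_betw idx UNIV {0..<CARD('n)}"
    using ex_bij_betw_finite_nat[OF finite_class.finite_UNIV] by auto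
  \<comment> \<open>Interleaving: with n coordinates, digit m of the combined sequence is binary
    digit m div n of the coordinate numbered m mod n. The curve \<open>h\<close> reads the places n
    k + \<open>idx i\<close> back into coordinate i.\<close>
  define d where "d m x = binary_digit (m div CARD('n)) (x $ inv idx (m mod CARD('n)))"
    for m and x :: "real ^ 'n"
  define s where "s x = ternary_value (\<lambda>m. d m x)" for x
  define h :: "real \<Rightarrow> real ^ 'n" where
    "h t = (\<chi> i. \<Sum>k. digit_wave (3 ^ (CARD('n) * k + idx i) * t) / 2 ^ Suc k)" for t
  have d01: "d m x \<in> {0, 1}" for m x unfolding d_def by (rule binary_digit_range)
  have wave_le: "norm (digit_wave u / 2 ^ Suc k) \<le> 1 / 2 ^ Suc k" for u k
    using digit_wave_range[of u] by (auto simp: field_simps)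
  have wave_sum: "summable (\<lambda>k. digit_wave (u k) / 2 ^ Suc k)" for u
    using wave_le by (intro summable_comparison_test'[OF sums_summable[OF binary_geometric], of 0]) auto
  show ?thesis
  proof
    show "continuous_on UNIV h"
      unfolding h_def
    proof (intro continuous_on_vec_lambda)
      fix i
      have "uniform_limit UNIV (\<lambda>n t. \<Sum>k<n. digit_wave (3 ^ (CARD('n) * k + idx i) * t) / 2 ^ Suc k)
        (\<lambda>t. \<Sum>k. digit_wave (3 ^ (CARD('n) * k + idx i) * t) / 2 ^ Suc k) sequentially"
        using wave_le sums_summable[OF binary_geometric] by (intro Weierstrass_m_test) auto
      then show "continuous_on UNIV (\<lambda>t. \<Sum>k. digit_wave (3 ^ (CARD('n) * k + idx i) * t) / 2 ^ Suc k)"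
        by (rule uniform_limit_theorem[rotated])
          (auto intro!: always_eventually continuous_intros continuous_on_compose2[OF continuous_digit_wave])
    qed
    show "h t $ i \<in> {0..1}" for t i
    proof -
      have "h t $ i \<le> (\<Sum>k. 1 / 2 ^ Suc k)"
        unfolding h_def vec_lambda_beta
        using digit_wave_range
        by (intro suminf_le wave_sum sums_summable[OF binary_geometric]) (auto simp: field_simps)
      moreover have "0 \<le> h t $ i"
        unfolding h_def vec_lambda_beta
        using digit_wave_range by (intro suminf_nonneg wave_sum) (auto simp: field_simps)
      ultimately show ?thesis using sums_unique[OF binary_geometric] by simp
    qed
    have [measurable]: "d m \<in> borel_measurable borel" for m
      unfolding d_def by measurable
    show "s \<in> borel_measurable borel"
      unfolding s_def ternary_value_def by measurable
    show "s x \<in> {0..1}" for x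
      unfolding s_def using d01[of _ x] by (intro ternary_value_bounds) (metis atLeastAtMost_iff insertE order_refl singletonD zero_le_one)
    show "h (s x) = x" if x: "\<And>i. 0 \<le> x $ i \<and> x $ i < 1" for x
    proof (rule vec_eq_iff[THEN iffD2], rule allI)
      fix i
      have i: "idx i < CARD('n)" using idx by (auto simp: bij_betw_def)
      have "inv idx (idx i) = i" using idx by (simp add: bij_betw_def)
      then have "d (CARD('n) * k + idx i) x = binary_digit k (x $ i)" for k
        using i by (simp add: d_def)
      then have "h (s x) $ i = (\<Sum>k. binary_digit k (x $ i) / 2 ^ Suc k)"
        unfolding h_def s_def vec_lambda_beta by (simp only: digit_wave_ternary_value[OF d01])
      then show "h (s x) $ i = x $ i"
        using binary_digit_sums[of "x $ i"] x by (simp add: sums_iff)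
    qed
  qed
qed

text \<open>Pulling the measures back along the section of a space-filling curve reduces compactness in
  \<open>n\<close> dimensions to Helly's selection theorem on the line.\<close>

theorem weak_compactness_bounded:
  fixes \<rho> :: "nat \<Rightarrow> (real ^ 'n) measure"
  assumes prob: "\<And>j. prob_space (\<rho> j)" and sets: "\<And>j. sets (\<rho> j) = sets borel"
    and bdd: "\<And>j. AE x in \<rho> j. norm x < R"
  obtains r M C where "strict_mono r" "prob_space M" "sets M = sets borel" "AE x in M. norm x \<le> C"
    "\<And>F :: real ^ 'n \<Rightarrow> complex. continuous_on UNIV F \<Longrightarrow>
       (\<lambda>j. integral\<^sup>L (\<rho> (r j)) F) \<longlonglongrightarrow> integral\<^sup>L M F"
proof -
  obtain h :: "real \<Rightarrow> real ^ 'n" and s where h: "continuous_on UNIV h" "\<And>t i. h t $ i \<in> {0..1}"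
    and s [measurable]: "s \<in> borel_measurable borel" "\<And>x. s x \<in> {0..1}"
    and hs: "\<And>x. (\<And>i. 0 \<le> x $ i \<and> x $ i < 1) \<Longrightarrow> h (s x) = x"
    by (rule space_filling_curve) blast
  \<comment> \<open>The added 1 keeps K positive whatever R is. The cube of half-width K contains
    the ball of radius R, and \<open>h'\<close> and \<open>s'\<close> are the curve and its section
    rescaled from the unit cube to this cube.\<close>
  define K where "K = \<bar>R\<bar> + 1"
  have K: "0 < K" "R \<le> K" by (auto simp: K_def)
  define h' where "h' t = (2 * K) *\<^sub>R h t - (\<chi> i. K)" for t
  define s' where "s' x = s ((1 / (2 * K)) *\<^sub>R (x + (\<chi> i. K)))" for x
  have h'_cont: "continuous_on UNIV h'" unfolding h'_def using h by (intro continuous_intros) auto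
  have s'_meas [measurable]: "s' \<in> borel_measurable borel" unfolding s'_def by measurable
  have h'_meas [measurable]: "h' \<in> borel_measurable borel"
    using h'_cont by (rule borel_measurable_continuous_onI)
  have h's': "h' (s' x) = x" if "norm x < R" for x
  proof -
    have "- K < x $ i \<and> x $ i < K" for i
      using component_le_norm_cart[of x i] that K by linarith
    then have "0 \<le> x $ i + K \<and> x $ i + K < 2 * K" for i
      by (smt (verit))
    then have "h (s' x) = (1 / (2 * K)) *\<^sub>R (x + (\<chi> i. K))"
      unfolding s'_def using K by (intro hs) (auto simp: divide_simps)
    then show ?thesis using K by (simp add: h'_def)
  qed
  have h'_bd: "norm (h' t) \<le> CARD('n) * K" for t
  proof -
    have "\<bar>h' t $ i\<bar> \<le> K" for i
    proof -
      have "0 \<le> h t $ i" "h t $ i \<le> 1" using h(2)[of t i] by auto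
      then have "0 \<le> K * h t $ i" "K * h t $ i \<le> K * 1" using K by (auto intro: mult_left_mono)
      then show ?thesis by (simp add: h'_def abs_le_iff)
    qed
    then have "(\<Sum>i\<in>UNIV. \<bar>h' t $ i\<bar>) \<le> (\<Sum>i\<in>(UNIV :: 'n set). K)" by (intro sum_mono) auto
    then show ?thesis using norm_le_l1_cart[of "h' t"] by simp
  qed
  define \<sigma> where "\<sigma> j = distr (\<rho> j) borel s'" for j
  have [measurable_cong]: "sets (\<rho> j) = sets borel" for j by (rule sets)
  have \<sigma>: "real_distribution (\<sigma> j)" for j
  proof -
    interpret prob_space "\<rho> j" by (rule prob)
    show ?thesis unfolding \<sigma>_def by (rule real_distribution_distr) measurable
  qed
  have "tight \<sigma>"
    unfolding tight_def
  proof (intro conjI allI impI)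
    show "real_distribution (\<sigma> n)" for n by (rule \<sigma>)
    fix \<epsilon> :: real assume "0 < \<epsilon>"
    \<comment> \<open>All mass lies in [0, 1], the range of the section, so one interval serves
      every \<epsilon>.\<close>
    have "measure (\<sigma> n) {-1<..1} > 1 - \<epsilon>" for n
    proof -
      interpret prob_space "\<rho> n" by (rule prob)
      have "s' -` {-1<..1} \<inter> space (\<rho> n) = space (\<rho> n)"
        using s(2) unfolding s'_def by auto (metis atLeastAtMost_iff less_le_trans neg_less_0_iff_less zero_less_one)
      then have "measure (\<sigma> n) {-1<..1} = 1"
        unfolding \<sigma>_def by (subst measure_distr) (auto simp: prob_space)
      then show ?thesis using \<open>0 < \<epsilon>\<close> by simp
    qed
    then show "\<exists>a b. a < b \<and> (\<forall>n. measure (\<sigma> n) {a<..b} > 1 - \<epsilon>)"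
      by (intro exI[of _ "-1"] exI[of _ 1]) auto
  qed
  from tight_imp_convergent_subsubsequence[OF this strict_mono_id]
  obtain r M where r: "strict_mono r" and M: "real_distribution M" "weak_conv_m (\<sigma> \<circ> r) M"
    by auto
  interpret M: real_distribution M by (rule M)
  show ?thesis
  proof
    show "strict_mono r" by (rule r)
    show "prob_space (distr M borel h')" by (rule M.prob_space_distr) measurable
    show "sets (distr M borel h') = sets borel" by simp
    show "AE x in distr M borel h'. norm x \<le> CARD('n) * K"
      by (subst AE_distr_iff) (auto simp: h'_bd)
    fix F :: "real ^ 'n \<Rightarrow> complex" assume F: "continuous_on UNIV F"
    have [measurable]: "F \<in> borel_measurable borel" using F by (rule borel_measurable_continuous_onI)
    have "compact (F ` cball 0 (CARD('n) * K))"
      using F by (intro compact_continuous_image continuous_on_subset[OF F]) auto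
    then obtain B where "\<And>y. y \<in> F ` cball 0 (CARD('n) * K) \<Longrightarrow> norm y \<le> B"
      by (meson bounded_iff compact_imp_bounded)
    then have B: "norm (F (h' t)) \<le> B" for t using h'_bd[of t] by auto
    have cont: "isCont (\<lambda>t. F (h' t)) t" for t
      using continuous_on_compose2[OF F h'_cont] by (auto simp: continuous_on_eq_continuous_at)
    \<comment> \<open>The section is merely measurable, but only the curve enters the limit: F
      composed with \<open>h'\<close> is bounded and continuous on the line, and \<open>h'\<close>
      undoes \<open>s'\<close> on the ball that carries the given measures.\<close>
    have "(\<lambda>n. integral\<^sup>L ((\<sigma> \<circ> r) n) (\<lambda>t. F (h' t))) \<longlonglongrightarrow> integral\<^sup>L M (\<lambda>t. F (h' t))"
      using \<sigma> M cont B by (intro weak_conv_imp_integral_bdd_continuous_conv[where B=B]) (auto simp: o_def)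
    moreover have "integral\<^sup>L ((\<sigma> \<circ> r) n) (\<lambda>t. F (h' t)) = integral\<^sup>L (\<rho> (r n)) F" for n
    proof -
      have "integral\<^sup>L ((\<sigma> \<circ> r) n) (\<lambda>t. F (h' t)) = (\<integral>x. F (h' (s' x)) \<partial>\<rho> (r n))"
        unfolding \<sigma>_def o_def by (rule integral_distr) measurable
      also have "\<dots> = integral\<^sup>L (\<rho> (r n)) F"
        using bdd[of "r n"] by (intro integral_cong_AE) (auto elim!: eventually_mono simp: h's')
      finally show ?thesis .
    qed
    moreover have "integral\<^sup>L M (\<lambda>t. F (h' t)) = integral\<^sup>L (distr M borel h') F"
      by (rule integral_distr[symmetric]) measurable
    ultimately show "(\<lambda>j. integral\<^sup>L (\<rho> (r j)) F) \<longlonglongrightarrow> integral\<^sup>L (distr M borel h') F"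
      by simp
  qed
qed

section \<open>Volumes of linear images\<close>

text \<open>The library computes the volume of linear images for well-ordered index types only; this copy
  of the index type carries such an order.\<close>

typedef 'n index = "{0..<CARD('n::finite)}"
  by (rule exI[of _ 0]) simp

lemma finite_UNIV_index: "finite (UNIV :: 'n::finite index set)"
  unfolding type_definition.univ[OF type_definition_index] by (intro finite_imageI) simp

instantiation index :: (finite) wellorder
begin

definition "x \<le> y \<longleftrightarrow> Rep_index x \<le> Rep_index y"
definition "x < y \<longleftrightarrow> Rep_index x < Rep_index y"

instance
proof
  fix P :: "'a index \<Rightarrow> bool" and x :: "'a index"
  assume step: "\<And>x. (\<And>y. y < x \<Longrightarrow> P y) \<Longrightarrow> P x"
  show "P x"
  proof (induction x rule: measure_induct_rule[of Rep_index])
    case (less x)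
    then show ?case unfolding less_index_def[symmetric] by (rule step)
  qed
qed (auto simp: less_eq_index_def less_index_def Rep_index_inject)

end

instance index :: (finite) finite
  by standard (rule finite_UNIV_index)

text \<open>Relabelling coordinates permutes the side lengths of a box, and Lebesgue measure is
  determined by its values on boxes.\<close>

lemma reindex_volume:
  fixes \<iota> :: "'m::finite \<Rightarrow> 'n::finite"
  assumes "bij \<iota>" "S \<in> sets borel"
  shows "measure lborel ((\<lambda>x. \<chi> j. x $ \<iota> j) -` S :: (real ^ 'n) set) = measure lborel (S :: (real ^ 'm) set)"
proof -
  let ?R = "\<lambda>x :: real ^ 'n. (\<chi> j. x $ \<iota> j) :: real ^ 'm"
  have [measurable]: "?R \<in> borel_measurable borel"
    by (intro borel_measurable_continuous_onI continuous_intros)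
  have "lborel = distr lborel borel ?R"
  proof (rule lborel_eqI)
    fix l u :: "real ^ 'm" assume le: "\<And>b. b \<in> Basis \<Longrightarrow> l \<bullet> b \<le> u \<bullet> b"
    let ?E = "\<lambda>x :: real ^ 'm. (\<chi> i. x $ inv \<iota> i) :: real ^ 'n"
    have inv: "inv \<iota> (\<iota> j) = j" "\<iota> (inv \<iota> i) = i" for i j
      using assms(1) by (auto simp: bij_is_inj bij_is_surj surj_f_inv_f)
    have lu: "l $ j \<le> u $ j" for j
      using le[of "axis j 1"] by (auto simp: inner_axis Basis_vec_def)
    have "?R -` box l u = box (?E l) (?E u)"
      by (auto simp: mem_box_cart inv) (metis inv(1) inv(2))+
    then have "emeasure (distr lborel borel ?R) (box l u) = emeasure lborel (box (?E l) (?E u))"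
      by (subst emeasure_distr) auto
    also have "\<dots> = (\<Prod>b\<in>Basis. (?E u - ?E l) \<bullet> b)"
      using lu by (intro emeasure_lborel_box) (auto simp: Basis_vec_def inner_axis)
    also have "(\<Prod>b\<in>Basis. (?E u - ?E l) \<bullet> b) = (\<Prod>i\<in>UNIV. (u - l) $ inv \<iota> i)"
      by (simp add: Basis_vec_def inner_axis UNION_singleton_eq_range prod.reindex inj_on_def axis_eq_axis)
    also have "\<dots> = (\<Prod>j\<in>UNIV. (u - l) $ j)"
      using assms(1) by (intro prod.reindex_bij_betw bij_imp_bij_inv)
    also have "\<dots> = (\<Prod>b\<in>Basis. (u - l) \<bullet> b)"
      by (simp add: Basis_vec_def inner_axis UNION_singleton_eq_range prod.reindex inj_on_def axis_eq_axis)
    finally show "emeasure (distr lborel borel ?R) (box l u) = (\<Prod>b\<in>Basis. (u - l) \<bullet> b)" .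
  qed simp
  then have "measure lborel S = measure (distr lborel borel ?R) S" by simp
  also have "\<dots> = measure lborel (?R -` S)"
    using assms(2) by (subst measure_distr) auto
  finally show ?thesis by simp
qed

text \<open>The factor is |det f|, and a matrix and its transpose have the same determinant. That
  one c serves both maps is what makes the cell volumes of a lattice and its dual
  reciprocal.\<close>

lemma volume_linear_image_adjoint:
  fixes f :: "real ^ 'n \<Rightarrow> real ^ 'n"
  assumes f: "linear f"
  obtains c where
    "\<And>S. S \<in> sets borel \<Longrightarrow> bounded S \<Longrightarrow> f ` S \<in> sets borel \<Longrightarrow> measure lborel (f ` S) = c * measure lborel S"
    "\<And>S. S \<in> sets borel \<Longrightarrow> bounded S \<Longrightarrow> adjoint f ` S \<in> sets borel \<Longrightarrow>
      measure lborel (adjoint f ` S) = c * measure lborel S"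
proof -
  have "card (UNIV :: 'n index set) = CARD('n)"
    using type_definition.card[OF type_definition_index] by simp
  then obtain \<iota> :: "'n index \<Rightarrow> 'n" where \<iota>: "bij \<iota>"
    using finite_same_card_bij[of "UNIV :: 'n index set" "UNIV :: 'n set"] by auto
  have inv [simp]: "inv \<iota> (\<iota> j) = j" "\<iota> (inv \<iota> i) = i" for i j
    using \<iota> by (auto simp: bij_is_inj bij_is_surj surj_f_inv_f)
  define R where "R x = (\<chi> j. x $ \<iota> j)" for x :: "real ^ 'n"
  define E where "E y = (\<chi> i. y $ inv \<iota> i)" for y :: "real ^ 'n index"
  have RE [simp]: "R (E y) = y" "E (R x) = x" for x y
    by (simp_all add: R_def E_def)
  have lin: "linear R" "linear E"
    by (auto simp: R_def E_def linear_iff vec_eq_iff)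
  \<comment> \<open>\<open>R\<close> and \<open>E\<close> are adjoint to each other, so conjugation
    with them commutes with taking adjoints.\<close>
  have inner: "R x \<bullet> y = x \<bullet> E y" for x y
  proof -
    have "R x \<bullet> y = (\<Sum>j\<in>UNIV. (\<lambda>i. x $ i * y $ inv \<iota> i) (\<iota> j))"
      by (simp add: inner_vec_def R_def)
    also have "\<dots> = (\<Sum>i\<in>UNIV. x $ i * y $ inv \<iota> i)"
      using \<iota> by (intro sum.reindex_bij_betw) (simp add: bij_betw_def bij_def)
    finally show ?thesis by (simp add: inner_vec_def E_def)
  qed
  have vol: "measure lborel (R ` S) = measure lborel S" "R ` S \<in> sets borel" if "S \<in> sets borel" for S
  proof -
    have eq: "R ` S = E -` S" using RE by (auto simp: image_iff) (metis RE)+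
    have E: "E \<in> borel_measurable borel"
      unfolding E_def by (intro borel_measurable_continuous_onI continuous_intros)
    show "measure lborel (R ` S) = measure lborel S"
      unfolding eq unfolding E_def using that \<iota> by (intro reindex_volume bij_imp_bij_inv)
    show "R ` S \<in> sets borel"
      unfolding eq using measurable_sets[OF E that] by simp
  qed
  have image: "measure lborel (g ` S) = \<bar>det (matrix (R \<circ> g \<circ> E))\<bar> * measure lborel S"
    if "linear g" "S \<in> sets borel" "bounded S" "g ` S \<in> sets borel" for g S
  proof -
    have "bounded (R ` S)"
      using that(3) lin by (intro bounded_linear_image) (auto simp: linear_conv_bounded_linear)
    then have RS: "R ` S \<in> lmeasurable"
      using vol(2)[OF that(2)] by (intro bounded_set_imp_lmeasurable) auto
    have "measure lborel (g ` S) = measure lborel (R ` g ` S)" using vol that by simp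
    also have "R ` g ` S = (R \<circ> g \<circ> E) ` (R ` S)" by (simp add: image_image)
    also have "measure lborel \<dots> = measure lebesgue \<dots>"
      using vol(2)[OF that(4)] by (simp add: image_image)
    also have "\<dots> = \<bar>det (matrix (R \<circ> g \<circ> E))\<bar> * measure lebesgue (R ` S)"
      using that lin RS by (intro measure_linear_image linear_compose)
    finally show ?thesis using vol[OF that(2)] by simp
  qed
  have adj: "adjoint (R \<circ> f \<circ> E) = R \<circ> adjoint f \<circ> E"
  proof (rule adjoint_unique, intro allI)
    fix x y
    have "(R \<circ> f \<circ> E) x \<bullet> y = E x \<bullet> adjoint f (E y)" by (simp add: inner adjoint_works[OF f])
    also have "\<dots> = x \<bullet> R (adjoint f (E y))" by (metis RE(1) inner inner_commute)
    finally show "(R \<circ> f \<circ> E) x \<bullet> y = x \<bullet> (R \<circ> adjoint f \<circ> E) y" by simp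
  qed
  have "det (matrix (R \<circ> adjoint f \<circ> E)) = det (matrix (R \<circ> f \<circ> E))"
    unfolding adj[symmetric] using f lin
    by (subst matrix_adjoint) (auto intro!: linear_compose simp: det_transpose)
  then show ?thesis
    using that[of "\<bar>det (matrix (R \<circ> f \<circ> E))\<bar>"] image[OF f] image[OF adjoint_linear[OF f]] by simp
qed

section \<open>Lattices and periodization\<close>

text \<open>The map \<open>a\<close> sends a vector to its coordinates in a lattice basis, so it is
  the inverse of the basis matrix. Integer coordinates give the lattice, coordinates in [0, 1) a
  half-open cell. With charts instead of bases, \<Gamma> and its dual are treated alike.\<close>

locale lattice_chart =
  fixes a :: "real ^ 'n \<Rightarrow> real ^ 'n"
  assumes linear_chart: "linear a" and inj_chart: "inj a"
begin

definition L :: "(real ^ 'n) set" where "L = {x. \<forall>i. a x $ i \<in> \<int>}"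

definition cell :: "(real ^ 'n) set" where "cell = {x. \<forall>i. 0 \<le> a x $ i \<and> a x $ i < 1}"

lemmas chart_simps = linear_add[OF linear_chart] linear_diff[OF linear_chart]
  linear_neg[OF linear_chart] linear_0[OF linear_chart]

lemma surj_chart: "surj a"
  by (rule linear_injective_imp_surjective[OF linear_chart inj_chart]) simp

lemma a_inv: "a (inv a y) = y"
  using surj_chart by (rule surj_f_inv_f)

lemma measurable_chart [measurable]: "a \<in> borel_measurable borel"
  by (intro borel_measurable_continuous_onI linear_continuous_on)
    (simp add: linear_chart linear_conv_bounded_linear[symmetric])

lemma L_0: "0 \<in> L" by (simp add: L_def chart_simps)

lemma L_add: "x \<in> L \<Longrightarrow> y \<in> L \<Longrightarrow> x + y \<in> L" by (simp add: L_def chart_simps)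

lemma L_minus: "x \<in> L \<Longrightarrow> - x \<in> L" by (simp add: L_def chart_simps)

lemma L_diff: "x \<in> L \<Longrightarrow> y \<in> L \<Longrightarrow> x - y \<in> L" by (simp add: L_def chart_simps)

text \<open>The shift is forced coordinatewise: it has to subtract the floor. The half-open cell
  thus represents every coset of the lattice exactly once.\<close>

lemma cell_ex1: "\<exists>!g. g \<in> L \<and> y + g \<in> cell"
proof (rule ex1I)
  let ?g = "inv a (\<chi> i. - of_int \<lfloor>a y $ i\<rfloor>)"
  show "?g \<in> L \<and> y + ?g \<in> cell"
    by (auto simp: L_def cell_def chart_simps a_inv) linarith
  fix g assume g: "g \<in> L \<and> y + g \<in> cell"
  have "a g = (\<chi> i. - of_int \<lfloor>a y $ i\<rfloor>)"
  proof (rule vec_eq_iff[THEN iffD2], rule allI)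
    fix i
    obtain k where k: "a g $ i = of_int k" using g by (auto simp: L_def elim: Ints_cases)
    have "0 \<le> a y $ i + a g $ i" "a y $ i + a g $ i < 1"
      using g by (auto simp: cell_def chart_simps)
    then have "\<lfloor>a y $ i\<rfloor> = - k" unfolding k by linarith
    then show "a g $ i = (\<chi> i. - of_int \<lfloor>a y $ i\<rfloor>) $ i" by (simp add: k)
  qed
  then show "g = ?g" using inj_chart by (metis inv_f_f)
qed

lemma sets_cell [measurable]: "cell \<in> sets borel"
proof -
  have "cell = {x \<in> space borel. \<forall>i. 0 \<le> a x $ i \<and> a x $ i < 1}" by (simp add: cell_def)
  also have "\<dots> \<in> sets borel" by measurable
  finally show ?thesis .
qed

lemma image_cell: "a ` cell = {x. \<forall>i. 0 \<le> x $ i \<and> x $ i < 1}"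
proof -
  have "x \<in> a ` cell" if "\<forall>i. 0 \<le> x $ i \<and> x $ i < 1" for x
    using that by (intro image_eqI[of _ _ "inv a x"]) (auto simp: a_inv cell_def)
  then show ?thesis by (auto simp: cell_def)
qed

lemma bounded_cell: "bounded cell"
proof -
  have "bounded {x :: real ^ 'n. \<forall>i. 0 \<le> x $ i \<and> x $ i < 1}"
    by (rule bounded_subset[OF bounded_cbox[of 0 1]]) (auto simp: mem_box_cart less_imp_le)
  moreover have "bounded_linear (inv a)"
    using inj_linear_imp_inv_bounded_linear[OF _ inj_chart] linear_chart
    by (simp add: linear_conv_bounded_linear)
  ultimately have "bounded (inv a ` (a ` cell))"
    unfolding image_cell[symmetric] by (rule bounded_linear_image)
  then show ?thesis by (simp only: image_image inv_f_f[OF inj_chart] image_ident)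
qed

lemma cell_radius:
  obtains \<delta> where "0 < \<delta>" "\<And>x. x \<in> cell \<Longrightarrow> norm x < \<delta>"
proof -
  obtain B where "0 < B" "\<forall>x\<in>cell. norm x \<le> B" using bounded_cell by (auto simp: bounded_pos)
  then show ?thesis by (intro that[of "B + 1"]) auto
qed

lemma lmeasurable_cell: "cell \<in> lmeasurable"
  using bounded_cell by (intro bounded_set_imp_lmeasurable) auto

lemma measure_cell_pos: "0 < measure lborel cell"
proof -
  have "continuous_on UNIV a"
    using linear_chart by (intro linear_continuous_on) (simp add: linear_conv_bounded_linear)
  then have "open (a -` box 0 1)"
    by (intro open_vimage) auto
  moreover have "inv a (\<chi> i. 1 / 2) \<in> a -` box 0 1"
    by (simp add: a_inv mem_box_cart)
  ultimately obtain e where e: "0 < e" "ball (inv a (\<chi> i. 1 / 2)) e \<subseteq> a -` box 0 1"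
    by (meson open_contains_ball)
  have "ball (inv a (\<chi> i. 1 / 2)) e \<subseteq> cell"
    using e(2) by (force simp: cell_def mem_box_cart less_imp_le)
  then have "measure lebesgue (ball (inv a (\<chi> i. 1 / 2)) e) \<le> measure lebesgue cell"
    using lmeasurable_cell by (intro measure_mono_fmeasurable) auto
  then show ?thesis
    using content_ball_gt_0_iff[of "inv a (\<chi> i. 1 / 2)" e] e(1) by (simp del: content_ball_gt_0_iff)
qed

lemma emeasure_cell: "emeasure lborel cell = ennreal (measure lborel cell)"
  using bounded_cell emeasure_bounded_finite[of cell]
  by (intro emeasure_eq_ennreal_measure) (auto simp: less_top[symmetric])

text \<open>The chart is bounded, so lattice points in a ball have integer coordinates in a bounded
  cube.\<close>

lemma locally_finite_L: "finite (L \<inter> ball 0 r)"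
proof -
  obtain B where B: "0 < B" "\<And>x. norm (a x) \<le> B * norm x"
    using linear_bounded_pos[OF linear_chart] by blast
  define F where "F = {k :: real. k \<in> \<int> \<and> \<bar>k\<bar> \<le> B * \<bar>r\<bar>}"
  have "finite F" unfolding F_def by (rule finite_abs_int_segment)
  then have fin: "finite (PiE UNIV (\<lambda>_ :: 'n. F))" by (intro finite_PiE) auto
  have "(\<lambda>x i. a x $ i) ` (L \<inter> ball 0 r) \<subseteq> PiE UNIV (\<lambda>_. F)"
  proof safe
    fix x i assume x: "x \<in> L" "x \<in> ball 0 r"
    have "\<bar>a x $ i\<bar> \<le> B * norm x" using component_le_norm_cart[of "a x" i] B(2)[of x] by linarith
    also have "\<dots> \<le> B * \<bar>r\<bar>" using x B(1) by (intro mult_left_mono) auto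
    finally show "a x $ i \<in> F" using x by (auto simp: F_def L_def)
  qed auto
  then have "finite ((\<lambda>x i. a x $ i) ` (L \<inter> ball 0 r))" using fin by (rule finite_subset)
  moreover have "inj_on (\<lambda>x i. a x $ i) (L \<inter> ball 0 r)"
    by (rule inj_onI, rule injD[OF inj_chart]) (simp add: vec_nth_inject)
  ultimately show ?thesis by (rule finite_imageD)
qed

lemma countable_L: "countable L"
proof -
  have "L = (\<Union>k::nat. L \<inter> ball 0 (real k))"
    using reals_Archimedean2[where 'a=real] by auto
  also have "countable \<dots>"
    using locally_finite_L by (intro countable_UN) (auto intro: countable_finite)
  finally show ?thesis .
qed

text \<open>The translates of the cell by the lattice points in the ball are disjoint, cover the
  ball of radius r - \<delta> and stay in the ball of radius r + \<delta>; volumes are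
  compared.\<close>

lemma card_L_cell_bounds:
  assumes \<delta>: "0 < \<delta>" "\<And>x. x \<in> cell \<Longrightarrow> norm x < \<delta>"
  shows "measure lborel (ball (0 :: real ^ 'n) (r - \<delta>)) \<le> card (L \<inter> ball 0 r) * measure lborel cell"
    and "card (L \<inter> ball 0 r) * measure lborel cell \<le> measure lborel (ball (0 :: real ^ 'n) (r + \<delta>))"
proof -
  define T where "T = L \<inter> ball 0 r"
  define U where "U = (\<Union>t\<in>T. (+) t ` cell)"
  have T: "finite T" unfolding T_def by (rule locally_finite_L)
  have disj: "pairwise (\<lambda>s t. disjnt ((+) s ` cell) ((+) t ` cell)) T"
  proof (unfold pairwise_def, intro ballI impI)
    fix s t assume st: "s \<in> T" "t \<in> T" "s \<noteq> t"
    show "disjnt ((+) s ` cell) ((+) t ` cell)"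
    proof (rule ccontr)
      assume "\<not> ?thesis"
      then obtain x y where xy: "x \<in> cell" "y \<in> cell" "s + x = t + y" by (auto simp: disjnt_def)
      have "y + (t - s) \<in> cell" "t - s \<in> L"
        using xy st by (auto simp: T_def L_diff algebra_simps) (metis add_diff_cancel_left' add_diff_eq)
      moreover have "y + 0 \<in> cell" "0 \<in> L" using xy L_0 by auto
      ultimately have "t - s = 0" using cell_ex1[of y] by blast
      then show False using st by simp
    qed
  qed
  have meas: "(+) t ` cell \<in> lmeasurable" for t
    using lmeasurable_cell by (rule measurable_translation)
  have U: "U \<in> lmeasurable" unfolding U_def using T meas by (intro fmeasurable.finite_UN) auto
  have "measure lebesgue U = (\<Sum>t\<in>T. measure lebesgue ((+) t ` cell))"
    unfolding U_def using T meas disj by (intro measure_UNION') auto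
  then have mU: "measure lebesgue U = card T * measure lborel cell"
    by (simp add: measure_translation)
  have "ball 0 (r - \<delta>) \<subseteq> U"
  proof
    fix x :: "real ^ 'n" assume x: "x \<in> ball 0 (r - \<delta>)"
    obtain g where g: "g \<in> L" "x + g \<in> cell" using cell_ex1[of x] by blast
    have "norm (- g) < r" using x \<delta>(2)[OF g(2)] norm_triangle_ineq4[of "x + g" x] by simp
    then have "- g \<in> T" using g L_minus by (auto simp: T_def)
    moreover have "x = - g + (x + g)" by simp
    ultimately show "x \<in> U" unfolding U_def using g by blast
  qed
  then have "measure lebesgue (ball (0 :: real ^ 'n) (r - \<delta>)) \<le> measure lebesgue U"
    using U by (intro measure_mono_fmeasurable) auto
  then show "measure lborel (ball (0 :: real ^ 'n) (r - \<delta>)) \<le> card (L \<inter> ball 0 r) * measure lborel cell"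
    using mU by (simp add: T_def)
  have "U \<subseteq> ball 0 (r + \<delta>)"
  proof
    fix x assume "x \<in> U"
    then obtain t y where "t \<in> T" "y \<in> cell" "x = t + y" by (auto simp: U_def)
    then show "x \<in> ball 0 (r + \<delta>)"
      using \<delta>(2)[of y] norm_triangle_ineq[of t y] by (auto simp: T_def)
  qed
  then have "measure lebesgue U \<le> measure lebesgue (ball (0 :: real ^ 'n) (r + \<delta>))"
    using U by (intro measure_mono_fmeasurable) auto
  then show "card (L \<inter> ball 0 r) * measure lborel cell \<le> measure lborel (ball (0 :: real ^ 'n) (r + \<delta>))"
    using mU by (simp add: T_def)
qed

end

section \<open>Density and growth of a lattice\<close>

text \<open>The volume of a ball is a multiple of r^n, so for large r the ratio is (1 + c / r)^n:
  boundary shells of fixed width have density 0.\<close>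

lemma measure_ball_ratio:
  "((\<lambda>r. measure lborel (ball (0 :: real ^ 'n) (r + c)) / measure lborel (ball (0 :: real ^ 'n) r)) \<longlongrightarrow> 1) at_top"
proof (rule Lim_transform_eventually)
  let ?d = "DIM(real ^ 'n)"
  have "((\<lambda>r. (1 + c / r) ^ ?d) \<longlongrightarrow> (1 + 0) ^ ?d) at_top"
    by (intro tendsto_intros tendsto_divide_0[OF tendsto_const] filterlim_at_top_imp_at_infinity filterlim_ident)
  then show "((\<lambda>r. (1 + c / r) ^ ?d) \<longlongrightarrow> 1) at_top" by simp
  show "\<forall>\<^sub>F r in at_top. (1 + c / r) ^ ?d
    = measure lborel (ball (0 :: real ^ 'n) (r + c)) / measure lborel (ball (0 :: real ^ 'n) r)"
    using eventually_ge_at_top[of "\<bar>c\<bar> + 1"]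
  proof eventually_elim
    case (elim r)
    then have "measure lborel (ball (0 :: real ^ 'n) (r + c)) / measure lborel (ball (0 :: real ^ 'n) r)
      = ((r + c) / r) ^ ?d"
      using unit_ball_vol_pos[of "real ?d"] by (simp add: content_ball power_divide less_imp_neq[symmetric])
    also have "(r + c) / r = 1 + c / r" using elim by (simp add: field_simps)
    finally show ?case by simp
  qed
qed

context lattice_chart begin

lemma has_dens_L: "has_dens L (1 / measure lborel cell)"
  unfolding has_dens_def
proof (intro conjI allI locally_finite_L)
  obtain \<delta> where \<delta>: "0 < \<delta>" "\<And>x. x \<in> cell \<Longrightarrow> norm x < \<delta>" by (rule cell_radius) blast
  let ?v = "\<lambda>r. measure lborel (ball (0 :: real ^ 'n) r)"
  let ?c = "measure lborel cell"
  show "((\<lambda>r. card (L \<inter> ball 0 r) / ?v r) \<longlongrightarrow> 1 / ?c) at_top"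
  proof (rule tendsto_sandwich)
    have "?v (r - \<delta>) / ?v r / ?c \<le> card (L \<inter> ball 0 r) / ?v r" for r
    proof -
      have "?v (r - \<delta>) / ?c \<le> card (L \<inter> ball 0 r)"
        using card_L_cell_bounds(1)[OF \<delta>, of r] measure_cell_pos by (simp add: pos_divide_le_eq)
      then have "?v (r - \<delta>) / ?c / ?v r \<le> card (L \<inter> ball 0 r) / ?v r"
        by (intro divide_right_mono) auto
      then show ?thesis by (simp add: mult.commute)
    qed
    then show "\<forall>\<^sub>F r in at_top. ?v (r + - \<delta>) / ?v r / ?c \<le> card (L \<inter> ball 0 r) / ?v r" by simp
    have "card (L \<inter> ball 0 r) / ?v r \<le> ?v (r + \<delta>) / ?v r / ?c" for r
    proof -
      have "card (L \<inter> ball 0 r) \<le> ?v (r + \<delta>) / ?c"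
        using card_L_cell_bounds(2)[OF \<delta>, of r] measure_cell_pos by (simp add: pos_le_divide_eq)
      then have "card (L \<inter> ball 0 r) / ?v r \<le> ?v (r + \<delta>) / ?c / ?v r"
        by (intro divide_right_mono) auto
      then show ?thesis by (simp add: mult.commute)
    qed
    then show "\<forall>\<^sub>F r in at_top. card (L \<inter> ball 0 r) / ?v r \<le> ?v (r + \<delta>) / ?v r / ?c" by simp
    show "((\<lambda>r. ?v (r + - \<delta>) / ?v r / ?c) \<longlongrightarrow> 1 / ?c) at_top"
      using measure_cell_pos by (intro tendsto_divide measure_ball_ratio tendsto_const) auto
    show "((\<lambda>r. ?v (r + \<delta>) / ?v r / ?c) \<longlongrightarrow> 1 / ?c) at_top"
      using measure_cell_pos by (intro tendsto_divide measure_ball_ratio tendsto_const) auto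
  qed
qed

text \<open>From r + \<delta> \<le> (1 + \<delta>) (1 + r) the volume bound becomes growth of order
  n, which later makes combs tempered and lattice sums of Schwartz functions converge.\<close>

lemma card_L_growth:
  obtains C where "0 \<le> C" "\<And>r. 0 \<le> r \<Longrightarrow> real (card (L \<inter> ball 0 r)) \<le> C * (1 + r) ^ CARD('n)"
proof -
  obtain \<delta> where \<delta>: "0 < \<delta>" "\<And>x. x \<in> cell \<Longrightarrow> norm x < \<delta>" by (rule cell_radius) blast
  let ?V = "unit_ball_vol (real CARD('n))" and ?c = "measure lborel cell"
  show ?thesis
  proof
    show "0 \<le> ?V * (1 + \<delta>) ^ CARD('n) / ?c" using \<delta> by simp
    fix r :: real assume "0 \<le> r"
    have "card (L \<inter> ball 0 r) * ?c \<le> ?V * (r + \<delta>) ^ CARD('n)"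
      using card_L_cell_bounds(2)[OF \<delta>, of r] \<open>0 \<le> r\<close> \<delta> by (simp add: content_ball)
    also have "(r + \<delta>) ^ CARD('n) \<le> ((1 + \<delta>) * (1 + r)) ^ CARD('n)"
      using \<open>0 \<le> r\<close> \<delta> by (intro power_mono) (auto simp: algebra_simps)
    finally show "real (card (L \<inter> ball 0 r)) \<le> ?V * (1 + \<delta>) ^ CARD('n) / ?c * (1 + r) ^ CARD('n)"
      using measure_cell_pos by (simp add: pos_le_divide_eq power_mult_distrib mult_ac)
  qed
qed

section \<open>Periodization of measures along a lattice\<close>

text \<open>The convolution of M with the Dirac comb of \<open>L\<close>, written as the image of a
  product measure under addition; in this form Fubini computes its integrals.\<close>

definition periodize :: "(real ^ 'n) measure \<Rightarrow> (real ^ 'n) measure" where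
  "periodize M = distr (M \<Otimes>\<^sub>M count_space L) borel (\<lambda>(x, g). x + g)"

lemma sets_periodize [simp, measurable_cong]: "sets (periodize M) = sets borel"
  by (simp add: periodize_def)

lemma sigma_finite_L: "sigma_finite_measure (count_space L)"
  using countable_L by (rule sigma_finite_measure_count_space_countable)

lemma measurable_add_L:
  assumes "sets M = sets borel"
  shows "(\<lambda>(x, g). x + g) \<in> borel_measurable (M \<Otimes>\<^sub>M count_space L)"
proof -
  have [measurable_cong]: "sets M = sets borel" by fact
  have "(\<lambda>p. snd p) \<in> borel_measurable (M \<Otimes>\<^sub>M count_space L)"
    by (rule measurable_compose[OF measurable_snd]) simp
  moreover have "(\<lambda>p. fst p) \<in> borel_measurable (M \<Otimes>\<^sub>M count_space L)"
    by measurable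
  ultimately show ?thesis by (simp add: case_prod_beta)
qed

lemma nn_integral_periodize:
  assumes "sets M = sets borel" "f \<in> borel_measurable borel"
  shows "(\<integral>\<^sup>+x. f x \<partial>periodize M) = (\<integral>\<^sup>+x. \<integral>\<^sup>+g. f (x + g) \<partial>count_space L \<partial>M)"
proof -
  note [measurable] = measurable_add_L[OF assms(1)] assms(2)
  interpret sigma_finite_measure "count_space L" by (rule sigma_finite_L)
  have "(\<integral>\<^sup>+x. f x \<partial>periodize M) = (\<integral>\<^sup>+p. f (case p of (x, g) \<Rightarrow> x + g) \<partial>(M \<Otimes>\<^sub>M count_space L))"
    unfolding periodize_def by (rule nn_integral_distr) auto
  also have "\<dots> = (\<integral>\<^sup>+x. \<integral>\<^sup>+g. f (x + g) \<partial>count_space L \<partial>M)"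
    by (subst nn_integral_fst[symmetric]) auto
  finally show ?thesis .
qed

lemma integral_periodize:
  fixes f :: "real ^ 'n \<Rightarrow> complex"
  assumes "sets M = sets borel" "sigma_finite_measure M" "integrable (periodize M) f"
  shows "(\<integral>x. f x \<partial>periodize M) = (\<integral>x. \<integral>g. f (x + g) \<partial>count_space L \<partial>M)"
proof -
  note [measurable] = measurable_add_L[OF assms(1)]
  have [measurable]: "f \<in> borel_measurable borel"
    using borel_measurable_integrable[OF assms(3)] by simp
  interpret sigma_finite_measure "count_space L" by (rule sigma_finite_L)
  interpret M: sigma_finite_measure M by fact
  interpret pair_sigma_finite M "count_space L" ..
  have "integrable (M \<Otimes>\<^sub>M count_space L) (\<lambda>p. f (case p of (x, g) \<Rightarrow> x + g))"
    using assms(3) unfolding periodize_def by (subst (asm) integrable_distr_eq) auto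
  then have "(\<integral>x. \<integral>g. f (x + g) \<partial>count_space L \<partial>M) = (\<integral>p. f (case p of (x, g) \<Rightarrow> x + g) \<partial>(M \<Otimes>\<^sub>M count_space L))"
    by (subst integral_fst'[symmetric]) auto
  also have "\<dots> = (\<integral>x. f x \<partial>periodize M)"
    unfolding periodize_def by (rule integral_distr[symmetric]) auto
  finally show ?thesis by simp
qed

text \<open>Exactly one lattice shift takes y into the cell, so the translates of its indicator form
  a partition of unity.\<close>

lemma nn_integral_L_cell: "(\<integral>\<^sup>+g. indicator cell (y + g) \<partial>count_space L) = 1"
proof -
  obtain g0 where g0: "g0 \<in> L" "y + g0 \<in> cell" "\<And>g. g \<in> L \<Longrightarrow> y + g \<in> cell \<Longrightarrow> g = g0"
    using cell_ex1[of y] by blast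
  have "y + g \<in> cell \<longleftrightarrow> g = g0" if "g \<in> L" for g using g0 that by blast
  then have "(\<integral>\<^sup>+g. indicator cell (y + g) \<partial>count_space L) = (\<integral>\<^sup>+g. indicator {g0} g \<partial>count_space L)"
    by (intro nn_integral_cong) (simp add: indicator_def)
  also have "\<dots> = 1" using g0(1) by simp
  finally show ?thesis .
qed

text \<open>Exchange sum and integral, move the shift from X to the cell by translation invariance,
  exchange back and sum the partition of unity.\<close>

lemma lborel_eq_periodize: "lborel = periodize (density lborel (indicator cell))"
proof (rule measure_eqI)
  show "sets lborel = sets (periodize (density lborel (indicator cell)))" by simp
  fix X :: "(real ^ 'n) set" assume "X \<in> sets lborel"
  then have [measurable]: "X \<in> sets borel" by simp
  interpret sigma_finite_measure "count_space L" by (rule sigma_finite_L)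
  interpret pair_sigma_finite lborel "count_space L" ..
  note [measurable] = measurable_add_L[of lborel, unfolded case_prod_beta, simplified]
  have fst [measurable]: "(\<lambda>p. fst p) \<in> borel_measurable (lborel \<Otimes>\<^sub>M count_space L)"
    by (rule measurable_fst'') auto
  have snd [measurable]: "(\<lambda>p. snd p) \<in> borel_measurable (lborel \<Otimes>\<^sub>M count_space L)"
    by (rule measurable_compose[OF measurable_snd]) simp
  have "emeasure (periodize (density lborel (indicator cell))) X
      = (\<integral>\<^sup>+x. indicator X x \<partial>periodize (density lborel (indicator cell)))"
    by simp
  also have "\<dots> = (\<integral>\<^sup>+x. \<integral>\<^sup>+g. indicator X (x + g) \<partial>count_space L \<partial>density lborel (indicator cell))"
    by (rule nn_integral_periodize) auto
  also have "\<dots> = (\<integral>\<^sup>+x. indicator cell x * (\<integral>\<^sup>+g. indicator X (x + g) \<partial>count_space L) \<partial>lborel)"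
    by (rule nn_integral_density) (auto intro!: borel_measurable_nn_integral simp: case_prod_beta)
  also have "\<dots> = (\<integral>\<^sup>+x. \<integral>\<^sup>+g. indicator cell x * indicator X (x + g) \<partial>count_space L \<partial>lborel)"
    by (intro nn_integral_cong nn_integral_cmult[symmetric]) auto
  also have "\<dots> = (\<integral>\<^sup>+g. \<integral>\<^sup>+x. indicator cell x * indicator X (x + g) \<partial>lborel \<partial>count_space L)"
    by (rule Fubini'[symmetric]) (simp add: case_prod_beta)
  also have "\<dots> = (\<integral>\<^sup>+g. \<integral>\<^sup>+x. indicator cell (x - g) * indicator X x \<partial>lborel \<partial>count_space L)"
  proof (rule nn_integral_cong)
    fix g
    have "(\<integral>\<^sup>+x. indicator cell (x - g) * indicator X x \<partial>distr lborel borel ((+) g))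
      = (\<integral>\<^sup>+x. indicator cell (g + x - g) * indicator X (g + x) \<partial>lborel)"
      by (rule nn_integral_distr) auto
    then show "(\<integral>\<^sup>+x. indicator cell x * indicator X (x + g) \<partial>lborel) =
      (\<integral>\<^sup>+x. indicator cell (x - g) * indicator X x \<partial>lborel)"
      by (simp add: lborel_distr_plus add.commute)
  qed
  also have "\<dots> = (\<integral>\<^sup>+x. \<integral>\<^sup>+g. indicator cell (x - g) * indicator X x \<partial>count_space L \<partial>lborel)"
    by (rule Fubini') (simp add: case_prod_beta)
  also have "\<dots> = (\<integral>\<^sup>+x. (\<integral>\<^sup>+g. indicator cell (x - g) \<partial>count_space L) * indicator X x \<partial>lborel)"
    by (intro nn_integral_cong nn_integral_multc) auto
  also have "\<dots> = (\<integral>\<^sup>+x. indicator X x \<partial>lborel)"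
  proof (rule nn_integral_cong)
    fix x
    \<comment> \<open>The cells are shifted by g here, the partition of unity is stated with x + g;
      the symmetry of the lattice reconciles the two.\<close>
    have "bij_betw uminus L L"
      using L_minus by (intro bij_betwI[of _ _ _ uminus]) auto
    then have "(\<integral>\<^sup>+g. indicator cell (x - g) \<partial>count_space L) = (\<integral>\<^sup>+g. indicator cell (x + g) \<partial>count_space L)"
      by (subst nn_integral_bij_count_space[symmetric, of uminus L L]) auto
    then show "(\<integral>\<^sup>+g. indicator cell (x - g) \<partial>count_space L) * indicator X x = indicator X x"
      by (simp add: nn_integral_L_cell)
  qed
  finally show "emeasure lborel X = emeasure (periodize (density lborel (indicator cell))) X"
    by simp
qed

text \<open>Translation by a lattice point permutes \<open>L\<close>, so the inner sum is the same
  for almost every x, and total mass 1 leaves the comb itself.\<close>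

lemma periodize_eq_comb:
  assumes "prob_space M" "sets M = sets borel" "AE x in M. x \<in> L"
  shows "periodize M = dirac_comb L"
proof (rule measure_eqI)
  show "sets (periodize M) = sets (dirac_comb L)" by (simp add: dirac_comb_def weighted_comb_def)
  fix X assume "X \<in> sets (periodize M)"
  then have [measurable]: "X \<in> sets borel" by simp
  interpret prob_space M by fact
  have "emeasure (periodize M) X = (\<integral>\<^sup>+x. indicator X x \<partial>periodize M)" by simp
  also have "\<dots> = (\<integral>\<^sup>+x. \<integral>\<^sup>+g. indicator X (x + g) \<partial>count_space L \<partial>M)"
    using assms by (intro nn_integral_periodize) auto
  also have "\<dots> = (\<integral>\<^sup>+x. (\<integral>\<^sup>+g. indicator X g \<partial>count_space L) \<partial>M)"
  proof (rule nn_integral_cong_AE, use assms(3) in eventually_elim)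
    fix x assume "x \<in> L"
    then have "bij_betw ((+) x) L L"
      using L_add L_diff by (intro bij_betwI[of _ _ _ "\<lambda>y. y - x"]) auto
    then show "(\<integral>\<^sup>+g. indicator X (x + g) \<partial>count_space L) = (\<integral>\<^sup>+g. indicator X g \<partial>count_space L)"
      by (rule nn_integral_bij_count_space)
  qed
  also have "\<dots> = (\<integral>\<^sup>+g. indicator X g \<partial>count_space L)" by (simp add: emeasure_space_1)
  also have "\<dots> = (\<integral>\<^sup>+g. indicator X g \<partial>dirac_comb L)"
    unfolding dirac_comb_def weighted_comb_def
    by (subst nn_integral_distr) (auto simp: nn_integral_density)
  also have "\<dots> = emeasure (dirac_comb L) X"
    by (simp add: dirac_comb_def weighted_comb_def)
  finally show "emeasure (periodize M) X = emeasure (dirac_comb L) X" .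
qed

end

section \<open>Decay of Schwartz functions and their Fourier transforms\<close>

text \<open>Points with j \<le> w < j + 1 have mass at most C (2 + j)^k and weight at most (1 +
  j)^-(k + 2). The two extra powers leave the convergent series over 1 / (j + 1)^2.\<close>

lemma integrable_polynomial_growth:
  fixes w :: "'a \<Rightarrow> real"
  assumes [measurable]: "w \<in> borel_measurable M" and w: "\<And>x. 0 \<le> w x" and "0 \<le> C"
    and growth: "\<And>r. 0 \<le> r \<Longrightarrow> emeasure M {x \<in> space M. w x < r} \<le> ennreal (C * (1 + r) ^ k)"
  shows "integrable M (\<lambda>x. 1 / (1 + w x) ^ (k + 2))"
proof (rule integrableI_bounded)
  let ?A = "\<lambda>j :: nat. {x \<in> space M. w x < 1 + real j}"
  \<comment> \<open>Sublevel sets are used instead of shells: they count points repeatedly, which an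
    upper bound tolerates, and the growth hypothesis speaks of them directly.\<close>
  have "(\<integral>\<^sup>+x. ennreal (norm (1 / (1 + w x) ^ (k + 2))) \<partial>M)
      \<le> (\<integral>\<^sup>+x. (\<Sum>j. ennreal (1 / (1 + real j) ^ (k + 2)) * indicator (?A j) x) \<partial>M)"
  proof (rule nn_integral_mono)
    fix x assume x: "x \<in> space M"
    define j where "j = nat \<lfloor>w x\<rfloor>"
    have j: "real j \<le> w x" "w x < 1 + real j"
      using w[of x] by (auto simp: j_def) linarith+
    have "ennreal (norm (1 / (1 + w x) ^ (k + 2))) \<le> ennreal (1 / (1 + real j) ^ (k + 2)) * indicator (?A j) x"
    proof -
      have "(1 + real j) ^ (k + 2) \<le> (1 + w x) ^ (k + 2)"
        using j by (intro power_mono) auto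
      then have "1 / (1 + w x) ^ (k + 2) \<le> 1 / (1 + real j) ^ (k + 2)"
        using w[of x] by (intro divide_left_mono mult_pos_pos zero_less_power) auto
      then show ?thesis using j x w[of x] by (simp add: ennreal_leI del: power_add_numeral2)
    qed
    also have "\<dots> \<le> (\<Sum>j. ennreal (1 / (1 + real j) ^ (k + 2)) * indicator (?A j) x)"
      (is "?g j \<le> _")
    proof -
      define g where "g = ?g"
      have "g j \<le> suminf g" using sum_le_suminf[OF summableI, of "{j}" g] by simp
      then show ?thesis unfolding g_def .
    qed
    finally show "ennreal (norm (1 / (1 + w x) ^ (k + 2)))
      \<le> (\<Sum>j. ennreal (1 / (1 + real j) ^ (k + 2)) * indicator (?A j) x)" .
  qed
  also have "\<dots> = (\<Sum>j. ennreal (1 / (1 + real j) ^ (k + 2)) * emeasure M (?A j))"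
    by (subst nn_integral_suminf) (auto simp: nn_integral_cmult)
  also have "\<dots> \<le> (\<Sum>j. ennreal (C * 2 ^ k * (1 / real (Suc j) ^ 2)))"
  proof (intro suminf_le summableI)
    fix j
    have "ennreal (1 / (1 + real j) ^ (k + 2)) * emeasure M (?A j)
        \<le> ennreal (1 / (1 + real j) ^ (k + 2)) * ennreal (C * (1 + (1 + real j)) ^ k)"
      by (intro mult_left_mono growth) auto
    also have "\<dots> = ennreal (C * (2 + real j) ^ k / (1 + real j) ^ (k + 2))"
      using \<open>0 \<le> C\<close> by (subst ennreal_mult[symmetric]) auto
    also have "\<dots> \<le> ennreal (C * 2 ^ k * (1 / real (Suc j) ^ 2))"
    proof (rule ennreal_leI)
      have "(2 + real j) ^ k \<le> (2 * (1 + real j)) ^ k" by (intro power_mono) auto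
      then have "C * (2 + real j) ^ k \<le> C * (2 ^ k * (1 + real j) ^ k)"
        using \<open>0 \<le> C\<close> unfolding power_mult_distrib by (rule mult_left_mono)
      then have "C * (2 + real j) ^ k / (1 + real j) ^ (k + 2) \<le> C * (2 ^ k * (1 + real j) ^ k) / (1 + real j) ^ (k + 2)"
        by (intro divide_right_mono) auto
      also have "\<dots> = C * 2 ^ k * (1 / real (Suc j) ^ 2)"
        by (simp add: power_add add_ac power2_eq_square)
      finally show "C * (2 + real j) ^ k / (1 + real j) ^ (k + 2) \<le> C * 2 ^ k * (1 / real (Suc j) ^ 2)" .
    qed
    finally show "ennreal (1 / (1 + real j) ^ (k + 2)) * emeasure M (?A j) \<le> ennreal (C * 2 ^ k * (1 / real (Suc j) ^ 2))" .
  qed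
  also have "\<dots> < \<infinity>"
  proof -
    have "summable (\<lambda>j. 1 / real (Suc j) ^ 2)"
      using inverse_power_summable[of 2, where 'a = real] by (subst summable_Suc_iff) (simp add: inverse_eq_divide)
    then have "summable (\<lambda>j. C * 2 ^ k * (1 / real (Suc j) ^ 2))" by (rule summable_mult)
    then show ?thesis
      using \<open>0 \<le> C\<close> by (subst suminf_ennreal2) auto
  qed
  finally show "(\<integral>\<^sup>+x. ennreal (norm (1 / (1 + w x) ^ (k + 2))) \<partial>M) < \<infinity>" .
qed measurable

lemma integrable_decay_lborel:
  "integrable lborel (\<lambda>x :: real ^ 'n. 1 / (1 + norm x) ^ (CARD('n) + 2))"
proof (rule integrable_polynomial_growth)
  let ?V = "unit_ball_vol (real CARD('n))"
  fix r :: real assume "0 \<le> r"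
  have "{x \<in> space lborel. norm (x :: real ^ 'n) < r} = ball 0 r" by auto
  then have "emeasure lborel {x \<in> space lborel. norm (x :: real ^ 'n) < r} = ennreal (?V * r ^ CARD('n))"
    using \<open>0 \<le> r\<close> by (simp add: emeasure_ball)
  also have "\<dots> \<le> ennreal (?V * (1 + r) ^ CARD('n))"
    using \<open>0 \<le> r\<close> by (intro ennreal_leI mult_left_mono power_mono) auto
  finally show "emeasure lborel {x \<in> space lborel. norm (x :: real ^ 'n) < r} \<le> ennreal (?V * (1 + r) ^ CARD('n))" .
qed auto

lemma one_plus_power_le:
  fixes t :: real assumes "0 \<le> t" shows "(1 + t) ^ k \<le> 2 ^ k * (1 + t ^ k)"
proof (cases "t \<le> 1")
  case True
  then have "(1 + t) ^ k \<le> 2 ^ k" using assms by (intro power_mono) auto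
  also have "\<dots> \<le> 2 ^ k * (1 + t ^ k)" using assms by simp
  finally show ?thesis .
next
  case False
  then have "(1 + t) ^ k \<le> (2 * t) ^ k" using assms by (intro power_mono) auto
  also have "\<dots> \<le> 2 ^ k * (1 + t ^ k)" using assms by (simp add: power_mult_distrib)
  finally show ?thesis .
qed

text \<open>A Peetre-type inequality: 1 + |x| \<le> (1 + R) (1 + |x + u|). A bounded shift costs
  only a constant factor, so one dominating function serves a whole bounded family of
  shifts.\<close>

lemma one_plus_norm_shift:
  fixes x u :: "'a :: real_normed_vector"
  assumes "norm u \<le> R"
  shows "1 / (1 + norm (x + u)) ^ k \<le> (1 + R) ^ k / (1 + norm x) ^ k"
proof -
  have R: "0 \<le> R" using assms norm_ge_zero order_trans by blast
  have "norm x \<le> norm (x + u) + R" using assms norm_triangle_ineq4[of "x + u" u] by simp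
  also have "\<dots> \<le> norm (x + u) + R + R * norm (x + u)" using R by simp
  finally have "1 + norm x \<le> (1 + R) * (1 + norm (x + u))" by (simp add: algebra_simps)
  then have "(1 + norm x) ^ k \<le> ((1 + R) * (1 + norm (x + u))) ^ k" by (intro power_mono) auto
  moreover have "0 < (1 + norm x) ^ k" "0 < (1 + norm (x + u)) ^ k"
    by (intro zero_less_power add_pos_nonneg; simp)+
  ultimately show ?thesis
    by (simp add: pos_le_divide_eq pos_divide_le_eq power_mult_distrib)
qed

section \<open>Schwartz functions and polynomial decay\<close>

lemma iter_partial_append: "iter_partial (xs @ ys) f = iter_partial xs (iter_partial ys f)"
  by (induction xs) auto

lemma schwartz_iter_partial: "schwartz f \<Longrightarrow> schwartz (iter_partial is f)"
  unfolding schwartz_def iter_partial_append[symmetric] by blast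

lemma schwartz_differentiable: "schwartz f \<Longrightarrow> f differentiable (at x)"
  unfolding schwartz_def by (metis iter_partial.simps(1))

lemma schwartz_continuous: "schwartz f \<Longrightarrow> continuous_on UNIV f"
  by (meson continuous_at_imp_continuous_on differentiable_imp_continuous_within schwartz_differentiable)

lemma schwartz_measurable: "schwartz f \<Longrightarrow> f \<in> borel_measurable borel"
  by (intro borel_measurable_continuous_onI schwartz_continuous)

text \<open>Up to the factor 2^k, the bounds for the norm powers 0 and k together control (1 +
  |x|)^k.\<close>

lemma schwartz_decay:
  assumes "schwartz f"
  obtains C where "0 \<le> C" "\<And>x. norm (f x) \<le> C / (1 + norm x) ^ k"
proof -
  have "bounded (range (\<lambda>x. norm x ^ j *\<^sub>R f x))" for j
    using assms unfolding schwartz_def by (metis iter_partial.simps(1))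
  then have "\<exists>B. \<forall>x. norm (norm x ^ j *\<^sub>R f x) \<le> B" for j
    by (auto simp: bounded_iff)
  then obtain B where B: "\<And>j x. norm (norm x ^ j *\<^sub>R f x) \<le> B j" by metis
  have B0: "0 \<le> B j" for j using B norm_ge_zero order_trans by blast
  show ?thesis
  proof
    show "0 \<le> 2 ^ k * (B 0 + B k)" using B0 by simp
    fix x
    have "(1 + norm x) ^ k * norm (f x) \<le> 2 ^ k * (1 + norm x ^ k) * norm (f x)"
      by (intro mult_right_mono one_plus_power_le) auto
    also have "\<dots> = 2 ^ k * (norm (norm x ^ 0 *\<^sub>R f x) + norm (norm x ^ k *\<^sub>R f x))"
      by (simp add: algebra_simps)
    also have "\<dots> \<le> 2 ^ k * (B 0 + B k)" by (intro mult_left_mono add_mono B) auto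
    finally show "norm (f x) \<le> 2 ^ k * (B 0 + B k) / (1 + norm x) ^ k"
      by (simp add: pos_le_divide_eq add_pos_nonneg mult.commute)
  qed
qed

lemma integrable_of_decay:
  fixes f :: "'a \<Rightarrow> complex"
  assumes "f \<in> borel_measurable M" "integrable M (\<lambda>x. 1 / (1 + w x) ^ k)"
    and "\<And>x. norm (f x) \<le> C / (1 + w x) ^ k"
  shows "integrable M f"
proof (rule Bochner_Integration.integrable_bound[OF integrable_mult_right[OF assms(2), of C] assms(1)])
  have "norm (f x) \<le> norm (C * (1 / (1 + w x) ^ k))" for x
    using order_trans[OF assms(3)[of x] abs_ge_self] by simp
  then show "AE x in M. norm (f x) \<le> norm (C * (1 / (1 + w x) ^ k))" by simp
qed

text \<open>Schwartz functions decay to order k + 2, which beats growth of order k.\<close>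

lemma tempered_measureI:
  fixes M :: "(real ^ 'n) measure"
  assumes "sets M = sets borel" "0 \<le> C"
    and "\<And>r. 0 \<le> r \<Longrightarrow> emeasure M (ball 0 r) \<le> ennreal (C * (1 + r) ^ k)"
  shows "tempered_measure M"
  unfolding tempered_measure_def
proof (intro conjI allI impI assms(1))
  fix f :: "real ^ 'n \<Rightarrow> complex" assume f: "schwartz f"
  have [measurable_cong]: "sets M = sets borel" by fact
  have [measurable]: "f \<in> borel_measurable borel" using f by (rule schwartz_measurable)
  have "space M = UNIV" using sets_eq_imp_space_eq[OF assms(1)] by simp
  then have "{x \<in> space M. norm x < r} = ball 0 r" for r by auto
  then have "integrable M (\<lambda>x. 1 / (1 + norm x) ^ (k + 2))"
    using assms(2,3) by (intro integrable_polynomial_growth[where C=C]) auto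
  moreover obtain C' where "\<And>x. norm (f x) \<le> C' / (1 + norm x) ^ (k + 2)"
    using schwartz_decay[OF f] by blast
  moreover have "f \<in> borel_measurable M" by measurable
  ultimately show "integrable M f" by (intro integrable_of_decay)
qed

lemma schwartz_integrable_lborel:
  fixes f :: "real ^ 'n \<Rightarrow> complex"
  assumes "schwartz f" shows "integrable lborel f"
proof -
  obtain C' where "\<And>x. norm (f x) \<le> C' / (1 + norm x) ^ (CARD('n) + 2)"
    using schwartz_decay[OF assms] by blast
  moreover have "f \<in> borel_measurable lborel" using schwartz_measurable[OF assms] by simp
  ultimately show ?thesis using integrable_decay_lborel by (intro integrable_of_decay)
qed

section \<open>Integrals of directional derivatives\<close>

text \<open>The mean value inequality for h restricted to a segment. It dominates difference
  quotients by the derivative along e.\<close>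

lemma norm_line_difference_le:
  fixes h :: "'a :: euclidean_space \<Rightarrow> complex"
  assumes diff: "\<And>x. h differentiable (at x)" and "0 \<le> s"
    and bound: "\<And>\<tau>. 0 \<le> \<tau> \<Longrightarrow> \<tau> \<le> s \<Longrightarrow> norm (frechet_derivative h (at (x + \<tau> *\<^sub>R e)) e) \<le> B"
  shows "norm (h (x + s *\<^sub>R e) - h x) \<le> B * s"
proof -
  let ?d = "\<lambda>\<tau>. frechet_derivative h (at (x + \<tau> *\<^sub>R e))"
  have "norm (h (x + s *\<^sub>R e) - h (x + 0 *\<^sub>R e)) \<le> B * norm (s - 0)"
  proof (rule differentiable_bound[of "{0..s}" "\<lambda>\<tau>. h (x + \<tau> *\<^sub>R e)" "\<lambda>\<tau> t. t *\<^sub>R ?d \<tau> e"])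
    fix \<tau> assume \<tau>: "\<tau> \<in> {0..s}"
    have h: "(h has_derivative ?d \<tau>) (at (x + \<tau> *\<^sub>R e))"
      using diff by (simp add: frechet_derivative_works[symmetric])
    then have lin: "linear (?d \<tau>)" by (rule has_derivative_linear)
    have "((\<lambda>\<tau>. x + \<tau> *\<^sub>R e) has_derivative (\<lambda>t. t *\<^sub>R e)) (at \<tau> within {0..s})"
      by (auto intro!: derivative_eq_intros)
    from has_derivative_compose[OF this, of h, OF h]
    have "((\<lambda>\<tau>. h (x + \<tau> *\<^sub>R e)) has_derivative (\<lambda>t. ?d \<tau> (t *\<^sub>R e))) (at \<tau> within {0..s})" .
    then show "((\<lambda>\<tau>. h (x + \<tau> *\<^sub>R e)) has_derivative (\<lambda>t. t *\<^sub>R ?d \<tau> e)) (at \<tau> within {0..s})"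
      using linear_cmul[OF lin] by simp
    show "onorm (\<lambda>t. t *\<^sub>R ?d \<tau> e) \<le> B"
      using bound[of \<tau>] \<tau> by (intro onorm_le) (auto simp: mult.commute[of B] mult_left_mono)
  qed (use \<open>0 \<le> s\<close> in auto)
  then show ?thesis using \<open>0 \<le> s\<close> by simp
qed

text \<open>The difference quotients have integral \<open>0\<close> by translation invariance.\<close>

lemma integral_directional_derivative_eq_0:
  fixes h :: "real ^ 'n \<Rightarrow> complex"
  assumes diff: "\<And>x. h differentiable (at x)" and e: "norm e \<le> 1"
    and decay: "\<And>x. norm (h x) \<le> C / (1 + norm x) ^ (CARD('n) + 2)"
      "\<And>x. norm (frechet_derivative h (at x) e) \<le> C / (1 + norm x) ^ (CARD('n) + 2)"
  shows "(\<integral>x. frechet_derivative h (at x) e \<partial>lborel) = 0"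
proof -
  let ?k = "CARD('n) + 2"
  have "continuous_on UNIV h"
    using diff by (meson continuous_at_imp_continuous_on differentiable_imp_continuous_within)
  then have hm [measurable]: "h \<in> borel_measurable borel" by (rule borel_measurable_continuous_onI)
  have hint: "integrable lborel h"
    using integrable_of_decay[OF _ integrable_decay_lborel decay(1)] by simp
  define s where "s m = 1 / real (Suc m)" for m
  define q where "q m x = (h (x + s m *\<^sub>R e) - h x) /\<^sub>R s m" for m x
  have s: "0 < s m" "s m \<le> 1" for m by (auto simp: s_def)
  have s0: "s \<longlonglongrightarrow> 0" unfolding s_def using LIMSEQ_inverse_real_of_nat by (simp add: inverse_eq_divide)
  have lim: "(\<lambda>m. q m x) \<longlonglongrightarrow> frechet_derivative h (at x) e" for x
  proof -
    let ?d = "frechet_derivative h (at x)"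
    have h: "(h has_derivative ?d) (at x)" using diff by (simp add: frechet_derivative_works[symmetric])
    then have lin: "linear ?d" by (rule has_derivative_linear)
    have "((\<lambda>\<tau>. h (x + \<tau> *\<^sub>R e)) has_derivative (\<lambda>t. ?d (t *\<^sub>R e))) (at 0)"
      using h by (intro has_derivative_compose[of "\<lambda>\<tau>. x + \<tau> *\<^sub>R e" "\<lambda>\<tau>. \<tau> *\<^sub>R e" 0 UNIV h])
        (auto intro!: derivative_eq_intros)
    then have "(\<lambda>y. norm (h (x + (0 + y) *\<^sub>R e) - h (x + 0 *\<^sub>R e) - ?d (y *\<^sub>R e)) / norm y) \<midarrow>0\<rightarrow> 0"
      unfolding has_derivative_at by blast
    moreover have "filterlim s (at 0) sequentially"
      using s s0 by (auto simp: filterlim_at less_imp_neq[symmetric])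
    ultimately have "(\<lambda>m. norm (h (x + (0 + s m) *\<^sub>R e) - h (x + 0 *\<^sub>R e) - ?d (s m *\<^sub>R e)) / norm (s m)) \<longlonglongrightarrow> 0"
      by (rule filterlim_compose)
    moreover have "norm (h (x + (0 + s m) *\<^sub>R e) - h (x + 0 *\<^sub>R e) - ?d (s m *\<^sub>R e)) / norm (s m) = norm (q m x - ?d e)" for m
    proof -
      have "q m x - ?d e = (h (x + s m *\<^sub>R e) - h x - ?d (s m *\<^sub>R e)) /\<^sub>R s m"
        using s[of m] by (simp add: q_def linear_cmul[OF lin] scaleR_diff_right)
      then show ?thesis using s[of m] by (simp add: divide_inverse mult.commute)
    qed
    ultimately have "(\<lambda>m. norm (q m x - ?d e)) \<longlonglongrightarrow> 0" by simp
    then show ?thesis by (rule LIM_zero_cancel[OF tendsto_norm_zero_cancel])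
  qed
  have qint0: "(\<integral>x. q m x \<partial>lborel) = 0" for m
  proof -
    have "integrable (distr lborel borel ((+) (s m *\<^sub>R e))) h" using hint by (simp add: lborel_distr_plus)
    then have i: "integrable lborel (\<lambda>x. h (x + s m *\<^sub>R e))"
      by (subst (asm) integrable_distr_eq) (auto simp: add.commute)
    have "(\<integral>x. h x \<partial>distr lborel borel ((+) (s m *\<^sub>R e))) = (\<integral>x. h (x + s m *\<^sub>R e) \<partial>lborel)"
      by (subst integral_distr) (auto simp: add.commute)
    then show ?thesis unfolding q_def using i hint by (simp add: lborel_distr_plus)
  qed
  have C: "0 \<le> C" using order_trans[OF norm_ge_zero decay(1)[of 0]] by simp
  have "(\<lambda>m. \<integral>x. q m x \<partial>lborel) \<longlonglongrightarrow> (\<integral>x. frechet_derivative h (at x) e \<partial>lborel)"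
  \<comment> \<open>The factor \<open>2 ^ ?k\<close> is the price in
    \<open>one_plus_norm_shift\<close> of a shift of norm at most 1; the step \<open>s m\<close> and
    the norm of e are both at most 1.\<close>
  proof (rule integral_dominated_convergence[where w="\<lambda>x. C * 2 ^ ?k * (1 / (1 + norm x) ^ ?k)"])
    show qm: "q m \<in> borel_measurable lborel" for m unfolding q_def by measurable
    show "(\<lambda>x. frechet_derivative h (at x) e) \<in> borel_measurable lborel"
      by (rule borel_measurable_LIMSEQ_metric[OF qm]) (use lim in auto)
    show "integrable lborel (\<lambda>x. C * 2 ^ ?k * (1 / (1 + norm (x :: real ^ 'n)) ^ ?k))"
      using integrable_decay_lborel by (rule integrable_mult_right)
    show "AE x in lborel. norm (q m x) \<le> C * 2 ^ ?k * (1 / (1 + norm x) ^ ?k)" for m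
    proof (intro always_eventually allI)
      fix x
      have "norm (h (x + s m *\<^sub>R e) - h x) \<le> C * ((1 + 1) ^ ?k / (1 + norm x) ^ ?k) * s m"
      proof (rule norm_line_difference_le[OF diff])
        fix \<tau> assume \<tau>: "0 \<le> \<tau>" "\<tau> \<le> s m"
        have "norm (\<tau> *\<^sub>R e) \<le> 1" using \<tau> s[of m] e by (simp add: mult_le_one)
        then have "C * (1 / (1 + norm (x + \<tau> *\<^sub>R e)) ^ ?k) \<le> C * ((1 + 1) ^ ?k / (1 + norm x) ^ ?k)"
          using C by (intro mult_left_mono one_plus_norm_shift)
        then show "norm (frechet_derivative h (at (x + \<tau> *\<^sub>R e)) e) \<le> C * ((1 + 1) ^ ?k / (1 + norm x) ^ ?k)"
          using decay(2)[of "x + \<tau> *\<^sub>R e"] by simp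
      qed (use s[of m] in auto)
      then have "norm (h (x + s m *\<^sub>R e) - h x) / s m \<le> C * ((1 + 1) ^ ?k / (1 + norm x) ^ ?k)"
        using s[of m] by (simp only: pos_divide_le_eq)
      then show "norm (q m x) \<le> C * 2 ^ ?k * (1 / (1 + norm x) ^ ?k)"
        using s[of m] by (simp add: q_def divide_inverse mult.commute)
    qed
  qed (use lim in auto)
  then show ?thesis unfolding qint0 using LIMSEQ_unique tendsto_const by blast
qed

section \<open>Decay of Fourier transforms\<close>

abbreviation character :: "real ^ 'n \<Rightarrow> real ^ 'n \<Rightarrow> complex" where
  "character t y \<equiv> exp (- 2 * of_real pi * \<i> * of_real (t \<bullet> y))"

lemma norm_character: "norm (character t y) = 1"
  by (simp add: norm_exp_eq_Re)

lemma measurable_character [measurable]: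
  "(\<lambda>y. character t y) \<in> borel_measurable borel" "(\<lambda>t. character t y) \<in> borel_measurable borel"
  by (intro borel_measurable_continuous_onI continuous_intros)+

lemma norm_fourier_le: "norm (fourier f t) \<le> (\<integral>y. norm (f y) \<partial>lborel)"
proof -
  have "norm (fourier f t) \<le> (\<integral>y. norm (character t y * f y) \<partial>lborel)"
    unfolding fourier_def by (rule integral_norm_bound)
  then show ?thesis by (simp only: norm_mult norm_character mult_1)
qed

text \<open>Integration by parts without boundary terms: the derivative of the product of the
  character and f integrates to 0, and the derivative of the character contributes -2 pi i times the
  j-th coordinate of t.\<close>

lemma fourier_partial:
  fixes f :: "real ^ 'n \<Rightarrow> complex"
  assumes f: "schwartz f"
  shows "fourier (iter_partial [j] f) t = 2 * of_real pi * \<i> * of_real (t $ j) * fourier f t"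
proof -
  let ?k = "CARD('n) + 2" and ?\<chi> = "character t" and ?c = "2 * complex_of_real pi * \<i> * of_real (t $ j)"
  have f': "schwartz (iter_partial [j] f)" using f by (rule schwartz_iter_partial)
  have der: "((\<lambda>y. ?\<chi> y * f y) has_derivative
      (\<lambda>v. ?\<chi> y * frechet_derivative f (at y) v + (- 2 * of_real pi * \<i> * of_real (t \<bullet> v)) * ?\<chi> y * f y)) (at y)" for y
  proof -
    have d: "(f has_derivative frechet_derivative f (at y)) (at y)"
      using schwartz_differentiable[OF f] by (simp add: frechet_derivative_works[symmetric])
    have chi: "(?\<chi> has_derivative (\<lambda>v. (- 2 * of_real pi * \<i> * of_real (t \<bullet> v)) * ?\<chi> y)) (at y)"
    proof -
      have "((\<lambda>y. - 2 * of_real pi * \<i> * complex_of_real (t \<bullet> y)) has_derivative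
          (\<lambda>v. - 2 * of_real pi * \<i> * of_real (t \<bullet> v))) (at y)"
        by (auto intro!: derivative_eq_intros)
      from has_derivative_compose[OF this DERIV_exp[THEN has_field_derivative_imp_has_derivative]]
      show ?thesis by (simp add: mult.commute)
    qed
    show ?thesis using has_derivative_mult[OF chi d] .
  qed
  then have fd: "frechet_derivative (\<lambda>y. ?\<chi> y * f y) (at y) (axis j 1) = ?\<chi> y * iter_partial [j] f y - ?c * (?\<chi> y * f y)" for y
    unfolding frechet_derivative_at[OF der, symmetric] by (simp add: inner_axis)
  obtain C1 where C1: "0 \<le> C1" "\<And>x. norm (f x) \<le> C1 / (1 + norm x) ^ ?k"
    using schwartz_decay[OF f] by blast
  obtain C2 where C2: "0 \<le> C2" "\<And>x. norm (iter_partial [j] f x) \<le> C2 / (1 + norm x) ^ ?k"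
    using schwartz_decay[OF f'] by blast
  have int: "integrable lborel (\<lambda>y. ?\<chi> y * g y)" if "schwartz g" for g :: "real ^ 'n \<Rightarrow> complex"
  proof (rule Bochner_Integration.integrable_bound[OF schwartz_integrable_lborel[OF that]])
    show "(\<lambda>y. ?\<chi> y * g y) \<in> borel_measurable lborel"
      using schwartz_measurable[OF that] by measurable
  qed (simp add: norm_mult norm_character)
  \<comment> \<open>One constant has to bound both the product and its derivative.\<close>
  define C where "C = C2 + (norm ?c + 1) * C1"
  have "(\<integral>y. frechet_derivative (\<lambda>y. ?\<chi> y * f y) (at y) (axis j 1) \<partial>lborel) = 0"
  proof (rule integral_directional_derivative_eq_0)
    show "(\<lambda>y. ?\<chi> y * f y) differentiable at y" for y using der by (auto simp: differentiable_def)
    show "norm (axis j (1 :: real)) \<le> 1" by simp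
    fix y :: "real ^ 'n"
    have "C1 \<le> C" using C1(1) C2(1) by (simp add: C_def algebra_simps)
    then have "C1 / (1 + norm y) ^ ?k \<le> C / (1 + norm y) ^ ?k" by (intro divide_right_mono) auto
    then show "norm (?\<chi> y * f y) \<le> C / (1 + norm y) ^ ?k"
      using C1(2)[of y] by (simp add: norm_mult norm_character)
    have "norm (frechet_derivative (\<lambda>y. ?\<chi> y * f y) (at y) (axis j 1)) \<le> norm (iter_partial [j] f y) + norm ?c * norm (f y)"
      unfolding fd by (rule norm_triangle_le_diff) (simp add: norm_mult norm_character)
    also have "\<dots> \<le> C2 / (1 + norm y) ^ ?k + norm ?c * (C1 / (1 + norm y) ^ ?k)"
      by (intro add_mono C2 mult_left_mono C1) auto
    also have "\<dots> = (C2 + norm ?c * C1) / (1 + norm y) ^ ?k" by (simp add: add_divide_distrib)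
    also have "\<dots> \<le> C / (1 + norm y) ^ ?k"
      using C1(1) by (intro divide_right_mono) (auto simp: C_def algebra_simps)
    finally show "norm (frechet_derivative (\<lambda>y. ?\<chi> y * f y) (at y) (axis j 1)) \<le> C / (1 + norm y) ^ ?k" .
  qed
  then have "(\<integral>y. ?\<chi> y * iter_partial [j] f y - ?c * (?\<chi> y * f y) \<partial>lborel) = 0" unfolding fd .
  then have "(\<integral>y. ?\<chi> y * iter_partial [j] f y \<partial>lborel) - ?c * (\<integral>y. ?\<chi> y * f y \<partial>lborel) = 0"
    using int[OF f] int[OF f'] by (subst (asm) Bochner_Integration.integral_diff) auto
  then show ?thesis unfolding fourier_def by simp
qed

lemma fourier_iter_partial:
  assumes "schwartz f"
  shows "fourier (iter_partial (replicate m j) f) t = (2 * of_real pi * \<i> * of_real (t $ j)) ^ m * fourier f t"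
proof (induction m)
  case (Suc m)
  have "iter_partial (replicate (Suc m) j) f = iter_partial [j] (iter_partial (replicate m j) f)" by simp
  then show ?case
    using fourier_partial[OF schwartz_iter_partial[OF assms, of "replicate m j"], of j t] Suc by simp
qed simp

text \<open>A pure derivative of order k controls the k-th power of a single coordinate. For each t
  the coordinate of largest modulus is taken, because norm t is at most n times that
  modulus.\<close>

lemma fourier_decay:
  fixes f :: "real ^ 'n \<Rightarrow> complex"
  assumes f: "schwartz f"
  obtains C where "0 \<le> C" "\<And>t. norm (fourier f t) \<le> C / (1 + norm t) ^ k"
proof -
  define I where "I j = (\<integral>y. norm (iter_partial (replicate k j) f y) \<partial>lborel)" for j
  define I0 where "I0 = (\<integral>y. norm (f y) \<partial>lborel)"
  have I: "\<bar>t $ j\<bar> ^ k * norm (fourier f t) \<le> I j" for t j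
  proof -
    have "\<bar>t $ j\<bar> ^ k * norm (fourier f t) \<le> (2 * pi * \<bar>t $ j\<bar>) ^ k * norm (fourier f t)"
      using pi_gt3 by (intro mult_right_mono power_mono) (auto simp: mult_le_cancel_right1 intro: mult_nonneg_nonneg)
    also have "\<dots> = norm (fourier (iter_partial (replicate k j) f) t)"
      by (simp add: fourier_iter_partial[OF f] norm_mult norm_power)
    also have "\<dots> \<le> I j" unfolding I_def by (rule norm_fourier_le)
    finally show ?thesis .
  qed
  have nonneg: "0 \<le> I j" "0 \<le> I0" for j by (auto simp: I_def I0_def)
  let ?n = "real CARD('n)"
  show ?thesis
  proof
    show "0 \<le> 2 ^ k * (I0 + ?n ^ k * (\<Sum>j\<in>UNIV. I j))" using nonneg by (simp add: sum_nonneg)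
    fix t :: "real ^ 'n"
    have "Max (range (\<lambda>i. \<bar>t $ i\<bar>)) \<in> range (\<lambda>i. \<bar>t $ i\<bar>)" by (rule Max_in) auto
    then obtain j where "Max (range (\<lambda>i. \<bar>t $ i\<bar>)) = \<bar>t $ j\<bar>" by blast
    then have j: "\<bar>t $ i\<bar> \<le> \<bar>t $ j\<bar>" for i
      using Max_ge[of "range (\<lambda>i. \<bar>t $ i\<bar>)" "\<bar>t $ i\<bar>"] by simp
    have "norm t \<le> (\<Sum>i\<in>UNIV. \<bar>t $ i\<bar>)" by (rule norm_le_l1_cart)
    also have "\<dots> \<le> (\<Sum>i\<in>(UNIV :: 'n set). \<bar>t $ j\<bar>)" by (intro sum_mono j)
    finally have "norm t ^ k \<le> (?n * \<bar>t $ j\<bar>) ^ k" by (intro power_mono) auto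
    then have "norm t ^ k * norm (fourier f t) \<le> (?n * \<bar>t $ j\<bar>) ^ k * norm (fourier f t)"
      by (intro mult_right_mono) auto
    also have "\<dots> = ?n ^ k * (\<bar>t $ j\<bar> ^ k * norm (fourier f t))" by (simp add: power_mult_distrib)
    also have "\<dots> \<le> ?n ^ k * I j" by (intro mult_left_mono I) auto
    also have "\<dots> \<le> ?n ^ k * (\<Sum>j\<in>UNIV. I j)"
      using nonneg by (intro mult_left_mono member_le_sum) auto
    finally have tk: "norm t ^ k * norm (fourier f t) \<le> ?n ^ k * (\<Sum>j\<in>UNIV. I j)" .
    have "(1 + norm t) ^ k * norm (fourier f t) \<le> 2 ^ k * (1 + norm t ^ k) * norm (fourier f t)"
      by (intro mult_right_mono one_plus_power_le) auto
    also have "\<dots> = 2 ^ k * (norm (fourier f t) + norm t ^ k * norm (fourier f t))"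
      by (simp add: algebra_simps)
    also have "\<dots> \<le> 2 ^ k * (I0 + ?n ^ k * (\<Sum>j\<in>UNIV. I j))"
      using norm_fourier_le[of f t] tk by (intro mult_left_mono add_mono) (auto simp: I0_def)
    finally show "norm (fourier f t) \<le> 2 ^ k * (I0 + ?n ^ k * (\<Sum>j\<in>UNIV. I j)) / (1 + norm t) ^ k"
      by (simp add: pos_le_divide_eq add_pos_nonneg mult.commute)
  qed
qed

lemma measurable_fourier:
  assumes "schwartz f" shows "fourier f \<in> borel_measurable borel"
proof -
  have [measurable]: "f \<in> borel_measurable borel" using assms by (rule schwartz_measurable)
  have [measurable]: "(\<lambda>p. character (fst p) (snd p)) \<in> borel_measurable (borel \<Otimes>\<^sub>M borel)"
    unfolding borel_prod by (intro borel_measurable_continuous_onI continuous_intros)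
  have "(\<lambda>x. \<integral>y. character x y * f y \<partial>lborel) \<in> borel_measurable borel"
    by (intro sigma_finite_measure.borel_measurable_lebesgue_integral) (auto simp: case_prod_beta lborel.sigma_finite_measure_axioms)
  then show ?thesis unfolding fourier_def[abs_def] .
qed

section \<open>Uniqueness of tempered measures\<close>

text \<open>The polynomial parameter makes the family closed under differentiation: the derivative
  of p(1/t) exp(-1/t) is q(1/t) exp(-1/t) with q = X^2 (p - p'). Smoothness of exp(-1/t) at 0 thus
  becomes a single induction.\<close>

definition flat_exp :: "real poly \<Rightarrow> real \<Rightarrow> real" where
  "flat_exp p t = (if 0 < t then poly p (1 / t) * exp (- (1 / t)) else 0)"

lemma poly_times_exp_tendsto_0: "((\<lambda>s :: real. poly p s * exp (- s)) \<longlongrightarrow> 0) at_top"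
proof -
  have "((\<lambda>s. \<Sum>i\<le>degree p. coeff p i * (s ^ i / exp s)) \<longlongrightarrow> (\<Sum>i\<le>degree p. coeff p i * 0)) at_top"
    by (intro tendsto_sum tendsto_mult tendsto_const tendsto_power_div_exp_0)
  moreover have "poly p s * exp (- s) = (\<Sum>i\<le>degree p. coeff p i * (s ^ i / exp s))" for s :: real
    by (simp add: poly_altdef sum_distrib_right exp_minus divide_inverse mult.assoc)
  ultimately show ?thesis by simp
qed

lemma flat_exp_has_derivative:
  "(flat_exp p has_real_derivative flat_exp ([:0, 0, 1:] * (p - pderiv p)) t) (at t)"
proof -
  consider "0 < t" | "t < 0" | "t = 0" by linarith
  then show ?thesis
  proof cases
    case 1
    have "((\<lambda>t. poly p (1 / t) * exp (- (1 / t))) has_real_derivative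
        flat_exp ([:0, 0, 1:] * (p - pderiv p)) t) (at t)"
      using 1 by (auto intro!: derivative_eq_intros DERIV_chain2[of "poly p"] poly_DERIV
          simp: flat_exp_def field_simps power2_eq_square)
    then show ?thesis
      by (rule DERIV_cong_ev[THEN iffD1, rotated -1, OF _ refl])
        (use 1 in \<open>auto simp: flat_exp_def intro!: eventually_mono[OF eventually_nhds_in_open[of "{0<..}" t]]\<close>)
  next
    case 2
    have "((\<lambda>t. 0) has_real_derivative flat_exp ([:0, 0, 1:] * (p - pderiv p)) t) (at t)"
      using 2 by (simp add: flat_exp_def)
    then show ?thesis
      by (rule DERIV_cong_ev[THEN iffD1, rotated -1, OF _ refl])
        (use 2 in \<open>auto simp: flat_exp_def intro!: eventually_mono[OF eventually_nhds_in_open[of "{..<0}" t]]\<close>)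
  next
    case 3
    have "((\<lambda>h. flat_exp p h / h) \<longlongrightarrow> 0) (at_right 0)"
    proof -
      \<comment> \<open>\<open>pCons 0 p\<close> is X p; the factor X accounts for the 1 / h of the
        difference quotient.\<close>
      have "((\<lambda>h. poly (pCons 0 p) (inverse h) * exp (- inverse h)) \<longlongrightarrow> 0) (at_right 0)"
        by (rule filterlim_compose[OF poly_times_exp_tendsto_0 filterlim_inverse_at_top_right])
      then show ?thesis
        by (rule Lim_transform_eventually)
          (use eventually_at_right_less[of 0] in eventually_elim, auto simp: flat_exp_def field_simps)
    qed
    moreover have "((\<lambda>h. flat_exp p h / h) \<longlongrightarrow> 0) (at_left 0)"
      by (rule Lim_transform_eventually[OF tendsto_const])
        (auto simp: flat_exp_def eventually_at_filter)
    ultimately have "((\<lambda>h. flat_exp p h / h) \<longlongrightarrow> 0) (at 0)"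
      by (simp add: filterlim_split_at)
    then show ?thesis
      unfolding 3 DERIV_def by (simp add: flat_exp_def)
  qed
qed

text \<open>Differentiability up to order \<open>n\<close>; the head-first recursion of \<^const>\<open>iter_partial\<close> differentiates
  on the outside, whereas induction needs the innermost derivative.\<close>

definition diff_upto :: "nat \<Rightarrow> (real ^ 'n \<Rightarrow> complex) \<Rightarrow> bool" where
  "diff_upto n f \<longleftrightarrow> (\<forall>is. length is \<le> n \<longrightarrow> (\<forall>x. iter_partial is f differentiable (at x)))"

lemma diff_upto_0: "diff_upto 0 f \<longleftrightarrow> (\<forall>x. f differentiable (at x))"
  by (auto simp: diff_upto_def)

lemma diff_upto_Suc:
  "diff_upto (Suc n) f \<longleftrightarrow> (\<forall>x. f differentiable (at x)) \<and> (\<forall>i. diff_upto n (iter_partial [i] f))"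
proof (intro iffI conjI allI)
  assume f: "diff_upto (Suc n) f"
  show "f differentiable (at x)" for x using f unfolding diff_upto_def by (metis iter_partial.simps(1) le0 list.size(3))
  show "diff_upto n (iter_partial [i] f)" for i
    unfolding diff_upto_def iter_partial_append[symmetric] using f by (auto simp: diff_upto_def)
next
  assume f: "(\<forall>x. f differentiable (at x)) \<and> (\<forall>i. diff_upto n (iter_partial [i] f))"
  show "diff_upto (Suc n) f"
    unfolding diff_upto_def
  proof (intro allI impI)
    fix "is" :: "'a list" and x assume len: "length is \<le> Suc n"
    show "iter_partial is f differentiable (at x)"
    proof (cases "is" rule: rev_cases)
      case (snoc js i)
      then show ?thesis using f len by (simp add: iter_partial_append diff_upto_def del: iter_partial.simps(2))
    qed (use f in simp)
  qed
qed

lemma diff_upto_mono: "diff_upto n f \<Longrightarrow> m \<le> n \<Longrightarrow> diff_upto m f"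
  unfolding diff_upto_def by auto

lemma diff_upto_differentiable: "diff_upto n f \<Longrightarrow> f differentiable (at x)"
  using diff_upto_mono[of n f 0] by (simp add: diff_upto_0)

lemma diff_upto_const: "diff_upto n (\<lambda>_. c)"
proof (induction n arbitrary: c)
  case (Suc n)
  have "iter_partial [i] (\<lambda>_. c) = (\<lambda>_ :: real ^ 'n. 0)" for i by (auto simp: fun_eq_iff)
  then show ?case using Suc by (simp add: diff_upto_Suc)
qed (simp add: diff_upto_0)

lemma diff_upto_add:
  "diff_upto n f \<Longrightarrow> diff_upto n g \<Longrightarrow> diff_upto n (\<lambda>x. f x + g x)"
proof (induction n arbitrary: f g)
  case (Suc n)
  have "iter_partial [i] (\<lambda>x. f x + g x) = (\<lambda>x. iter_partial [i] f x + iter_partial [i] g x)" for i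
  proof
    fix x
    have "(f has_derivative frechet_derivative f (at x)) (at x)" "(g has_derivative frechet_derivative g (at x)) (at x)"
      using Suc.prems[THEN diff_upto_differentiable] by (simp_all add: frechet_derivative_works[symmetric])
    from frechet_derivative_at[OF has_derivative_add[OF this], symmetric]
    show "iter_partial [i] (\<lambda>x. f x + g x) x = iter_partial [i] f x + iter_partial [i] g x" by simp
  qed
  then show ?case using Suc by (simp add: diff_upto_Suc)
qed (simp add: diff_upto_0)

lemma diff_upto_mult:
  "diff_upto n f \<Longrightarrow> diff_upto n g \<Longrightarrow> diff_upto n (\<lambda>x. f x * g x)"
proof (induction n arbitrary: f g)
  case (Suc n)
  have "iter_partial [i] (\<lambda>x. f x * g x) = (\<lambda>x. f x * iter_partial [i] g x + iter_partial [i] f x * g x)" for i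
  proof
    fix x
    have "(f has_derivative frechet_derivative f (at x)) (at x)" "(g has_derivative frechet_derivative g (at x)) (at x)"
      using Suc.prems[THEN diff_upto_differentiable] by (simp_all add: frechet_derivative_works[symmetric])
    from frechet_derivative_at[OF has_derivative_mult[OF this], symmetric]
    show "iter_partial [i] (\<lambda>x. f x * g x) x = f x * iter_partial [i] g x + iter_partial [i] f x * g x" by simp
  qed
  moreover have "diff_upto n f" "diff_upto n g" using Suc.prems by (auto intro: diff_upto_mono)
  ultimately show ?case
    using Suc by (simp add: diff_upto_Suc diff_upto_add del: iter_partial.simps(2))
qed (simp add: diff_upto_0)

lemma diff_upto_prod:
  "finite I \<Longrightarrow> (\<And>i. i \<in> I \<Longrightarrow> diff_upto n (f i)) \<Longrightarrow> diff_upto n (\<lambda>x. \<Prod>i\<in>I. f i x)"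
  by (induction I rule: finite_induct) (auto intro: diff_upto_mult diff_upto_const)

text \<open>The induction runs over all p at once, since each partial derivative is a constant times
  another member of the family.\<close>

lemma diff_upto_flat_exp:
  fixes i :: "'n :: finite"
  shows "diff_upto n (\<lambda>x :: real ^ 'n. of_real (flat_exp p (c * x $ i + d)))"
proof (induction n arbitrary: p)
  case (0 p)
  have "((\<lambda>x. of_real (flat_exp p (c * x $ i + d)) :: complex) has_derivative
    (\<lambda>v. of_real (c * v $ i * flat_exp ([:0, 0, 1:] * (p - pderiv p)) (c * x $ i + d)))) (at x)" for x :: "real ^ 'n"
    by (intro has_derivative_of_real DERIV_compose_FDERIV[OF flat_exp_has_derivative])
      (auto intro!: derivative_eq_intros bounded_linear_imp_has_derivative bounded_linear_vec_nth)
  then show ?case by (auto simp: diff_upto_0 differentiable_def)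
next
  case (Suc n p)
  let ?q = "[:0, 0, 1:] * (p - pderiv p)"
  have der: "((\<lambda>x. of_real (flat_exp p (c * x $ i + d)) :: complex) has_derivative
    (\<lambda>v. of_real (c * v $ i * flat_exp ?q (c * x $ i + d)))) (at x)" for x :: "real ^ 'n"
    by (intro has_derivative_of_real DERIV_compose_FDERIV[OF flat_exp_has_derivative])
      (auto intro!: derivative_eq_intros bounded_linear_imp_has_derivative bounded_linear_vec_nth)
  have "iter_partial [j] (\<lambda>x. of_real (flat_exp p (c * x $ i + d)))
    = (\<lambda>x. of_real (c * axis j 1 $ i) * of_real (flat_exp ?q (c * x $ i + d)))" for j :: 'n
    by (simp add: fun_eq_iff frechet_derivative_at[OF der, symmetric])
  then show ?case
    using der Suc unfolding diff_upto_Suc by (auto simp: differentiable_def intro!: diff_upto_mult diff_upto_const)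
qed

section \<open>Bump functions approximating boxes\<close>

text \<open>All derivatives vanish on the open set \<open>R < norm x\<close>, where f is locally 0,
  and are continuous, hence bounded, on the complementary compact ball.\<close>

lemma schwartz_compact_support:
  assumes diff: "\<And>n. diff_upto n f" and supp: "\<And>x. R < norm x \<Longrightarrow> f x = 0"
  shows "schwartz f"
  unfolding schwartz_def
proof (intro allI conjI)
  fix "is" x
  show d: "iter_partial is f differentiable (at x)" for x "is"
    using diff[of "length is"] by (simp add: diff_upto_def)
  fix k :: nat
  have 0: "iter_partial is f x = 0" if "R < norm x" for x "is"
    using that
  proof (induction "is" arbitrary: x)
    case (Cons i "is")
    have "(iter_partial is f has_derivative frechet_derivative (iter_partial is f) (at x)) (at x)"
      using d frechet_derivative_works by blast
    then have "((\<lambda>_. 0) has_derivative frechet_derivative (iter_partial is f) (at x)) (at x)"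
      by (rule has_derivative_transform_within_open[where s = "{y. R < norm y}"])
        (use Cons in \<open>auto intro!: open_Collect_less continuous_intros\<close>)
    then have "frechet_derivative (iter_partial is f) (at x) = (\<lambda>_. 0)"
      by (rule has_derivative_unique) simp
    then show ?case by simp
  qed (use supp in simp)
  have "continuous_on UNIV (\<lambda>x. norm x ^ k *\<^sub>R iter_partial is f x)"
    using d by (intro continuous_intros)
      (meson continuous_at_imp_continuous_on differentiable_imp_continuous_within)
  then have "compact ((\<lambda>x. norm x ^ k *\<^sub>R iter_partial is f x) ` cball 0 R)"
    by (intro compact_continuous_image) (auto intro: continuous_on_subset)
  then have "bounded (insert 0 ((\<lambda>x. norm x ^ k *\<^sub>R iter_partial is f x) ` cball 0 R))"
    by (simp add: compact_imp_bounded)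
  then show "bounded (range (\<lambda>x. norm x ^ k *\<^sub>R iter_partial is f x))"
  proof (rule bounded_subset)
    show "range (\<lambda>x. norm x ^ k *\<^sub>R iter_partial is f x)
      \<subseteq> insert 0 ((\<lambda>x. norm x ^ k *\<^sub>R iter_partial is f x) ` cball 0 R)"
    proof (rule image_subsetI)
      fix x
      show "norm x ^ k *\<^sub>R iter_partial is f x
        \<in> insert 0 ((\<lambda>x. norm x ^ k *\<^sub>R iter_partial is f x) ` cball 0 R)"
        using 0[of x "is"] by (cases "norm x \<le> R") auto
    qed
  qed
qed

text \<open>At distance s inside a face the factor is exp(-1 / ((m + 1) s)), which increases to 1
  with m; on and beyond the face it is 0. Scaling the argument by m + 1 thus gives monotone
  convergence directly.\<close>

definition box_bump :: "real ^ 'n \<Rightarrow> real ^ 'n \<Rightarrow> nat \<Rightarrow> real ^ 'n \<Rightarrow> real" where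
  "box_bump l u m x =
    (\<Prod>i\<in>UNIV. flat_exp 1 (real (Suc m) * (x $ i - l $ i)) * flat_exp 1 (real (Suc m) * (u $ i - x $ i)))"

lemma flat_exp_1_nonneg: "0 \<le> flat_exp 1 t"
  by (simp add: flat_exp_def)

lemma flat_exp_1_mono: "s \<le> t \<Longrightarrow> flat_exp 1 s \<le> flat_exp 1 t"
  by (auto simp: flat_exp_def intro!: divide_left_mono)

lemma box_bump_nonneg: "0 \<le> box_bump l u m x"
  by (simp add: box_bump_def prod_nonneg flat_exp_1_nonneg)

lemma box_bump_outside: "x \<notin> box l u \<Longrightarrow> box_bump l u m x = 0"
  unfolding box_bump_def by (intro prod_zero) (auto simp: mem_box_cart flat_exp_def zero_less_mult_iff)

lemma schwartz_box_bump: "schwartz (\<lambda>x. of_real (box_bump l u m x))"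
proof -
  obtain R where R: "\<And>x. x \<in> box l u \<Longrightarrow> norm x \<le> R"
    using bounded_box[of l u] by (auto simp: bounded_iff)
  show ?thesis
  proof (rule schwartz_compact_support)
    let ?c = "real (Suc m)"
    have "(\<lambda>x. complex_of_real (box_bump l u m x)) = (\<lambda>x. \<Prod>i\<in>UNIV.
        of_real (flat_exp 1 (?c * x $ i + - ?c * l $ i)) * of_real (flat_exp 1 (- ?c * x $ i + ?c * u $ i)))"
      by (simp add: fun_eq_iff box_bump_def algebra_simps)
    then show "diff_upto n (\<lambda>x. complex_of_real (box_bump l u m x))" for n
      by (simp only: diff_upto_prod diff_upto_mult diff_upto_flat_exp finite)
    show "of_real (box_bump l u m x) = (0 :: complex)" if "R < norm x" for x
      using R[of x] box_bump_outside[of x l u m] that by force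
  qed
qed

lemma box_bump_incseq: "incseq (\<lambda>m. box_bump l u m x)"
proof (cases "x \<in> box l u")
  case True
  show ?thesis
  proof (rule incseq_SucI)
    fix m
    show "box_bump l u m x \<le> box_bump l u (Suc m) x"
      unfolding box_bump_def using True
      by (intro prod_mono conjI mult_mono flat_exp_1_mono mult_right_mono mult_nonneg_nonneg flat_exp_1_nonneg)
        (auto simp: mem_box_cart less_imp_le)
  qed
qed (simp add: box_bump_outside)

lemma box_bump_tendsto: "(\<lambda>m. box_bump l u m x) \<longlonglongrightarrow> indicator (box l u) x"
proof (cases "x \<in> box l u")
  case True
  have *: "(\<lambda>m. flat_exp 1 (real (Suc m) * t)) \<longlonglongrightarrow> 1" if "0 < t" for t :: real
  proof -
    have "(\<lambda>m. exp (- (inverse (real (Suc m)) * (1 / t)))) \<longlonglongrightarrow> exp (- (0 * (1 / t)))"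
      by (intro tendsto_intros LIMSEQ_inverse_real_of_nat)
    then show ?thesis using that by (simp add: flat_exp_def divide_inverse)
  qed
  have "(\<lambda>m. box_bump l u m x) \<longlonglongrightarrow> (\<Prod>i\<in>(UNIV :: 'a set). 1 * 1)"
    unfolding box_bump_def using True by (intro tendsto_prod tendsto_mult *) (auto simp: mem_box_cart)
  then show ?thesis using True by simp
qed (simp add: box_bump_outside)

text \<open>Points of the original box keep distance at least 1 from the faces of the box enlarged
  by 1, so each factor is at least exp(-1). Integrability of this one bump then bounds the mass of
  the box.\<close>

lemma box_bump_lower_bound:
  obtains c where "0 < c" "\<And>x. x \<in> box l u \<Longrightarrow> c \<le> box_bump (l - 1) (u + 1) 0 x"
proof
  show "0 < (\<Prod>i\<in>(UNIV :: 'a set). exp (- 1) * exp (- 1 :: real))" by (intro prod_pos) simp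
  fix x assume x: "x \<in> box l u"
  have "exp (- 1) \<le> flat_exp 1 t" if "1 \<le> t" for t :: real
    using flat_exp_1_mono[OF that] by (simp add: flat_exp_def)
  then show "(\<Prod>i\<in>(UNIV :: 'a set). exp (- 1) * exp (- 1)) \<le> box_bump (l - 1) (u + 1) 0 x"
    unfolding box_bump_def using x
    by (intro prod_mono conjI mult_mono) (auto simp: mem_box_cart flat_exp_1_nonneg algebra_simps less_imp_le)
qed

section \<open>Tempered measures are determined on boxes\<close>

lemma emeasure_box_tempered:
  assumes "tempered_measure M" shows "emeasure M (box l u) < \<infinity>"
proof -
  obtain c where c: "0 < c" "\<And>x. x \<in> box l u \<Longrightarrow> c \<le> box_bump (l - 1) (u + 1) 0 x"
    by (rule box_bump_lower_bound) blast
  have sets: "sets M = sets borel" using assms by (simp add: tempered_measure_def)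
  have "integrable M (\<lambda>x. complex_of_real (box_bump (l - 1) (u + 1) 0 x))"
    using assms[unfolded tempered_measure_def, THEN conjunct2, rule_format, OF schwartz_box_bump] .
  then have int: "integrable M (box_bump (l - 1) (u + 1) 0)" by (simp only: complex_of_real_integrable_eq)
  have "emeasure M (box l u) = (\<integral>\<^sup>+x. indicator (box l u) x \<partial>M)" by (simp add: sets)
  also have "\<dots> \<le> (\<integral>\<^sup>+x. ennreal (1 / c * box_bump (l - 1) (u + 1) 0 x) \<partial>M)"
  proof (rule nn_integral_mono)
    fix x
    show "indicator (box l u) x \<le> ennreal (1 / c * box_bump (l - 1) (u + 1) 0 x)"
    proof (cases "x \<in> box l u")
      case True
      then have "1 \<le> 1 / c * box_bump (l - 1) (u + 1) 0 x" using c by (simp add: pos_le_divide_eq)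
      from ennreal_leI[OF this] show ?thesis using True by simp
    qed simp
  qed
  also have "\<dots> = ennreal (\<integral>x. 1 / c * box_bump (l - 1) (u + 1) 0 x \<partial>M)"
    using c(1) int by (intro nn_integral_eq_integral) (auto simp: box_bump_nonneg)
  finally show ?thesis by (simp add: order_le_less_trans)
qed

lemma emeasure_bounded_tempered:
  assumes "tempered_measure M" "bounded B" shows "emeasure M B < \<infinity>"
proof -
  obtain l u where "B \<subseteq> box l u" using bounded_subset_box_symmetric[OF assms(2)] by blast
  moreover have "box l u \<in> sets M" using assms(1) by (simp add: tempered_measure_def)
  ultimately have "emeasure M B \<le> emeasure M (box l u)" by (rule emeasure_mono)
  then show ?thesis using emeasure_box_tempered[OF assms(1)] by (rule order_le_less_trans)
qed

lemma emeasure_box_eq_lim_integral: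
  fixes M :: "(real ^ 'n) measure"
  assumes M: "tempered_measure M"
  shows "(\<lambda>m. ennreal (\<integral>x. box_bump l u m x \<partial>M)) \<longlonglongrightarrow> emeasure M (box l u)"
proof -
  have sets: "sets M = sets borel" using M by (simp add: tempered_measure_def)
  have int: "integrable M (box_bump l u m)" for m
    using M[unfolded tempered_measure_def, THEN conjunct2, rule_format, OF schwartz_box_bump[of l u m]]
    by (simp only: complex_of_real_integrable_eq)
  have meas: "(\<lambda>x. ennreal (box_bump l u m x)) \<in> borel_measurable M" for m
    using borel_measurable_integrable[OF int[of m]] by measurable
  have "(\<lambda>m. \<integral>\<^sup>+x. ennreal (box_bump l u m x) \<partial>M) \<longlonglongrightarrow> (\<integral>\<^sup>+x. indicator (box l u) x \<partial>M)"
  proof (rule nn_integral_LIMSEQ[OF _ meas])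
    show "incseq (\<lambda>m x. ennreal (box_bump l u m x))"
      using box_bump_incseq[of l u] by (auto simp: incseq_def le_fun_def intro: ennreal_leI)
    show "(\<lambda>m. ennreal (box_bump l u m x)) \<longlonglongrightarrow> indicator (box l u) x" for x
      using tendsto_ennrealI[OF box_bump_tendsto[of l u x]] by (simp add: ennreal_indicator)
  qed
  moreover have "(\<integral>\<^sup>+x. ennreal (box_bump l u m x) \<partial>M) = ennreal (\<integral>x. box_bump l u m x \<partial>M)" for m
    using int[of m] by (intro nn_integral_eq_integral) (auto simp: box_bump_nonneg)
  ultimately show ?thesis by (simp add: sets)
qed

text \<open>Testing against bumps gives the identity on open boxes in the limit. Boxes are stable
  under intersection, generate the Borel sets, exhaust the space and have finite mass, so they
  determine a measure. With c \<ge> 0 the right-hand side is itself a measure, \<open>K\<close>; the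
  case c = 0 yields uniqueness.\<close>

theorem tempered_measure_eq_plusI:
  fixes N M D :: "(real ^ 'n) measure"
  assumes N: "tempered_measure N" and M: "tempered_measure M" and D: "tempered_measure D" and c: "0 \<le> c"
    and eq: "\<And>f. schwartz f \<Longrightarrow> integral\<^sup>L N f = integral\<^sup>L M f + of_real c * integral\<^sup>L D f"
    and B: "B \<in> sets borel"
  shows "emeasure N B = emeasure M B + ennreal c * emeasure D B"
proof -
  have sets: "sets N = sets borel" "sets M = sets borel" "sets D = sets borel"
    using N M D by (simp_all add: tempered_measure_def)
  define K :: "(real ^ 'n) measure"
    where "K = measure_of UNIV (sets borel) (\<lambda>B. emeasure M B + ennreal c * emeasure D B)"
  have sK: "sets K = sets borel"
    unfolding K_def using sets.sigma_sets_eq[of "borel :: (real ^ 'n) measure"] by simp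
  have eK: "emeasure K X = emeasure M X + ennreal c * emeasure D X" if X: "X \<in> sets borel" for X
    unfolding K_def
  proof (rule emeasure_measure_of_sigma[OF _ _ _ X])
    show "sigma_algebra UNIV (sets (borel :: (real ^ 'n) measure))"
      using sets.sigma_algebra_axioms[of borel] by simp
    show "positive (sets borel) (\<lambda>B. emeasure M B + ennreal c * emeasure D B)"
      by (simp add: positive_def)
    show "countably_additive (sets borel) (\<lambda>B. emeasure M B + ennreal c * emeasure D B)"
    proof (rule countably_additiveI)
      fix A :: "nat \<Rightarrow> (real ^ 'n) set"
      assume A: "range A \<subseteq> sets borel" "disjoint_family A"
      then show "(\<Sum>i. emeasure M (A i) + ennreal c * emeasure D (A i))
        = emeasure M (\<Union> (range A)) + ennreal c * emeasure D (\<Union> (range A))"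
        using sets suminf_emeasure[of A M] suminf_emeasure[of A D]
        by (subst suminf_add[symmetric]) (auto simp: ennreal_suminf_cmult)
    qed
  qed
  have "N = K"
  proof (rule measure_eqI_generator_eq)
    let ?E = "range (\<lambda>(a, b). box a b :: (real ^ 'n) set)"
    show "Int_stable ?E" by (auto simp: Int_stable_def box_Int_box)
    show "?E \<subseteq> Pow UNIV" "sets N = sigma_sets UNIV ?E" "sets K = sigma_sets UNIV ?E"
      by (simp_all add: borel_eq_box sets sK)
    let ?A = "\<lambda>n::nat. box (- (real n *\<^sub>R One)) (real n *\<^sub>R One) :: (real ^ 'n) set"
    show "range ?A \<subseteq> ?E" "(\<Union>i. ?A i) = UNIV" unfolding UN_box_eq_UNIV by auto
    show "emeasure N (?A i) \<noteq> \<infinity>" for i using emeasure_box_tempered[OF N] by (simp add: less_top)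
    fix X assume "X \<in> ?E"
    then obtain l u where X: "X = box l u" by auto
    have "complex_of_real (\<integral>x. box_bump l u m x \<partial>N)
      = of_real ((\<integral>x. box_bump l u m x \<partial>M) + c * (\<integral>x. box_bump l u m x \<partial>D))" for m
      using eq[OF schwartz_box_bump[of l u m]] by simp
    then have int: "(\<integral>x. box_bump l u m x \<partial>N)
      = (\<integral>x. box_bump l u m x \<partial>M) + c * (\<integral>x. box_bump l u m x \<partial>D)" for m
      by (simp only: of_real_eq_iff)
    have "ennreal (\<integral>x. box_bump l u m x \<partial>N)
      = ennreal (\<integral>x. box_bump l u m x \<partial>M) + ennreal c * ennreal (\<integral>x. box_bump l u m x \<partial>D)" for m
      unfolding int using c by (simp add: box_bump_nonneg ennreal_mult)
    moreover have "(\<lambda>m. ennreal (\<integral>x. box_bump l u m x \<partial>M) + ennreal c * ennreal (\<integral>x. box_bump l u m x \<partial>D))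
      \<longlonglongrightarrow> emeasure M (box l u) + ennreal c * emeasure D (box l u)"
      by (intro tendsto_add ennreal_tendsto_cmult emeasure_box_eq_lim_integral M D) simp
    ultimately show "emeasure N X = emeasure K X"
      unfolding X using LIMSEQ_unique[OF emeasure_box_eq_lim_integral[OF N, of l u]] by (simp add: eK)
  qed
  then show ?thesis using eK[OF B] by simp
qed

corollary tempered_measure_eqI:
  assumes M: "tempered_measure M" and N: "tempered_measure N"
    and eq: "\<And>f. schwartz f \<Longrightarrow> integral\<^sup>L M f = integral\<^sup>L N f"
  shows "M = N"
proof (rule measure_eqI)
  show "sets M = sets N" using M N by (simp add: tempered_measure_def)
  show "emeasure M B = emeasure N B" if "B \<in> sets M" for B
    using tempered_measure_eq_plusI[OF M N N order_refl] eq that M by (simp add: tempered_measure_def)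
qed

lemma measure_fourier_eq:
  assumes "is_fourier_transform M N" shows "measure_fourier M = N"
  unfolding measure_fourier_def
proof (rule the_equality[where P = "is_fourier_transform M", OF assms])
  fix N' assume "is_fourier_transform M N'"
  with assms show "N' = N" unfolding is_fourier_transform_def by (intro tempered_measure_eqI) auto
qed

section \<open>Weighted combs\<close>

lemma sets_weighted_comb [simp, measurable_cong]: "sets (weighted_comb L w) = sets borel"
  by (simp add: weighted_comb_def)

lemma nn_integral_weighted_comb:
  assumes "f \<in> borel_measurable borel"
  shows "(\<integral>\<^sup>+x. f x \<partial>weighted_comb L w) = (\<integral>\<^sup>+t. ennreal (w t) * f t \<partial>count_space L)"
  unfolding weighted_comb_def using assms
  by (subst nn_integral_distr) (auto simp: nn_integral_density)

lemma emeasure_weighted_comb: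
  assumes "B \<in> sets borel"
  shows "emeasure (weighted_comb L w) B = (\<integral>\<^sup>+t. ennreal (w t) * indicator B t \<partial>count_space L)"
  using nn_integral_weighted_comb[of "indicator B" L w] assms by simp

lemma integral_weighted_comb:
  fixes f :: "real ^ 'n \<Rightarrow> complex"
  assumes "f \<in> borel_measurable borel" "\<And>t. t \<in> L \<Longrightarrow> 0 \<le> w t"
  shows "(\<integral>x. f x \<partial>weighted_comb L w) = (\<integral>t. of_real (w t) * f t \<partial>count_space L)"
  unfolding weighted_comb_def using assms
  by (subst integral_distr) (auto simp: integral_density AE_count_space scaleR_conv_of_real)

lemma weighted_comb_cong:
  assumes "\<And>t. t \<in> L \<Longrightarrow> v t = w t"
  shows "weighted_comb L v = weighted_comb L w"
proof (rule measure_eqI)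
  fix B assume "B \<in> sets (weighted_comb L v)"
  then have B: "B \<in> sets borel" by simp
  show "emeasure (weighted_comb L v) B = emeasure (weighted_comb L w) B"
    unfolding emeasure_weighted_comb[OF B] using assms by (intro nn_integral_cong) simp
qed simp

section \<open>Temperedness of combs and periodizations, lattice sums\<close>

context lattice_chart begin

lemma emeasure_count_L: "emeasure (count_space L) {x \<in> L. norm x < r} = ennreal (card (L \<inter> ball 0 r))"
proof -
  have "{x \<in> L. norm x < r} = L \<inter> ball 0 r" by auto
  then show ?thesis using locally_finite_L[of r] by (simp add: ennreal_of_nat_eq_real_of_nat)
qed

lemma integrable_decay_L:
  "integrable (count_space L) (\<lambda>x. 1 / (1 + norm x) ^ (CARD('n) + 2))"
proof -
  obtain C where C: "0 \<le> C" "\<And>r. 0 \<le> r \<Longrightarrow> real (card (L \<inter> ball 0 r)) \<le> C * (1 + r) ^ CARD('n)"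
    by (rule card_L_growth) blast
  show ?thesis
    by (rule integrable_polynomial_growth[where C=C])
      (use C in \<open>auto simp: emeasure_count_L intro!: ennreal_leI simp del: ennreal_of_nat_eq_real_of_nat\<close>)
qed

lemma tempered_weighted_comb:
  assumes w: "\<And>t. t \<in> L \<Longrightarrow> w t \<le> K" and K: "0 \<le> K"
  shows "tempered_measure (weighted_comb L w)"
proof -
  obtain C where C: "0 \<le> C" "\<And>r. 0 \<le> r \<Longrightarrow> real (card (L \<inter> ball 0 r)) \<le> C * (1 + r) ^ CARD('n)"
    by (rule card_L_growth) blast
  show ?thesis
  proof (rule tempered_measureI)
    show "0 \<le> K * C" using K C by simp
    fix r :: real assume r: "0 \<le> r"
    have "emeasure (weighted_comb L w) (ball 0 r) = (\<integral>\<^sup>+t. ennreal (w t) * indicator (ball 0 r) t \<partial>count_space L)"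
      by (rule emeasure_weighted_comb) simp
    also have "\<dots> \<le> (\<integral>\<^sup>+t. ennreal K * indicator {x \<in> L. norm x < r} t \<partial>count_space L)"
      using w by (intro nn_integral_mono) (auto simp: indicator_def intro: ennreal_leI)
    also have "\<dots> = ennreal K * ennreal (card (L \<inter> ball 0 r))"
      by (subst nn_integral_cmult_indicator) (auto simp: emeasure_count_L)
    also have "\<dots> = ennreal (K * card (L \<inter> ball 0 r))" using K by (simp add: ennreal_mult)
    also have "\<dots> \<le> ennreal (K * C * (1 + r) ^ CARD('n))"
      using mult_left_mono[OF C(2)[OF r] K] by (intro ennreal_leI) (simp add: mult.assoc)
    finally show "emeasure (weighted_comb L w) (ball 0 r) \<le> ennreal (K * C * (1 + r) ^ CARD('n))" .
  qed simp
qed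

text \<open>If x + g lies in the ball of radius r and norm x \<le> R, then g lies in the ball of
  radius r + |R|; the growth is therefore that of the lattice.\<close>

lemma tempered_periodize:
  assumes M: "prob_space M" "sets M = sets borel" "AE x in M. norm x \<le> R" and c: "0 \<le> c"
  shows "tempered_measure (density (periodize M) (\<lambda>_. ennreal c))"
proof -
  interpret prob_space M by fact
  obtain C where C: "0 \<le> C" "\<And>r. 0 \<le> r \<Longrightarrow> real (card (L \<inter> ball 0 r)) \<le> C * (1 + r) ^ CARD('n)"
    by (rule card_L_growth) blast
  define R' where "R' = \<bar>R\<bar>"
  show ?thesis
  proof (rule tempered_measureI)
    show "0 \<le> c * (C * (1 + R') ^ CARD('n))" using c C by (simp add: R'_def)
    fix r :: real assume r: "0 \<le> r"
    have "emeasure (density (periodize M) (\<lambda>_. ennreal c)) (ball 0 r)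
        = (\<integral>\<^sup>+x. ennreal c * indicator (ball 0 r) x \<partial>periodize M)"
      by (subst emeasure_density) auto
    also have "\<dots> = (\<integral>\<^sup>+x. \<integral>\<^sup>+g. ennreal c * indicator (ball 0 r) (x + g) \<partial>count_space L \<partial>M)"
      by (rule nn_integral_periodize[OF M(2)])
        (intro borel_measurable_times_ennreal borel_measurable_indicator; simp)
    also have "\<dots> \<le> (\<integral>\<^sup>+x. ennreal (c * (C * (1 + R') ^ CARD('n) * (1 + r) ^ CARD('n))) \<partial>M)"
    proof (rule nn_integral_mono_AE, use M(3) in eventually_elim)
      fix x :: "real ^ 'n" assume x: "norm x \<le> R"
      have "(\<integral>\<^sup>+g. ennreal c * indicator (ball 0 r) (x + g) \<partial>count_space L)
          \<le> (\<integral>\<^sup>+g. ennreal c * indicator {g \<in> L. norm g < r + R'} g \<partial>count_space L)"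
      proof (rule nn_integral_mono)
        fix g assume "g \<in> space (count_space L)"
        moreover have "norm g < r + R'" if "norm (x + g) < r"
          using x that norm_triangle_ineq4[of "x + g" x] by (simp add: R'_def)
        ultimately show "ennreal c * indicator (ball 0 r) (x + g) \<le> ennreal c * indicator {g \<in> L. norm g < r + R'} g"
          by (auto simp: indicator_def)
      qed
      also have "\<dots> = ennreal c * ennreal (card (L \<inter> ball 0 (r + R')))"
        by (subst nn_integral_cmult_indicator) (auto simp: emeasure_count_L)
      also have "\<dots> = ennreal (c * card (L \<inter> ball 0 (r + R')))" using c by (simp add: ennreal_mult)
      also have "\<dots> \<le> ennreal (c * (C * (1 + R') ^ CARD('n) * (1 + r) ^ CARD('n)))"
      proof (intro ennreal_leI mult_left_mono c)
        have "real (card (L \<inter> ball 0 (r + R'))) \<le> C * (1 + (r + R')) ^ CARD('n)"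
          using r by (intro C(2)) (simp add: R'_def)
        also have "\<dots> \<le> C * ((1 + R') * (1 + r)) ^ CARD('n)"
          using r C by (intro mult_left_mono power_mono) (auto simp: R'_def algebra_simps)
        finally show "real (card (L \<inter> ball 0 (r + R'))) \<le> C * (1 + R') ^ CARD('n) * (1 + r) ^ CARD('n)"
          by (simp add: power_mult_distrib mult.assoc)
      qed
      finally show "(\<integral>\<^sup>+g. ennreal c * indicator (ball 0 r) (x + g) \<partial>count_space L)
        \<le> ennreal (c * (C * (1 + R') ^ CARD('n) * (1 + r) ^ CARD('n)))" .
    qed
    also have "\<dots> = ennreal (c * (C * (1 + R') ^ CARD('n)) * (1 + r) ^ CARD('n))"
      by (simp add: emeasure_space_1 mult_ac)
    finally show "emeasure (density (periodize M) (\<lambda>_. ennreal c)) (ball 0 r)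
      \<le> ennreal (c * (C * (1 + R') ^ CARD('n)) * (1 + r) ^ CARD('n))" .
  qed simp
qed

text \<open>This makes lattice sums of Schwartz functions test functions for weak convergence. A
  convergent sequence of arguments is bounded, so by \<open>one_plus_norm_shift\<close> one summable
  function dominates all the sums.\<close>

lemma continuous_lattice_sum:
  fixes f :: "real ^ 'n \<Rightarrow> complex"
  assumes f: "schwartz f"
  shows "continuous_on UNIV (\<lambda>x. \<integral>g. f (x + g) \<partial>count_space L)"
proof -
  let ?k = "CARD('n) + 2"
  obtain C where C: "0 \<le> C" "\<And>x. norm (f x) \<le> C / (1 + norm x) ^ ?k"
    using schwartz_decay[OF f] by blast
  have "(\<lambda>n. \<integral>g. f (u n + g) \<partial>count_space L) \<longlonglongrightarrow> (\<integral>g. f (x + g) \<partial>count_space L)"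
    if u: "u \<longlonglongrightarrow> x" for u x
  proof -
    obtain R where R: "\<And>n. norm (u n) \<le> R"
      using convergent_imp_Bseq[of u] u by (auto simp: convergent_def Bseq_def)
    show ?thesis
    proof (rule integral_dominated_convergence[where w="\<lambda>g. C * (1 + R) ^ ?k * (1 / (1 + norm g) ^ ?k)"])
      show "integrable (count_space L) (\<lambda>g. C * (1 + R) ^ ?k * (1 / (1 + norm g) ^ ?k))"
        using integrable_decay_L by (rule integrable_mult_right)
      have "(\<lambda>n. f (u n + g)) \<longlonglongrightarrow> f (x + g)" for g
        using schwartz_continuous[OF f] u
        by (intro continuous_on_tendsto_compose[of UNIV f] tendsto_intros) auto
      then show "AE g in count_space L. (\<lambda>n. f (u n + g)) \<longlonglongrightarrow> f (x + g)" by simp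
      show "AE g in count_space L. norm (f (u n + g)) \<le> C * (1 + R) ^ ?k * (1 / (1 + norm g) ^ ?k)" for n
      proof (rule always_eventually, rule allI)
        fix g
        have "norm (f (u n + g)) \<le> C * (1 / (1 + norm (g + u n)) ^ ?k)"
          using C(2)[of "u n + g"] by (simp add: add.commute[of g])
        also have "\<dots> \<le> C * ((1 + R) ^ ?k / (1 + norm g) ^ ?k)"
          using C(1) R by (intro mult_left_mono one_plus_norm_shift)
        finally show "norm (f (u n + g)) \<le> C * (1 + R) ^ ?k * (1 / (1 + norm g) ^ ?k)" by simp
      qed
    qed auto
  qed
  then show ?thesis
    unfolding continuous_on_sequentially by (auto simp: o_def)
qed

lemma integral_L_cell:
  fixes c :: complex
  shows "(\<integral>g. indicator cell (y + g) *\<^sub>R c \<partial>count_space L) = c"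
proof -
  obtain g0 where g0: "g0 \<in> L" "y + g0 \<in> cell" "\<And>g. g \<in> L \<Longrightarrow> y + g \<in> cell \<Longrightarrow> g = g0"
    using cell_ex1[of y] by blast
  have "y + g \<in> cell \<longleftrightarrow> g = g0" if "g \<in> L" for g using g0 that by blast
  then have "(\<integral>g. indicator cell (y + g) *\<^sub>R c \<partial>count_space L) = (\<integral>g. indicator {g0} g *\<^sub>R c \<partial>count_space L)"
    by (intro Bochner_Integration.integral_cong) (auto simp: indicator_def)
  also have "\<dots> = c" using g0(1) by (simp add: measure_count_space)
  finally show ?thesis .
qed

lemma sigma_finite_cell: "sigma_finite_measure (density lborel (indicator cell))"
proof -
  have "finite_measure (density lborel (indicator cell :: _ \<Rightarrow> ennreal))"
    by (rule finite_measureI) (simp add: emeasure_density emeasure_cell)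
  then show ?thesis by (simp add: finite_measure_def)
qed

lemma integral_cell_density:
  fixes f :: "real ^ 'n \<Rightarrow> complex"
  assumes [measurable]: "f \<in> borel_measurable borel"
  shows "(\<integral>x. f x \<partial>density lborel (indicator cell)) = (\<integral>x. indicator cell x *\<^sub>R f x \<partial>lborel)"
  using integral_density[of f lborel "indicator cell :: _ \<Rightarrow> real"] by (simp add: ennreal_indicator)

lemma integral_unfold:
  fixes f :: "real ^ 'n \<Rightarrow> complex"
  assumes "integrable lborel f"
  shows "(\<integral>x. f x \<partial>lborel) = (\<integral>x. \<integral>g. f (x + g) \<partial>count_space L \<partial>density lborel (indicator cell))"
  by (subst lborel_eq_periodize, rule integral_periodize)
    (use assms sigma_finite_cell in \<open>simp_all add: lborel_eq_periodize[symmetric]\<close>)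

end

section \<open>Dual lattices\<close>

lemma measure_unit_cube: "measure lborel {x :: real ^ 'n. \<forall>i. 0 \<le> x $ i \<and> x $ i < 1} = 1"
proof (rule antisym)
  let ?K = "{x :: real ^ 'n. \<forall>i. 0 \<le> x $ i \<and> x $ i < 1}"
  interpret I: lattice_chart "\<lambda>x :: real ^ 'n. x"
    by standard (auto simp: linear_iff)
  have K: "?K = I.cell" by (simp add: I.cell_def)
  have unit: "measure lborel (cbox 0 (1 :: real ^ 'n)) = 1"
    by (subst content_cbox_cart) (auto simp: interval_eq_empty_cart)
  have "measure lebesgue ?K \<le> measure lebesgue (cbox 0 (1 :: real ^ 'n))"
    unfolding K by (intro measure_mono_fmeasurable) (auto simp: I.cell_def mem_box_cart less_imp_le)
  then show "measure lborel ?K \<le> 1" using I.sets_cell by (simp add: K unit)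
  have "measure lebesgue (box 0 (1 :: real ^ 'n)) \<le> measure lebesgue ?K"
    unfolding K using I.lmeasurable_cell
    by (intro measure_mono_fmeasurable) (auto simp: I.cell_def mem_box_cart less_imp_le)
  moreover have "measure lborel (box 0 (1 :: real ^ 'n)) = measure lborel (cbox 0 (1 :: real ^ 'n))"
    by (simp add: measure_lborel_box_eq measure_lborel_cbox_eq)
  ultimately show "1 \<le> measure lborel ?K" using I.sets_cell by (simp add: K unit)
qed

text \<open>With the basis vectors as columns of \<open>A\<close>, the charts are the inverse of
  \<open>A\<close> for \<Gamma> and the adjoint of \<open>A\<close> for the dual: a vector pairs
  integrally with \<Gamma> iff its products with the basis, which are the coordinates of its image
  under the adjoint, are integers. The cells are the images of the unit cube under \<open>A\<close>
  and under the inverse of the adjoint, with volumes |det A| and 1 / |det A|.\<close>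

lemma is_lattice_charts:
  fixes \<Gamma> :: "(real ^ 'n) set"
  assumes "is_lattice \<Gamma>"
  obtains a b where "lattice_chart a" "lattice_chart b" "lattice_chart.L a = \<Gamma>"
    "lattice_chart.L b = dual_lattice \<Gamma>"
    "measure lborel (lattice_chart.cell a) * measure lborel (lattice_chart.cell b) = 1"
proof -
  obtain B where B: "independent B" "card B = CARD('n)"
    "\<Gamma> = {\<Sum>b\<in>B. of_int (k b) *\<^sub>R b | k :: real ^ 'n \<Rightarrow> int. True}"
    using assms unfolding is_lattice_def by blast
  have finB: "finite B" using B(1) by (rule independent_imp_finite)
  obtain \<beta> :: "'n \<Rightarrow> real ^ 'n" where \<beta>: "bij_betw \<beta> UNIV B"
    using finite_same_card_bij[OF finite finB] B(2) by auto
  have inv\<beta>: "inv \<beta> (\<beta> i) = i" for i using \<beta> by (simp add: bij_betw_def)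
  define A where "A x = (\<Sum>i\<in>UNIV. x $ i *\<^sub>R \<beta> i)" for x
  have sumB: "(\<Sum>v\<in>B. u v *\<^sub>R v) = A (\<chi> i. u (\<beta> i))" for u
    unfolding A_def using sum.reindex_bij_betw[OF \<beta>, of "\<lambda>v. u v *\<^sub>R v"] by simp
  have linA: "linear A"
    by (rule linearI) (auto simp: A_def scaleR_add_left sum.distrib scaleR_sum_right)
  have injA: "inj A"
  proof (unfold linear_injective_0[OF linA], intro allI impI)
    fix x assume "A x = 0"
    then have "(\<Sum>v\<in>B. x $ inv \<beta> v *\<^sub>R v) = 0" by (simp add: sumB inv\<beta>)
    then have "x $ inv \<beta> (\<beta> i) = 0" for i
      using independentD[OF B(1) finB subset_refl, of "\<lambda>v. x $ inv \<beta> v" "\<beta> i"] \<beta> by (auto simp: bij_betw_def)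
    then show "x = 0" by (simp add: vec_eq_iff inv\<beta>)
  qed
  have surjA: "surj A" by (rule linear_injective_imp_surjective[OF linA injA]) simp
  have Ai: "A (axis i 1) = \<beta> i" for i
  proof -
    have "A (axis i 1) = (\<Sum>j\<in>UNIV. if j = i then \<beta> j else 0)"
      unfolding A_def by (intro sum.cong) (auto simp: axis_def)
    then show ?thesis by simp
  qed
  have adj: "adjoint A k $ i = k \<bullet> \<beta> i" for k i
  proof -
    have "adjoint A k $ i = axis i 1 \<bullet> adjoint A k" by (simp add: inner_axis')
    also have "\<dots> = k \<bullet> \<beta> i" by (simp add: adjoint_works[OF linA] Ai inner_commute)
    finally show ?thesis .
  qed
  have injadj: "inj (adjoint A)"
  proof (unfold linear_injective_0[OF adjoint_linear[OF linA]], intro allI impI)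
    fix k assume "adjoint A k = 0"
    moreover obtain x where "A x = k" using surjA by (metis surjD)
    ultimately have "k \<bullet> k = 0" using adjoint_works[OF linA, of x k] by simp
    then show "k = 0" by simp
  qed
  interpret P: lattice_chart "inv A"
    by (rule lattice_chart.intro[OF inj_linear_imp_inv_linear[OF linA injA] surj_imp_inj_inv[OF surjA]])
  interpret Q: lattice_chart "adjoint A"
    by (rule lattice_chart.intro[OF adjoint_linear[OF linA] injadj])
  have PL: "P.L = \<Gamma>"
  proof (rule set_eqI, rule iffI)
    fix x assume "x \<in> P.L"
    then have "inv A x $ i = of_int \<lfloor>inv A x $ i\<rfloor>" for i by (simp add: P.L_def)
    then have "A (\<chi> i. of_int \<lfloor>inv A x $ inv \<beta> (\<beta> i)\<rfloor>) = A (inv A x)"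
      by (metis (no_types, lifting) inv\<beta> vec_lambda_unique)
    then have "(\<Sum>v\<in>B. of_int \<lfloor>inv A x $ inv \<beta> v\<rfloor> *\<^sub>R v) = x"
      by (simp only: sumB surj_f_inv_f[OF surjA])
    then show "x \<in> \<Gamma>" unfolding B(3) by (intro CollectI exI[of _ "\<lambda>v. \<lfloor>inv A x $ inv \<beta> v\<rfloor>"]) simp
  next
    fix x assume "x \<in> \<Gamma>"
    then obtain k where "x = A (\<chi> i. of_int (k (\<beta> i)))" unfolding B(3) sumB by auto
    then show "x \<in> P.L" by (simp add: P.L_def injA)
  qed
  have QL: "Q.L = dual_lattice \<Gamma>"
  proof (rule set_eqI, rule iffI)
    fix k assume k: "k \<in> Q.L"
    show "k \<in> dual_lattice \<Gamma>"
      unfolding dual_lattice_def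
    proof (intro CollectI ballI)
      fix v assume "v \<in> \<Gamma>"
      then obtain m where "v = A (\<chi> i. of_int (m (\<beta> i)))" unfolding B(3) sumB by auto
      then have "k \<bullet> v = (\<Sum>i\<in>UNIV. of_int (m (\<beta> i)) * (k \<bullet> \<beta> i))"
        by (simp add: A_def inner_sum_right)
      also have "\<dots> \<in> \<int>" using k by (intro Ints_sum Ints_mult) (auto simp: Q.L_def adj)
      finally show "k \<bullet> v \<in> \<int>" .
    qed
  next
    fix k assume k: "k \<in> dual_lattice \<Gamma>"
    have "\<beta> i \<in> \<Gamma>" for i
    proof -
      have "\<beta> j = \<beta> i \<longleftrightarrow> j = i" for j by (metis inv\<beta>)
      then have ax: "(axis i 1 :: real ^ 'n) = (\<chi> j. of_int (if \<beta> j = \<beta> i then 1 else 0))"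
        by (simp add: axis_def vec_eq_iff)
      have "A (axis i 1) = (\<Sum>v\<in>B. of_int (if v = \<beta> i then 1 else 0) *\<^sub>R v)"
        by (simp only: sumB ax)
      then have "\<beta> i = (\<Sum>v\<in>B. of_int (if v = \<beta> i then 1 else 0) *\<^sub>R v)"
        by (simp only: Ai)
      then show ?thesis
        unfolding B(3) by (intro CollectI exI[of _ "\<lambda>v. if v = \<beta> i then 1 else 0"]) simp
    qed
    then show "k \<in> Q.L" using k by (simp add: Q.L_def adj dual_lattice_def)
  qed
  let ?K = "{x :: real ^ 'n. \<forall>i. 0 \<le> x $ i \<and> x $ i < 1}"
  interpret I: lattice_chart "\<lambda>x :: real ^ 'n. x"
    by standard (auto simp: linear_iff)
  have K: "?K = I.cell" by (simp add: I.cell_def)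
  have Pc: "P.cell = A ` ?K"
    unfolding P.image_cell[symmetric] by (simp add: image_image surj_f_inv_f[OF surjA])
  have Qc: "adjoint A ` Q.cell = ?K" by (rule Q.image_cell)
  obtain c where c: "\<And>S. S \<in> sets borel \<Longrightarrow> bounded S \<Longrightarrow> A ` S \<in> sets borel \<Longrightarrow> measure lborel (A ` S) = c * measure lborel S"
    "\<And>S. S \<in> sets borel \<Longrightarrow> bounded S \<Longrightarrow> adjoint A ` S \<in> sets borel \<Longrightarrow>
      measure lborel (adjoint A ` S) = c * measure lborel S"
    using volume_linear_image_adjoint[OF linA] by blast
  have unit: "measure lborel ?K = 1" by (rule measure_unit_cube)
  have "measure lborel P.cell = c"
    using c(1)[of ?K] I.sets_cell I.bounded_cell P.sets_cell unit
    unfolding K[symmetric] Pc by simp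
  moreover have "c * measure lborel Q.cell = 1"
    using c(2)[of Q.cell] I.sets_cell Q.bounded_cell Q.sets_cell unit
    unfolding K[symmetric] Qc by simp
  ultimately show ?thesis
    using that P.lattice_chart_axioms Q.lattice_chart_axioms PL QL by metis
qed

section \<open>Natural density under changes of radius and translation\<close>

lemma has_dens_unique: "has_dens A d \<Longrightarrow> has_dens A e \<Longrightarrow> d = e"
  unfolding has_dens_def by (blast intro: tendsto_unique[OF trivial_limit_at_top_linorder])

lemma dens_eq: "has_dens A d \<Longrightarrow> dens A = d"
  unfolding dens_def by (blast intro: has_dens_unique)

lemma has_dens_dens: "dens_exists A \<Longrightarrow> has_dens A (dens A)"
  unfolding dens_exists_def using dens_eq by auto

lemma has_dens_shifted:
  fixes A :: "(real ^ 'n) set"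
  assumes "has_dens A d"
  shows "((\<lambda>r. card (A \<inter> ball 0 (r + c)) / measure lborel (ball (0 :: real ^ 'n) r)) \<longlongrightarrow> d) at_top"
proof (rule Lim_transform_eventually)
  let ?v = "\<lambda>r. measure lborel (ball (0 :: real ^ 'n) r)"
  have "filterlim (\<lambda>r. r + c) at_top at_top"
    by (rule filterlim_tendsto_add_at_top[of "\<lambda>_. c" c at_top "\<lambda>r. r", simplified add.commute[of c]])
      (auto intro: filterlim_ident)
  moreover have "((\<lambda>r. card (A \<inter> ball 0 r) / ?v r) \<longlongrightarrow> d) at_top"
    using assms by (simp add: has_dens_def)
  ultimately have "((\<lambda>r. card (A \<inter> ball 0 (r + c)) / ?v (r + c)) \<longlongrightarrow> d) at_top"
    by (rule filterlim_compose[rotated])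
  from tendsto_mult[OF this measure_ball_ratio[of c]]
  show "((\<lambda>r. card (A \<inter> ball 0 (r + c)) / ?v (r + c) * (?v (r + c) / ?v r)) \<longlongrightarrow> d) at_top"
    by (simp only: mult_1_right)
  show "\<forall>\<^sub>F r in at_top. card (A \<inter> ball 0 (r + c)) / ?v (r + c) * (?v (r + c) / ?v r)
      = card (A \<inter> ball 0 (r + c)) / ?v r"
    using eventually_gt_at_top[of "- c"] by eventually_elim simp
qed

text \<open>A change of the radius by a constant does not change a density, so a count that is
  uncertain only in a shell of width c keeps the density d.\<close>

lemma has_dens_sandwich:
  fixes A :: "(real ^ 'n) set"
  assumes "has_dens A d"
    and "\<And>r. card (A \<inter> ball 0 (r - c)) \<le> f r" "\<And>r. f r \<le> card (A \<inter> ball 0 (r + c))"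
  shows "((\<lambda>r. real (f r) / measure lborel (ball (0 :: real ^ 'n) r)) \<longlongrightarrow> d) at_top"
  using assms(2,3)
  by (intro tendsto_sandwich[OF _ _ has_dens_shifted[OF assms(1), of "- c"] has_dens_shifted[OF assms(1), of c]])
    (auto intro!: always_eventually divide_right_mono)

lemma has_dens_finite: "has_dens A d \<Longrightarrow> finite (A \<inter> ball 0 r)"
  by (simp add: has_dens_def)

lemma has_dens_nonneg: "has_dens A d \<Longrightarrow> 0 \<le> d"
  unfolding has_dens_def
  by (elim conjE, rule tendsto_lowerbound) (auto intro: always_eventually)

lemma has_dens_translate:
  assumes "has_dens A d" shows "has_dens ((+) t ` A) d"
proof -
  have sub: "(+) t ` A \<inter> ball 0 r \<subseteq> (+) t ` (A \<inter> ball 0 (r + norm t))" for r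
  proof clarsimp
    fix x assume "x \<in> A" "norm (t + x) < r"
    then show "t + x \<in> (+) t ` (A \<inter> ball 0 (r + norm t))"
      using norm_triangle_ineq4[of "t + x" t] by auto
  qed
  have sub': "(+) t ` (A \<inter> ball 0 (r - norm t)) \<subseteq> (+) t ` A \<inter> ball 0 r" for r
  proof clarsimp
    fix x assume "x \<in> A" "norm x < r - norm t"
    then show "norm (t + x) < r" using norm_triangle_ineq[of t x] by simp
  qed
  have fin: "finite ((+) t ` A \<inter> ball 0 r)" for r
    using sub[of r] has_dens_finite[OF assms] by (meson finite_imageI finite_subset)
  have lo: "card (A \<inter> ball 0 (r - norm t)) \<le> card ((+) t ` A \<inter> ball 0 r)" for r
    using card_mono[OF fin sub'[of r]] by (simp add: card_image)
  have up: "card ((+) t ` A \<inter> ball 0 r) \<le> card (A \<inter> ball 0 (r + norm t))" for r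
    using card_mono[OF _ sub[of r]] has_dens_finite[OF assms] by (simp add: card_image)
  show ?thesis
    unfolding has_dens_def using has_dens_sandwich[OF assms lo up] fin by blast
qed

text \<open>Cutting S off before or after the translation by u matters only within distance norm u
  of the boundary sphere. This links the densities that define \<nu> to the finite sets whose
  spectra are formed.\<close>

lemma truncated_autocorrelation_tendsto:
  fixes S :: "(real ^ 'n) set"
  assumes "has_dens (S \<inter> (+) u ` S) d"
  shows "((\<lambda>r. card ((S \<inter> ball 0 r) \<inter> (+) u ` (S \<inter> ball 0 r)) / measure lborel (ball (0 :: real ^ 'n) r)) \<longlongrightarrow> d) at_top"
proof (rule has_dens_sandwich[OF assms])
  let ?A = "S \<inter> (+) u ` S"
  fix r
  have sub: "(S \<inter> ball 0 r) \<inter> (+) u ` (S \<inter> ball 0 r) \<subseteq> ?A \<inter> ball 0 (r + norm u)" by auto (smt (verit) norm_ge_zero)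
  then show "card ((S \<inter> ball 0 r) \<inter> (+) u ` (S \<inter> ball 0 r)) \<le> card (?A \<inter> ball 0 (r + norm u))"
    using has_dens_finite[OF assms] by (intro card_mono)
  have sub': "?A \<inter> ball 0 (r - norm u) \<subseteq> (S \<inter> ball 0 r) \<inter> (+) u ` (S \<inter> ball 0 r)"
  proof
    fix x assume x: "x \<in> ?A \<inter> ball 0 (r - norm u)"
    then obtain y where y: "y \<in> S" "x = u + y" by auto
    have "norm x < r - norm u" "y = x - u" using x y by auto
    then have "norm (x - u) < r \<and> norm x < r" using norm_triangle_ineq4[of x u] norm_ge_zero[of u] by linarith
    then have "norm y < r" "norm x < r" using \<open>y = x - u\<close> by auto
    then show "x \<in> (S \<inter> ball 0 r) \<inter> (+) u ` (S \<inter> ball 0 r)" using x y by auto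
  qed
  show "card (?A \<inter> ball 0 (r - norm u)) \<le> card ((S \<inter> ball 0 r) \<inter> (+) u ` (S \<inter> ball 0 r))"
    using sub by (intro card_mono[OF _ sub']) (rule finite_subset[OF _ has_dens_finite[OF assms]])
qed

section \<open>Differences and power spectra of finite sets\<close>

text \<open>A pair with difference u is determined by s, as t = s - u, so such pairs are counted by
  the overlap of E with its translate.\<close>

lemma sum_differences:
  fixes c :: complex and E :: "'a :: real_normed_vector set"
  assumes "finite E"
  shows "(\<Sum>s\<in>E. \<Sum>t\<in>E. if s - t = u then c else 0) = of_nat (card (E \<inter> (+) u ` E)) * c"
proof -
  have "(\<Sum>s\<in>E. \<Sum>t\<in>E. if s - t = u then c else 0) = (\<Sum>s\<in>E. if s \<in> (+) u ` E then c else 0)"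
  proof (intro sum.cong refl)
    fix s assume "s \<in> E"
    have "(\<Sum>t\<in>E. if s - t = u then c else 0) = (\<Sum>t\<in>E. if t = s - u then c else 0)"
      by (intro sum.cong) (auto simp: diff_eq_eq eq_diff_eq add.commute)
    also have "\<dots> = (if s - u \<in> E then c else 0)" using assms by simp
    also have "s - u \<in> E \<longleftrightarrow> s \<in> (+) u ` E" by (force simp: image_iff)
    finally show "(\<Sum>t\<in>E. if s - t = u then c else 0) = (if s \<in> (+) u ` E then c else 0)" .
  qed
  also have "\<dots> = of_nat (card (E \<inter> (+) u ` E)) * c"
    using assms by (simp add: sum.If_cases Int_def)
  finally show ?thesis .
qed

text \<open>Pairs are grouped by their difference. The result is an integral over all of
  \<open>L\<close>, so that letting E grow becomes a limit under one fixed measure.\<close>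

lemma integral_differences:
  fixes G :: "'a :: real_normed_vector \<Rightarrow> complex"
  assumes E: "finite E" "\<And>s t. s \<in> E \<Longrightarrow> t \<in> E \<Longrightarrow> s - t \<in> L"
  shows "(\<Sum>s\<in>E. \<Sum>t\<in>E. G (s - t)) = (\<integral>u. of_nat (card (E \<inter> (+) u ` E)) * G u \<partial>count_space L)"
proof -
  have one: "integrable (count_space L) (\<lambda>u. if v = u then G u else 0)"
    "(\<integral>u. (if v = u then G u else 0) \<partial>count_space L) = G v" if "v \<in> L" for v
  proof -
    have eq: "(if v = u then G u else 0) = indicator {v} u *\<^sub>R G v" for u by simp
    show "integrable (count_space L) (\<lambda>u. if v = u then G u else 0)"
      unfolding eq using that by (intro integrable_scaleR_left integrable_real_indicator) auto
    show "(\<integral>u. (if v = u then G u else 0) \<partial>count_space L) = G v"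
      unfolding eq using that by (simp add: measure_count_space)
  qed
  have "(\<Sum>s\<in>E. \<Sum>t\<in>E. G (s - t)) = (\<Sum>s\<in>E. \<Sum>t\<in>E. \<integral>u. (if s - t = u then G u else 0) \<partial>count_space L)"
    using E by (intro sum.cong refl one(2)[symmetric]) auto
  also have "\<dots> = (\<integral>u. (\<Sum>s\<in>E. \<Sum>t\<in>E. if s - t = u then G u else 0) \<partial>count_space L)"
    using E one(1) by (subst Bochner_Integration.integral_sum; (intro Bochner_Integration.integrable_sum)?)
      (auto intro!: sum.cong Bochner_Integration.integral_sum[symmetric] Bochner_Integration.integrable_sum)
  finally show ?thesis using E(1) by (simp only: sum_differences)
qed

definition power_spectrum :: "(real ^ 'n) set \<Rightarrow> real ^ 'n \<Rightarrow> real" where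
  "power_spectrum E x = (norm (\<Sum>t\<in>E. character t x))\<^sup>2"

lemma character_add: "character (s + t) x = character s x * character t x"
  by (simp add: inner_add_left exp_add[symmetric] algebra_simps)

lemma character_add_right: "character t (x + y) = character t x * character t y"
  by (simp add: inner_add_right exp_add[symmetric] algebra_simps)

lemma character_uminus: "character (- t) x = cnj (character t x)"
  by (simp add: exp_cnj)

text \<open>Conjugation negates the index of a character, so the squared modulus expands into
  characters of differences. One side shows nonnegativity, the other the link with the
  autocorrelation.\<close>

lemma power_spectrum_eq_sum:
  "of_real (power_spectrum E x) = (\<Sum>s\<in>E. \<Sum>t\<in>E. character (s - t) x)"
proof -
  have "of_real (power_spectrum E x) = (\<Sum>s\<in>E. character s x) * cnj (\<Sum>t\<in>E. character t x)"
    unfolding power_spectrum_def by (rule complex_norm_square)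
  also have "\<dots> = (\<Sum>s\<in>E. \<Sum>t\<in>E. character s x * character (- t) x)"
    by (simp only: cnj_sum sum_product character_uminus)
  also have "\<dots> = (\<Sum>s\<in>E. \<Sum>t\<in>E. character (s - t) x)"
    by (simp only: character_add[symmetric] add_uminus_conv_diff)
  finally show ?thesis .
qed

lemma measurable_power_spectrum [measurable]: "power_spectrum E \<in> borel_measurable borel"
  unfolding power_spectrum_def[abs_def] by measurable

lemma power_spectrum_nonneg: "0 \<le> power_spectrum E x"
  by (simp add: power_spectrum_def)

lemma integrable_character_mult:
  assumes "integrable M f" and [measurable_cong]: "sets M = sets borel"
  shows "integrable M (\<lambda>x. character t x * f x)"
proof (rule Bochner_Integration.integrable_bound[OF assms(1)])
  have [measurable]: "f \<in> borel_measurable M" using assms(1) by auto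
  show "(\<lambda>x. character t x * f x) \<in> borel_measurable M" by measurable
qed (simp add: norm_mult norm_character)

lemma integral_power_spectrum_mult:
  fixes f :: "real ^ 'n \<Rightarrow> complex"
  assumes "integrable M f" "sets M = sets borel"
  shows "integrable M (\<lambda>x. of_real (power_spectrum E x) * f x)"
    and "(\<integral>x. of_real (power_spectrum E x) * f x \<partial>M) = (\<Sum>s\<in>E. \<Sum>t\<in>E. \<integral>x. character (s - t) x * f x \<partial>M)"
proof -
  note int = integrable_character_mult[OF assms]
  have eq: "of_real (power_spectrum E x) * f x = (\<Sum>s\<in>E. \<Sum>t\<in>E. character (s - t) x * f x)" for x
    by (simp only: power_spectrum_eq_sum sum_distrib_right)
  show "integrable M (\<lambda>x. of_real (power_spectrum E x) * f x)"
    unfolding eq by (intro Bochner_Integration.integrable_sum int)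
  show "(\<integral>x. of_real (power_spectrum E x) * f x \<partial>M) = (\<Sum>s\<in>E. \<Sum>t\<in>E. \<integral>x. character (s - t) x * f x \<partial>M)"
    unfolding eq by (simp only: Bochner_Integration.integral_sum Bochner_Integration.integrable_sum int)
qed

section \<open>A lattice paired with its dual: orthogonality of characters\<close>

locale dual_charts = P: lattice_chart a + Q: lattice_chart b
  for a b :: "real ^ 'n \<Rightarrow> real ^ 'n" +
  assumes dual: "Q.L = dual_lattice P.L"
    and volume: "measure lborel P.cell * measure lborel Q.cell = 1"
begin

abbreviation "vQ \<equiv> measure lborel Q.cell"

abbreviation "cell_measure \<equiv> density lborel (indicator Q.cell :: _ \<Rightarrow> ennreal)"

text \<open>Reciprocal cell volumes turn the density of the lattice into the volume of the dual
  cell; this is where the factor dens \<Gamma> comes from.\<close>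

lemma dens_P: "dens P.L = vQ"
proof -
  have "dens P.L = 1 / measure lborel P.cell" using P.has_dens_L by (rule dens_eq)
  also have "\<dots> = vQ"
    unfolding volume[symmetric] using P.measure_cell_pos by simp
  finally show ?thesis .
qed

lemma character_dual:
  assumes "t \<in> P.L" "g \<in> Q.L" shows "character t g = 1"
proof -
  have "g \<bullet> t \<in> \<int>" using assms by (simp add: dual dual_lattice_def)
  then have "t \<bullet> g \<in> \<int>" by (simp add: inner_commute)
  then obtain k where k: "t \<bullet> g = of_int k" by (rule Ints_cases)
  show ?thesis unfolding exp_eq_1 k by (auto intro: exI[of _ "- k"])
qed

lemma character_periodic: "t \<in> P.L \<Longrightarrow> g \<in> Q.L \<Longrightarrow> character t (x + g) = character t x"
  by (simp only: character_add_right character_dual mult_1_right)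

lemma power_spectrum_periodic:
  "E \<subseteq> P.L \<Longrightarrow> g \<in> Q.L \<Longrightarrow> power_spectrum E (x + g) = power_spectrum E x"
  unfolding power_spectrum_def by (intro arg_cong[where f = "\<lambda>z. (norm z)\<^sup>2"] sum.cong refl character_periodic) auto

lemma finite_measure_cell: "finite_measure cell_measure"
  by (rule finite_measureI) (simp add: emeasure_density Q.emeasure_cell)

lemma measure_cell_measure: "measure cell_measure UNIV = vQ"
  by (simp add: measure_def emeasure_density)

lemma integrable_cell_bounded:
  fixes f :: "real ^ 'n \<Rightarrow> complex"
  assumes "f \<in> borel_measurable borel" "\<And>x. norm (f x) \<le> B"
  shows "integrable cell_measure f"
proof -
  interpret finite_measure cell_measure by (rule finite_measure_cell)
  show ?thesis using assms by (intro integrable_const_bound[of _ B]) auto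
qed

text \<open>Orthogonality: a translation of the cell under which the character changes sign does not change
  the integral.\<close>

lemma integral_character_cell:
  assumes t: "t \<in> P.L"
  shows "(\<integral>x. character t x \<partial>cell_measure) = (if t = 0 then of_real vQ else 0)"
proof (cases "t = 0")
  case True
  then show ?thesis using measure_cell_measure by (simp add: scaleR_conv_of_real)
next
  case False
  \<comment> \<open>The choice gives the inner product 1/2 with t, so the character takes the value
    exp(-pi i) = -1 at v.\<close>
  define v where "v = (1 / (2 * (t \<bullet> t))) *\<^sub>R t"
  have "t \<bullet> v = 1 / 2" using False by (simp add: v_def)
  then have chi_v: "character t v = - 1"
  proof -
    have "- 2 * complex_of_real pi * \<i> * of_real (1 / 2) = - (of_real pi * \<i>)" by simp
    then show ?thesis unfolding \<open>t \<bullet> v = 1 / 2\<close> by (simp only: exp_minus exp_pi_i) simp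
  qed
  define h where "h x = indicator Q.cell x *\<^sub>R character t (v + x)" for x
  have h_meas: "h \<in> borel_measurable borel"
    unfolding h_def by (intro borel_measurable_scaleR borel_measurable_indicator borel_measurable_continuous_onI continuous_intros) simp_all
  have "emeasure lborel Q.cell < \<infinity>" by (simp add: Q.emeasure_cell)
  then have "integrable lborel (indicator Q.cell :: _ \<Rightarrow> real)"
    by (intro integrable_real_indicator) auto
  then have h_int: "integrable lborel h"
  proof (rule Bochner_Integration.integrable_bound)
    show "h \<in> borel_measurable lborel" using h_meas by simp
    show "AE x in lborel. norm (h x) \<le> norm (indicator Q.cell x :: real)"
      by (simp add: h_def norm_character)
  qed
  have shift: "integrable lborel (\<lambda>x. h (- v + x))" "(\<integral>x. h (- v + x) \<partial>lborel) = (\<integral>x. h x \<partial>lborel)"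
  proof -
    have "integrable (distr lborel borel ((+) (- v))) h" using h_int by (simp only: lborel_distr_plus)
    then show "integrable lborel (\<lambda>x. h (- v + x))"
      by (subst (asm) integrable_distr_eq) (use h_meas in simp_all)
    have "(\<integral>x. h x \<partial>distr lborel borel ((+) (- v))) = (\<integral>x. h (- v + x) \<partial>lborel)"
      by (rule integral_distr) (use h_meas in simp_all)
    then show "(\<integral>x. h (- v + x) \<partial>lborel) = (\<integral>x. h x \<partial>lborel)" by (simp only: lborel_distr_plus)
  qed
  \<comment> \<open>The shift has displaced the cell. Unfolding along the dual lattice puts it back:
    the character is periodic and the displaced cell indicators still sum to 1.\<close>
  have "(\<integral>x. h x \<partial>lborel) = (\<integral>x. \<integral>g. h (- v + (x + g)) \<partial>count_space Q.L \<partial>cell_measure)"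
    unfolding shift(2)[symmetric] using shift(1) by (rule Q.integral_unfold)
  also have "\<dots> = (\<integral>x. character t x \<partial>cell_measure)"
  proof (intro Bochner_Integration.integral_cong refl)
    fix x
    have "(\<integral>g. h (- v + (x + g)) \<partial>count_space Q.L)
        = (\<integral>g. indicator Q.cell ((- v + x) + g) *\<^sub>R character t x \<partial>count_space Q.L)"
    proof (intro Bochner_Integration.integral_cong refl)
      fix g assume "g \<in> space (count_space Q.L)"
      then have "character t (x + g) = character t x" using character_periodic[OF t] by simp
      moreover have "v + (- v + (x + g)) = x + g" by simp
      ultimately show "h (- v + (x + g)) = indicator Q.cell ((- v + x) + g) *\<^sub>R character t x"
        unfolding h_def by (simp only: add.assoc)
    qed
    then show "(\<integral>g. h (- v + (x + g)) \<partial>count_space Q.L) = character t x"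
      by (simp only: Q.integral_L_cell)
  qed
  finally have I1: "(\<integral>x. h x \<partial>lborel) = (\<integral>x. character t x \<partial>cell_measure)" .
  have "(\<integral>x. h x \<partial>lborel) = (\<integral>x. indicator Q.cell x *\<^sub>R (- character t x) \<partial>lborel)"
    unfolding h_def character_add_right chi_v by simp
  also have "\<dots> = (\<integral>x. - character t x \<partial>cell_measure)"
    by (rule Q.integral_cell_density[symmetric]) measurable
  also have "\<dots> = - (\<integral>x. character t x \<partial>cell_measure)"
    by (rule Bochner_Integration.integral_minus)
  finally have "(\<integral>x. character t x \<partial>cell_measure) = - (\<integral>x. character t x \<partial>cell_measure)"
    using I1 by simp
  moreover have "z = 0" if "z = - z" for z :: complex using that by (simp add: complex_eq_iff)
  ultimately have "(\<integral>x. character t x \<partial>cell_measure) = 0" by blast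
  then show ?thesis using False by simp
qed

text \<open>Orthogonality keeps exactly the pairs with t - s = u, so a Fourier coefficient of the
  power spectrum is a count of differences.\<close>

lemma integral_power_spectrum_character_cell:
  assumes E: "finite E" "E \<subseteq> P.L" and u: "u \<in> P.L"
  shows "(\<integral>x. of_real (power_spectrum E x) * character u x \<partial>cell_measure)
    = of_nat (card (E \<inter> (+) u ` E)) * of_real vQ"
proof -
  have "(\<integral>x. of_real (power_spectrum E x) * character u x \<partial>cell_measure)
      = (\<Sum>s\<in>E. \<Sum>t\<in>E. \<integral>x. character (s - t) x * character u x \<partial>cell_measure)"
    by (rule integral_power_spectrum_mult(2))
      (auto intro!: integrable_cell_bounded[of _ 1] simp del: exp_of_real simp: norm_character)
  also have "\<dots> = (\<Sum>s\<in>E. \<Sum>t\<in>E. if t - s = u then of_real vQ else 0)"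
  proof (intro sum.cong refl)
    fix s t assume "s \<in> E" "t \<in> E"
    then have "s - t + u \<in> P.L" using E(2) u P.L_diff P.L_add by blast
    then have "(\<integral>x. character (s - t + u) x \<partial>cell_measure) = (if s - t + u = 0 then of_real vQ else 0)"
      by (rule integral_character_cell)
    also have "s - t + u = 0 \<longleftrightarrow> t - s = u" by (auto simp: algebra_simps)
    finally show "(\<integral>x. character (s - t) x * character u x \<partial>cell_measure) = (if t - s = u then of_real vQ else 0)"
      by (simp only: character_add)
  qed
  also have "\<dots> = (\<Sum>t\<in>E. \<Sum>s\<in>E. if t - s = u then of_real vQ else 0)" by (rule sum.swap)
  finally show ?thesis using E(1) by (simp only: sum_differences)
qed

end

section \<open>Existence of the diffraction measure and Poisson summation\<close>

context dual_charts begin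

text \<open>By periodicity the power spectrum moves under the lattice sum. Unfolding then replaces
  the cell by the whole space, where each character of a difference yields a value of the Fourier
  transform of f.\<close>

lemma integral_power_spectrum_schwartz:
  assumes f: "schwartz f" and E: "finite E" "E \<subseteq> P.L"
  shows "(\<integral>x. of_real (power_spectrum E x) * (\<integral>g. f (x + g) \<partial>count_space Q.L) \<partial>cell_measure)
    = (\<integral>u. of_nat (card (E \<inter> (+) u ` E)) * fourier f u \<partial>count_space P.L)"
proof -
  note f_int = schwartz_integrable_lborel[OF f]
  have "(\<integral>x. of_real (power_spectrum E x) * (\<integral>g. f (x + g) \<partial>count_space Q.L) \<partial>cell_measure)
      = (\<integral>x. \<integral>g. of_real (power_spectrum E (x + g)) * f (x + g) \<partial>count_space Q.L \<partial>cell_measure)"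
  proof (intro Bochner_Integration.integral_cong refl)
    fix x
    have "(\<integral>g. of_real (power_spectrum E (x + g)) * f (x + g) \<partial>count_space Q.L)
        = (\<integral>g. of_real (power_spectrum E x) * f (x + g) \<partial>count_space Q.L)"
      using E(2) by (intro Bochner_Integration.integral_cong refl) (simp add: power_spectrum_periodic)
    then show "of_real (power_spectrum E x) * (\<integral>g. f (x + g) \<partial>count_space Q.L)
        = (\<integral>g. of_real (power_spectrum E (x + g)) * f (x + g) \<partial>count_space Q.L)"
      by simp
  qed
  also have "\<dots> = (\<integral>x. of_real (power_spectrum E x) * f x \<partial>lborel)"
    by (rule Q.integral_unfold[symmetric], rule integral_power_spectrum_mult(1)[OF f_int]) simp
  also have "\<dots> = (\<Sum>s\<in>E. \<Sum>t\<in>E. fourier f (s - t))"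
    using integral_power_spectrum_mult(2)[OF f_int] by (simp only: fourier_def sets_lborel)
  also have "\<dots> = (\<integral>u. of_nat (card (E \<inter> (+) u ` E)) * fourier f u \<partial>count_space P.L)"
    using E P.L_diff by (intro integral_differences) auto
  finally show ?thesis .
qed

text \<open>The divisor is the zeroth Fourier coefficient of the power spectrum on the cell.\<close>

definition normalized_spectrum :: "(real ^ 'n) set \<Rightarrow> (real ^ 'n) measure" where
  "normalized_spectrum E = density cell_measure (\<lambda>x. ennreal (power_spectrum E x / (card E * vQ)))"

lemma sets_normalized_spectrum [simp]: "sets (normalized_spectrum E) = sets borel"
  by (simp add: normalized_spectrum_def)

lemma integral_normalized_spectrum:
  fixes F :: "real ^ 'n \<Rightarrow> complex"
  assumes "F \<in> borel_measurable borel"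
  shows "(\<integral>x. F x \<partial>normalized_spectrum E)
    = (\<integral>x. of_real (power_spectrum E x) * F x \<partial>cell_measure) / of_real (card E * vQ)"
proof -
  have "(\<integral>x. F x \<partial>normalized_spectrum E)
      = (\<integral>x. (power_spectrum E x / (card E * vQ)) *\<^sub>R F x \<partial>cell_measure)"
    unfolding normalized_spectrum_def
    using assms by (intro integral_density) (auto simp: power_spectrum_nonneg)
  also have "\<dots> = (\<integral>x. (of_real (power_spectrum E x) * F x) / of_real (card E * vQ) \<partial>cell_measure)"
    by (intro Bochner_Integration.integral_cong) (auto simp: scaleR_conv_of_real)
  also have "\<dots> = (\<integral>x. of_real (power_spectrum E x) * F x \<partial>cell_measure) / of_real (card E * vQ)"
    by (rule Bochner_Integration.integral_divide_zero)
  finally show ?thesis .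
qed

lemma prob_space_normalized_spectrum:
  assumes E: "finite E" "E \<subseteq> P.L" "E \<noteq> {}"
  shows "prob_space (normalized_spectrum E)"
proof (rule prob_spaceI)
  have pos: "0 < card E * vQ" using E Q.measure_cell_pos by (simp add: card_gt_0_iff)
  have c1: "integrable cell_measure (\<lambda>x. 1 :: complex)"
    by (rule integrable_cell_bounded[of _ 1]) auto
  have "character 0 x = 1" for x :: "real ^ 'n" by simp
  then have "(\<integral>x. of_real (power_spectrum E x) * 1 \<partial>cell_measure) = complex_of_real (card E * vQ)"
    using integral_power_spectrum_character_cell[OF E(1,2) P.L_0] by simp
  then have "complex_of_real (\<integral>x. power_spectrum E x \<partial>cell_measure) = of_real (card E * vQ)"
    by simp
  then have tot: "(\<integral>x. power_spectrum E x \<partial>cell_measure) = card E * vQ" by (simp only: of_real_eq_iff)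
  have "integrable cell_measure (\<lambda>x. of_real (power_spectrum E x) * 1 :: complex)"
    using c1 by (rule integral_power_spectrum_mult(1)) simp
  then have int: "integrable cell_measure (power_spectrum E)"
    by (simp add: complex_of_real_integrable_eq)
  have "emeasure (normalized_spectrum E) (space (normalized_spectrum E))
      = (\<integral>\<^sup>+x. ennreal (power_spectrum E x / (card E * vQ)) \<partial>cell_measure)"
    unfolding normalized_spectrum_def by (subst emeasure_density) (auto intro!: nn_integral_cong)
  also have "\<dots> = ennreal (\<integral>x. power_spectrum E x / (card E * vQ) \<partial>cell_measure)"
    using int by (intro nn_integral_eq_integral) (auto simp: power_spectrum_nonneg)
  also have "(\<integral>x. power_spectrum E x / (card E * vQ) \<partial>cell_measure) = 1"
    using tot pos by (auto simp: zero_less_mult_iff)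
  finally show "emeasure (normalized_spectrum E) (space (normalized_spectrum E)) = 1" by simp
qed

lemma AE_normalized_spectrum:
  assumes "\<And>x. x \<in> Q.cell \<Longrightarrow> P x" and [measurable]: "Measurable.pred borel P"
  shows "AE x in normalized_spectrum E. P x"
proof -
  have "AE x in cell_measure. P x"
    by (subst AE_density) (use assms(1) in \<open>auto simp: indicator_def\<close>)
  then show ?thesis
    unfolding normalized_spectrum_def by (subst AE_density) auto
qed

section \<open>The limit spectrum and existence of the diffraction measure\<close>

text \<open>Characters and lattice sums of Schwartz functions are both continuous, hence test
  functions for the same weak limit \<mu>. Weak convergence holds only along a subsequence, but the
  truncated coefficients converge along all radii, so the values of these integrals do not depend on
  its choice. Positive density permits the normalization.\<close>

lemma limit_spectrum:
  assumes S: "S \<subseteq> P.L" and ex: "\<And>u. autocorr_coeff_exists S u" and pos: "0 < dens S"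
  shows "\<exists>\<mu> C. prob_space \<mu> \<and> sets \<mu> = sets borel \<and> (AE x in \<mu>. norm x \<le> C) \<and>
    (\<forall>u\<in>P.L. (\<integral>x. character u x \<partial>\<mu>) = of_real (autocorr_coeff S u / dens S)) \<and>
    (\<forall>f. schwartz f \<longrightarrow> of_real (dens S * vQ) * (\<integral>x. \<integral>g. f (x + g) \<partial>count_space Q.L \<partial>\<mu>)
       = (\<integral>u. of_real (autocorr_coeff S u) * fourier f u \<partial>count_space P.L))"
proof -
  let ?v = "\<lambda>r. measure lborel (ball (0 :: real ^ 'n) r)"
  define E where "E r = S \<inter> ball 0 r" for r
  \<comment> \<open>\<open>N r u\<close> is the autocorrelation coefficient of the truncated set,
    \<open>N r 0\<close> its density in the ball; for lattice vectors u the quotient is a Fourier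
    coefficient of the normalized spectrum.\<close>
  define N where "N r u = card (E r \<inter> (+) u ` E r) / ?v r" for r u
  have Efin: "finite (E r)" for r
    unfolding E_def using S by (intro finite_subset[OF _ P.locally_finite_L[of r]]) auto
  have EP: "E r \<subseteq> P.L" for r using S by (auto simp: E_def)
  have N_lim: "((\<lambda>r. N r u) \<longlongrightarrow> autocorr_coeff S u) at_top" for u
    unfolding N_def E_def autocorr_coeff_def
    using ex[of u] by (intro truncated_autocorrelation_tendsto has_dens_dens) (simp add: autocorr_coeff_exists_def)
  have nu0: "autocorr_coeff S 0 = dens S" by (simp add: autocorr_coeff_def)
  have N0: "N r 0 = card (E r) / ?v r" for r by (simp add: N_def)
  have N_le: "N r u \<le> N r 0" for r u
    unfolding N0 unfolding N_def using Efin by (intro divide_right_mono) (auto intro: card_mono)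
  \<comment> \<open>Positive density provides points of S in all large balls. Smaller radii are
    skipped so that every set \<open>E (R j)\<close> can be normalized.\<close>
  have "\<forall>\<^sub>F r in at_top. 0 < r \<and> 0 < N r 0"
    using eventually_gt_at_top[of 0] order_tendstoD(1)[OF N_lim[of 0], of 0] pos
    by (auto simp: nu0 intro: eventually_conj)
  then obtain r0 where r0: "\<And>r. r0 \<le> r \<Longrightarrow> 0 < r \<and> 0 < N r 0"
    by (auto simp: eventually_at_top_linorder)
  define R where "R j = r0 + real j" for j
  have R: "0 < R j" "0 < N (R j) 0" for j using r0[of "R j"] by (auto simp: R_def)
  have R_lim: "filterlim R at_top sequentially"
    unfolding R_def by (intro filterlim_tendsto_add_at_top[OF tendsto_const] filterlim_real_sequentially)
  have Ene: "E (R j) \<noteq> {}" for j using R(2)[of j] by (auto simp: N0)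
  obtain \<delta> where \<delta>: "0 < \<delta>" "\<And>x. x \<in> Q.cell \<Longrightarrow> norm x < \<delta>" by (rule Q.cell_radius) blast
  obtain \<sigma> \<mu> C where \<sigma>: "strict_mono \<sigma>" and \<mu>: "prob_space \<mu>" "sets \<mu> = sets borel" "AE x in \<mu>. norm x \<le> C"
    and weak: "\<And>F :: real ^ 'n \<Rightarrow> complex. continuous_on UNIV F \<Longrightarrow>
       (\<lambda>j. integral\<^sup>L (normalized_spectrum (E (R (\<sigma> j)))) F) \<longlonglongrightarrow> integral\<^sup>L \<mu> F"
  proof (rule weak_compactness_bounded[of "\<lambda>j. normalized_spectrum (E (R j))" \<delta>])
    show "prob_space (normalized_spectrum (E (R j)))" for j
      using Efin EP Ene by (rule prob_space_normalized_spectrum)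
    show "AE x in normalized_spectrum (E (R j)). norm x < \<delta>" for j
      using \<delta>(2) by (intro AE_normalized_spectrum) auto
  qed (auto intro: that)
  define \<tau> where "\<tau> j = R (\<sigma> j)" for j
  have \<tau>_lim: "filterlim \<tau> at_top sequentially"
    unfolding \<tau>_def using filterlim_compose[OF R_lim filterlim_subseq[OF \<sigma>]] .
  have \<tau>: "0 < ?v (\<tau> j)" "0 < N (\<tau> j) 0" for j using R[of "\<sigma> j"] by (auto simp: \<tau>_def)
  have N\<tau>: "(\<lambda>j. N (\<tau> j) u) \<longlonglongrightarrow> autocorr_coeff S u" for u
    using N_lim \<tau>_lim by (rule filterlim_compose)
  have card\<tau>: "complex_of_real (card (E (\<tau> j)) * vQ) = of_real (?v (\<tau> j) * (N (\<tau> j) 0 * vQ))" for j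
    using \<tau>(1)[of j] by (simp add: N0)
  show ?thesis
  proof (rule exI[of _ \<mu>], rule exI[of _ C], intro conjI ballI allI impI \<mu>)
    fix u assume u: "u \<in> P.L"
    have cont: "continuous_on UNIV (character u)" by (intro continuous_intros)
    have "integral\<^sup>L (normalized_spectrum (E (\<tau> j))) (character u) = of_real (N (\<tau> j) u / N (\<tau> j) 0)" for j
    proof -
      have "integral\<^sup>L (normalized_spectrum (E (\<tau> j))) (character u)
          = of_nat (card (E (\<tau> j) \<inter> (+) u ` E (\<tau> j))) * of_real vQ / of_real (card (E (\<tau> j)) * vQ)"
        using integral_power_spectrum_character_cell[OF Efin EP u, of "\<tau> j"]
        by (subst integral_normalized_spectrum) auto
      also have "\<dots> = of_real (N (\<tau> j) u / N (\<tau> j) 0)"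
        using \<tau>(1)[of j] Q.measure_cell_pos unfolding N0 unfolding N_def by simp
      finally show ?thesis .
    qed
    moreover have "(\<lambda>j. complex_of_real (N (\<tau> j) u / N (\<tau> j) 0)) \<longlonglongrightarrow> of_real (autocorr_coeff S u / autocorr_coeff S 0)"
      using pos by (intro tendsto_of_real tendsto_divide N\<tau>) (simp add: nu0)
    ultimately show "(\<integral>x. character u x \<partial>\<mu>) = of_real (autocorr_coeff S u / dens S)"
      using LIMSEQ_unique[OF weak[OF cont]] by (simp add: nu0 \<tau>_def)
  next
    fix f :: "real ^ 'n \<Rightarrow> complex" assume f: "schwartz f"
    let ?F = "\<lambda>x. \<integral>g. f (x + g) \<partial>count_space Q.L"
    let ?k = "CARD('n) + 2"
    have cont: "continuous_on UNIV ?F" using f by (rule Q.continuous_lattice_sum)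
    have "integral\<^sup>L (normalized_spectrum (E (\<tau> j))) ?F
        = (\<integral>u. of_real (N (\<tau> j) u) * fourier f u \<partial>count_space P.L) / of_real (N (\<tau> j) 0 * vQ)" for j
    proof -
      have "integral\<^sup>L (normalized_spectrum (E (\<tau> j))) ?F
          = (\<integral>u. of_nat (card (E (\<tau> j) \<inter> (+) u ` E (\<tau> j))) * fourier f u \<partial>count_space P.L)
            / of_real (card (E (\<tau> j)) * vQ)"
        unfolding integral_power_spectrum_schwartz[OF f Efin EP, symmetric]
        by (rule integral_normalized_spectrum[OF borel_measurable_continuous_onI[OF cont]])
      also have "(\<integral>u. of_nat (card (E (\<tau> j) \<inter> (+) u ` E (\<tau> j))) * fourier f u \<partial>count_space P.L)
          = (\<integral>u. of_real (?v (\<tau> j)) * (of_real (N (\<tau> j) u) * fourier f u) \<partial>count_space P.L)"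
        using \<tau>(1)[of j] by (intro Bochner_Integration.integral_cong refl) (simp add: N_def)
      also have "\<dots> = of_real (?v (\<tau> j)) * (\<integral>u. of_real (N (\<tau> j) u) * fourier f u \<partial>count_space P.L)"
        by (rule integral_mult_right_zero)
      finally show ?thesis
        unfolding card\<tau> using \<tau>(1)[of j] by (simp only: of_real_mult) simp
    qed
    moreover have "(\<lambda>j. (\<integral>u. of_real (N (\<tau> j) u) * fourier f u \<partial>count_space P.L))
      \<longlonglongrightarrow> (\<integral>u. of_real (autocorr_coeff S u) * fourier f u \<partial>count_space P.L)"
    proof -
      \<comment> \<open>The value of \<open>N\<close> at u never exceeds the one at 0, which
        converges along the radii and is thus bounded; K therefore dominates uniformly in u.\<close>
      obtain K where K: "\<And>j. norm (N (\<tau> j) 0) \<le> K"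
        using convergent_imp_Bseq[of "\<lambda>j. N (\<tau> j) 0"] N\<tau>[of 0] by (auto simp: convergent_def Bseq_def)
      have NK: "norm (complex_of_real (N (\<tau> j) u)) \<le> K" for j u
      proof -
        have "0 \<le> N (\<tau> j) u" by (simp add: N_def)
        then show ?thesis using K[of j] N_le[of "\<tau> j" u] by (simp add: norm_of_real)
      qed
      obtain D where D: "0 \<le> D" "\<And>u. norm (fourier f u) \<le> D / (1 + norm u) ^ ?k"
        using fourier_decay[OF f] by blast
      show ?thesis
      proof (rule integral_dominated_convergence[where w = "\<lambda>u. K * D * (1 / (1 + norm u) ^ ?k)"])
        show "integrable (count_space P.L) (\<lambda>u. K * D * (1 / (1 + norm u) ^ ?k))"
          using P.integrable_decay_L by (rule integrable_mult_right)
        show "AE u in count_space P.L. (\<lambda>j. of_real (N (\<tau> j) u) * fourier f u)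
          \<longlonglongrightarrow> of_real (autocorr_coeff S u) * fourier f u"
          by (intro always_eventually allI tendsto_intros N\<tau>)
        show "AE u in count_space P.L. norm (of_real (N (\<tau> j) u) * fourier f u) \<le> K * D * (1 / (1 + norm u) ^ ?k)" for j
        proof (rule always_eventually, rule allI)
          fix u
          have "norm (of_real (N (\<tau> j) u) * fourier f u) \<le> K * (D / (1 + norm u) ^ ?k)"
            unfolding norm_mult using NK[of j u] D(2)[of u] by (intro mult_mono) (auto intro: order_trans[OF norm_ge_zero])
          then show "norm (of_real (N (\<tau> j) u) * fourier f u) \<le> K * D * (1 / (1 + norm u) ^ ?k)" by simp
        qed
      qed auto
    qed
    moreover have "(\<lambda>j. complex_of_real (N (\<tau> j) 0 * vQ)) \<longlonglongrightarrow> of_real (dens S * vQ)"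
      using N\<tau>[of 0] by (intro tendsto_intros) (simp add: nu0)
    ultimately have "(\<lambda>j. integral\<^sup>L (normalized_spectrum (E (\<tau> j))) ?F)
      \<longlonglongrightarrow> (\<integral>u. of_real (autocorr_coeff S u) * fourier f u \<partial>count_space P.L) / of_real (dens S * vQ)"
      using pos Q.measure_cell_pos by (simp only:) (intro tendsto_divide, auto)
    then have "integral\<^sup>L \<mu> ?F
        = (\<integral>u. of_real (autocorr_coeff S u) * fourier f u \<partial>count_space P.L) / of_real (dens S * vQ)"
      using LIMSEQ_unique[OF weak[OF cont]] by (simp add: \<tau>_def)
    then show "of_real (dens S * vQ) * integral\<^sup>L \<mu> ?F
        = (\<integral>u. of_real (autocorr_coeff S u) * fourier f u \<partial>count_space P.L)"
      using pos Q.measure_cell_pos by simp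
  qed
qed

text \<open>The overlap is a subset of S, and the coefficient at 0 is dens S itself.\<close>

lemma autocorr_coeff_bounds:
  assumes S: "S \<subseteq> P.L" and ex: "\<And>u. autocorr_coeff_exists S u"
  shows "0 \<le> autocorr_coeff S u" "autocorr_coeff S u \<le> dens S"
proof -
  have d: "has_dens (S \<inter> (+) u ` S) (autocorr_coeff S u)" for u
    using ex[of u] unfolding autocorr_coeff_exists_def autocorr_coeff_def by (intro has_dens_dens)
  show "0 \<le> autocorr_coeff S u" using d by (rule has_dens_nonneg)
  have "has_dens S (dens S)" using d[of 0] by (simp add: autocorr_coeff_def)
  moreover have "card (S \<inter> (+) u ` S \<inter> ball 0 r) \<le> card (S \<inter> ball 0 r)" for r
    using has_dens_finite[OF \<open>has_dens S (dens S)\<close>] by (intro card_mono) auto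
  ultimately show "autocorr_coeff S u \<le> dens S"
    using d[of u] unfolding has_dens_def
    by (elim conjE, intro tendsto_le[where F = at_top]) (auto intro!: always_eventually divide_right_mono)
qed

lemma integral_density_periodize:
  fixes f :: "real ^ 'n \<Rightarrow> complex"
  assumes \<mu>: "prob_space \<mu>" "sets \<mu> = sets borel" "AE x in \<mu>. norm x \<le> C" and c: "0 \<le> c" and f: "schwartz f"
  shows "(\<integral>x. f x \<partial>density (Q.periodize \<mu>) (\<lambda>_. ennreal c))
    = of_real c * (\<integral>x. \<integral>g. f (x + g) \<partial>count_space Q.L \<partial>\<mu>)"
proof -
  interpret prob_space \<mu> by (rule \<mu>)
  \<comment> \<open>The factor 1 gives the periodization itself, which is thereby known to integrate
    f.\<close>
  have "tempered_measure (density (Q.periodize \<mu>) (\<lambda>_. ennreal 1))"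
    using \<mu> by (rule Q.tempered_periodize) simp
  then have int: "integrable (Q.periodize \<mu>) f" using f by (simp add: tempered_measure_def density_1)
  have "(\<integral>x. f x \<partial>density (Q.periodize \<mu>) (\<lambda>_. ennreal c)) = (\<integral>x. c *\<^sub>R f x \<partial>Q.periodize \<mu>)"
    using c schwartz_measurable[OF f] by (intro integral_density) auto
  also have "\<dots> = c *\<^sub>R (\<integral>x. f x \<partial>Q.periodize \<mu>)" by simp
  also have "(\<integral>x. f x \<partial>Q.periodize \<mu>) = (\<integral>x. \<integral>g. f (x + g) \<partial>count_space Q.L \<partial>\<mu>)"
    using \<mu>(2) sigma_finite_measure_axioms int by (rule Q.integral_periodize)
  finally show ?thesis by (simp add: scaleR_conv_of_real)
qed

lemma fourier_transform_autocorrelation_exists: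
  assumes S: "S \<subseteq> P.L" and ex: "\<And>u. autocorr_coeff_exists S u"
  obtains N where "is_fourier_transform (autocorrelation P.L S) N"
proof -
  note nu = autocorr_coeff_bounds[OF S ex]
  have d0: "0 \<le> dens S" using nu[of 0] by linarith
  have T: "tempered_measure (autocorrelation P.L S)"
    unfolding autocorrelation_def using nu d0 by (intro P.tempered_weighted_comb)
  have hat: "(\<integral>x. fourier f x \<partial>autocorrelation P.L S)
      = (\<integral>u. of_real (autocorr_coeff S u) * fourier f u \<partial>count_space P.L)" if "schwartz f" for f
    unfolding autocorrelation_def using measurable_fourier[OF that] nu by (intro integral_weighted_comb)
  show ?thesis
  proof (cases "dens S = 0")
    \<comment> \<open>A set of density 0 cannot be normalized, but then all its coefficients vanish
      by their bounds, and the zero measure is the transform.\<close>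
    case True
    then have z: "autocorr_coeff S u = 0" for u using nu[of u] by simp
    have T0: "tempered_measure (weighted_comb P.L (\<lambda>_. 0))"
      by (rule P.tempered_weighted_comb[of _ 0]) auto
    have "(\<integral>x. f x \<partial>weighted_comb P.L (\<lambda>_. 0)) = 0" if "schwartz f" for f :: "real ^ 'n \<Rightarrow> complex"
      using schwartz_measurable[OF that] by (subst integral_weighted_comb) auto
    then have "is_fourier_transform (autocorrelation P.L S) (weighted_comb P.L (\<lambda>_. 0))"
      unfolding is_fourier_transform_def using T T0 hat z by simp
    then show ?thesis by (rule that)
  next
    case False
    with d0 have pos: "0 < dens S" by simp
    obtain \<mu> C where \<mu>: "prob_space \<mu>" "sets \<mu> = sets borel" "AE x in \<mu>. norm x \<le> C"
      and eq: "\<And>f. schwartz f \<Longrightarrow> of_real (dens S * vQ) * (\<integral>x. \<integral>g. f (x + g) \<partial>count_space Q.L \<partial>\<mu>)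
       = (\<integral>u. of_real (autocorr_coeff S u) * fourier f u \<partial>count_space P.L)"
      using limit_spectrum[OF S ex pos] by blast
    have c: "0 \<le> dens S * vQ" using pos by simp
    \<comment> \<open>The factor dens S times the dual cell volume undoes the normalization to mass
      1.\<close>
    have "is_fourier_transform (autocorrelation P.L S) (density (Q.periodize \<mu>) (\<lambda>_. ennreal (dens S * vQ)))"
      unfolding is_fourier_transform_def
      using T Q.tempered_periodize[OF \<mu> c] hat eq integral_density_periodize[OF \<mu> c] by simp
    then show ?thesis by (rule that)
  qed
qed

section \<open>Poisson summation\<close>

lemma Int_translate_empty:
  assumes "A \<subseteq> P.L" "z \<notin> P.L" shows "A \<inter> (+) z ` A = {}"
proof (rule equals0I)
  fix x assume "x \<in> A \<inter> (+) z ` A"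
  then obtain y where "x \<in> P.L" "y \<in> P.L" "x = z + y" using assms(1) by auto
  then have "z \<in> P.L" using P.L_diff[of x y] by simp
  with assms(2) show False by simp
qed

lemma has_dens_empty: "has_dens {} 0"
  by (simp add: has_dens_def)

lemma Int_translate_lattice:
  assumes "u \<in> P.L" shows "P.L \<inter> (+) u ` P.L = P.L"
proof -
  have "x \<in> (+) u ` P.L" if "x \<in> P.L" for x
    using P.L_diff[OF that assms] by (intro image_eqI[of _ _ "x - u"]) auto
  then show ?thesis by auto
qed

text \<open>Numbers of modulus 1 can average to 1 under a probability measure only if almost all of
  them are 1. So each character indexed by the lattice is 1 almost everywhere, which puts \<mu> on
  the dual lattice. However \<mu> is spread over the dual lattice points, its periodization is the
  dual comb.\<close>

theorem poisson_summation:
  assumes f: "schwartz f"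
  shows "(\<integral>x. fourier f x \<partial>dirac_comb P.L) = of_real (dens P.L) * (\<integral>x. f x \<partial>dirac_comb Q.L)"
proof -
  have PL: "has_dens P.L vQ" using P.has_dens_L dens_eq dens_P by metis
  have ex: "autocorr_coeff_exists P.L u" for u
  proof (cases "u \<in> P.L")
    case True
    then show ?thesis using PL by (auto simp: autocorr_coeff_exists_def dens_exists_def Int_translate_lattice)
  next
    case False
    then show ?thesis
      using has_dens_empty Int_translate_empty[OF subset_refl] by (auto simp: autocorr_coeff_exists_def dens_exists_def)
  qed
  have nu: "autocorr_coeff P.L u = vQ" if "u \<in> P.L" for u
    using that PL by (simp add: autocorr_coeff_def Int_translate_lattice dens_eq)
  have pos: "0 < dens P.L" using Q.measure_cell_pos by (simp add: dens_P)
  obtain \<mu> C where \<mu>: "prob_space \<mu>" "sets \<mu> = sets borel" "AE x in \<mu>. norm x \<le> C"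
    and char: "\<And>u. u \<in> P.L \<Longrightarrow> (\<integral>x. character u x \<partial>\<mu>) = of_real (autocorr_coeff P.L u / dens P.L)"
    and eq: "\<And>f. schwartz f \<Longrightarrow> of_real (dens P.L * vQ) * (\<integral>x. \<integral>g. f (x + g) \<partial>count_space Q.L \<partial>\<mu>)
       = (\<integral>u. of_real (autocorr_coeff P.L u) * fourier f u \<partial>count_space P.L)"
    using limit_spectrum[OF subset_refl ex pos] by blast
  interpret prob_space \<mu> by (rule \<mu>)
  have [measurable_cong]: "sets \<mu> = sets borel" by (rule \<mu>)
  have AEu: "AE x in \<mu>. character u x = 1" if u: "u \<in> P.L" for u
  proof -
    have int: "integrable \<mu> (\<lambda>x. character u x)"
      by (rule integrable_const_bound[of _ 1]) (auto simp: norm_character)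
    have int': "integrable \<mu> (\<lambda>x. 1 - Re (character u x))" using int by simp
    have "(\<integral>x. character u x \<partial>\<mu>) = 1" using char[OF u] nu[OF u] pos by (simp add: dens_P)
    then have "Re (\<integral>x. character u x \<partial>\<mu>) = 1" by simp
    then have "(\<integral>x. 1 - Re (character u x) \<partial>\<mu>) = 0"
      using int by (simp add: prob_space)
    moreover have "AE x in \<mu>. 0 \<le> 1 - Re (character u x)"
      using complex_Re_le_cmod norm_character[of u] by (metis (mono_tags, lifting) AE_I2 diff_ge_0_iff_ge)
    ultimately have "AE x in \<mu>. 1 - Re (character u x) = 0"
      using integral_nonneg_eq_0_iff_AE[OF int'] by simp
    then show ?thesis
    proof eventually_elim
      case (elim x)
      have "(Re (character u x))\<^sup>2 + (Im (character u x))\<^sup>2 = 1"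
        using norm_character[of u x] unfolding cmod_power2[symmetric] by simp
      with elim show ?case by (intro complex_eqI) auto
    qed
  qed
  \<comment> \<open>The lattice is countable, so the exceptional null sets combine into one.\<close>
  have "AE x in \<mu>. \<forall>u\<in>P.L. character u x = 1"
    using AEu P.countable_L by (simp only: AE_ball_countable) blast
  then have conc: "AE x in \<mu>. x \<in> Q.L"
  proof eventually_elim
    case (elim x)
    have "x \<bullet> u \<in> \<int>" if "u \<in> P.L" for u
    proof -
      have "character u x = 1" using elim that by (rule bspec)
      then obtain n where "Im (- 2 * of_real pi * \<i> * of_real (u \<bullet> x)) = of_int (2 * n) * pi"
        unfolding exp_eq_1 by (elim conjE exE)
      then have "(u \<bullet> x + of_int n) * (2 * pi) = 0" by (simp add: algebra_simps)
      then have "u \<bullet> x = of_int (- n)" by simp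
      then show ?thesis by (metis Ints_of_int inner_commute)
    qed
    then show ?case by (simp add: dual dual_lattice_def)
  qed
  have "(\<integral>x. \<integral>g. f (x + g) \<partial>count_space Q.L \<partial>\<mu>) = (\<integral>x. f x \<partial>density (Q.periodize \<mu>) (\<lambda>_. ennreal 1))"
    using integral_density_periodize[OF \<mu> _ f, of 1] by simp
  also have "\<dots> = (\<integral>x. f x \<partial>dirac_comb Q.L)"
    using Q.periodize_eq_comb[OF \<mu>(1,2) conc] by (simp add: density_1)
  finally have "of_real (dens P.L * vQ) * (\<integral>x. f x \<partial>dirac_comb Q.L)
      = (\<integral>u. of_real (autocorr_coeff P.L u) * fourier f u \<partial>count_space P.L)"
    using eq[OF f] by simp
  also have "\<dots> = (\<integral>u. of_real vQ * fourier f u \<partial>count_space P.L)"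
    by (intro Bochner_Integration.integral_cong) (auto simp: nu)
  also have "\<dots> = of_real vQ * (\<integral>u. of_real 1 * fourier f u \<partial>count_space P.L)"
    by simp
  also have "(\<integral>u. of_real 1 * fourier f u \<partial>count_space P.L) = (\<integral>x. fourier f x \<partial>dirac_comb P.L)"
    unfolding dirac_comb_def by (rule integral_weighted_comb[symmetric, OF measurable_fourier[OF f]]) simp
  finally show ?thesis using Q.measure_cell_pos by (simp add: dens_P)
qed

end

section \<open>Complementary sets\<close>

lemma pure_point_weighted_comb:
  fixes L :: "(real ^ 'n) set"
  shows "pure_point (weighted_comb L w)"
  unfolding pure_point_def
proof
  fix B :: "(real ^ 'n) set" assume B: "B \<in> sets borel"
  have point: "emeasure (weighted_comb L w) {x} = ennreal (w x) * indicator L x" for x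
  proof -
    have "emeasure (weighted_comb L w) {x} = (\<integral>\<^sup>+t. ennreal (w t) * indicator {x} t * indicator L t \<partial>count_space UNIV)"
      by (subst emeasure_weighted_comb) (simp_all add: nn_integral_count_space_indicator)
    also have "\<dots> = (\<integral>\<^sup>+t. (ennreal (w x) * indicator L x) * indicator {x} t \<partial>count_space UNIV)"
      by (intro nn_integral_cong) (auto simp: indicator_def)
    also have "\<dots> = ennreal (w x) * indicator L x"
      by (subst nn_integral_cmult_indicator) auto
    finally show ?thesis .
  qed
  show "emeasure (weighted_comb L w) B = (\<integral>\<^sup>+x. emeasure (weighted_comb L w) {x} \<partial>count_space B)"
    unfolding point emeasure_weighted_comb[OF B]
    by (simp add: nn_integral_count_space_indicator mult_ac)
qed

text \<open>Exhaustion by balls transfers an identity from bounded Borel sets, where finite masses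
  can be cancelled, to all Borel sets.\<close>

lemma emeasure_eq_SUP_ball:
  assumes "sets M = sets borel" "B \<in> sets borel"
  shows "emeasure M B = (SUP k. emeasure M (B \<inter> ball (0 :: real ^ 'n) (real k)))"
proof -
  have U: "(\<Union>k. B \<inter> ball 0 (real k)) = B"
    using reals_Archimedean2[where 'a = real] by auto
  have "(SUP k. emeasure M (B \<inter> ball 0 (real k))) = emeasure M (\<Union>k. B \<inter> ball 0 (real k))"
  proof (rule SUP_emeasure_incseq)
    show "range (\<lambda>k. B \<inter> ball 0 (real k)) \<subseteq> sets M"
      unfolding assms(1) using assms(2) by (intro image_subsetI sets.Int) auto
    show "incseq (\<lambda>k. B \<inter> ball (0 :: real ^ 'n) (real k))"
      by (intro incseq_SucI Int_mono order_refl subset_ball) simp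
  qed
  then show ?thesis by (simp only: U)
qed

lemma nn_integral_count_space_eq_SUP_ball:
  "(\<integral>\<^sup>+x. f x \<partial>count_space B) = (SUP k. \<integral>\<^sup>+x. f x \<partial>count_space (B \<inter> ball (0 :: real ^ 'n) (real k)))"
proof -
  have "(SUP k. f x * indicator (B \<inter> ball 0 (real k)) x) = f x * indicator B x" for x
  proof (rule antisym)
    show "(SUP k. f x * indicator (B \<inter> ball 0 (real k)) x) \<le> f x * indicator B x"
      by (intro SUP_least) (auto simp: indicator_def)
    obtain k where "norm x < real k" using reals_Archimedean2 by blast
    then have "f x * indicator B x \<le> f x * indicator (B \<inter> ball 0 (real k)) x"
      by (auto simp: indicator_def)
    then show "f x * indicator B x \<le> (SUP k. f x * indicator (B \<inter> ball 0 (real k)) x)"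
      by (rule order_trans) (auto intro: SUP_upper)
  qed
  then have "(\<integral>\<^sup>+x. f x * indicator B x \<partial>count_space UNIV)
      = (\<integral>\<^sup>+x. (SUP k. f x * indicator (B \<inter> ball 0 (real k)) x) \<partial>count_space UNIV)"
    by (simp only:)
  also have "\<dots> = (SUP k. \<integral>\<^sup>+x. f x * indicator (B \<inter> ball 0 (real k)) x \<partial>count_space UNIV)"
    by (rule nn_integral_monotone_convergence_SUP) (auto simp: incseq_def le_fun_def indicator_def)
  also have "(\<lambda>k. \<integral>\<^sup>+x. f x * indicator (B \<inter> ball 0 (real k)) x \<partial>count_space UNIV)
      = (\<lambda>k. \<integral>\<^sup>+x. f x \<partial>count_space (B \<inter> ball 0 (real k)))"
    by (rule ext, rule nn_integral_count_space_indicator[symmetric]) (simp add: NO_MATCH_def)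
  also have "(\<integral>\<^sup>+x. f x * indicator B x \<partial>count_space UNIV) = (\<integral>\<^sup>+x. f x \<partial>count_space B)"
    by (rule nn_integral_count_space_indicator[symmetric]) (simp add: NO_MATCH_def)
  finally show ?thesis .
qed

text \<open>Atoms add up as the measures do. From M to N a common term is added; from N to M it must
  be cancelled, which [0, infinity] allows where D is finite, that is on bounded sets. Balls exhaust
  the rest.\<close>

lemma pure_point_plus_iff:
  fixes M N D :: "(real ^ 'n) measure"
  assumes plus: "\<And>B. B \<in> sets borel \<Longrightarrow> emeasure N B = emeasure M B + ennreal c * emeasure D B"
    and sets: "sets M = sets borel" "sets N = sets borel"
    and D: "pure_point D" "\<And>B. bounded B \<Longrightarrow> emeasure D B < \<infinity>"
  shows "pure_point N \<longleftrightarrow> pure_point M"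
proof -
  have int: "(\<integral>\<^sup>+x. emeasure N {x} \<partial>count_space B)
      = (\<integral>\<^sup>+x. emeasure M {x} \<partial>count_space B) + ennreal c * emeasure D B" if "B \<in> sets borel" for B
  proof -
    have "(\<integral>\<^sup>+x. emeasure N {x} \<partial>count_space B)
        = (\<integral>\<^sup>+x. emeasure M {x} + ennreal c * emeasure D {x} \<partial>count_space B)"
      by (intro nn_integral_cong) (simp add: plus)
    also have "\<dots> = (\<integral>\<^sup>+x. emeasure M {x} \<partial>count_space B) + ennreal c * (\<integral>\<^sup>+x. emeasure D {x} \<partial>count_space B)"
      by (simp add: nn_integral_add nn_integral_cmult)
    also have "(\<integral>\<^sup>+x. emeasure D {x} \<partial>count_space B) = emeasure D B"
      using D(1) that unfolding pure_point_def by metis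
    finally show ?thesis .
  qed
  show ?thesis
  proof
    assume M: "pure_point M"
    show "pure_point N"
      unfolding pure_point_def
    proof
      fix B :: "(real ^ 'n) set" assume B: "B \<in> sets borel"
      have "emeasure M B = (\<integral>\<^sup>+x. emeasure M {x} \<partial>count_space B)"
        using M B unfolding pure_point_def by blast
      then show "emeasure N B = (\<integral>\<^sup>+x. emeasure N {x} \<partial>count_space B)"
        by (simp only: int[OF B] plus[OF B])
    qed
  next
    assume N: "pure_point N"
    have *: "emeasure M B = (\<integral>\<^sup>+x. emeasure M {x} \<partial>count_space B)" if B: "B \<in> sets borel" "bounded B" for B
    proof -
      have "emeasure M B + ennreal c * emeasure D B = (\<integral>\<^sup>+x. emeasure M {x} \<partial>count_space B) + ennreal c * emeasure D B"
        unfolding plus[OF B(1), symmetric] int[OF B(1), symmetric] using N B(1) unfolding pure_point_def by blast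
      moreover have "ennreal c * emeasure D B \<noteq> \<infinity>"
        using D(2)[OF B(2)] by (simp add: ennreal_mult_eq_top_iff)
      ultimately show ?thesis by (simp add: add.commute ennreal_add_left_cancel)
    qed
    show "pure_point M"
      unfolding pure_point_def
    proof
      fix B :: "(real ^ 'n) set" assume B: "B \<in> sets borel"
      have "emeasure M B = (SUP k. emeasure M (B \<inter> ball 0 (real k)))"
        using sets(1) B by (rule emeasure_eq_SUP_ball)
      also have "\<dots> = (SUP k. \<integral>\<^sup>+x. emeasure M {x} \<partial>count_space (B \<inter> ball 0 (real k)))"
        using B by (intro SUP_cong refl *) (auto intro: bounded_subset[OF bounded_ball])
      also have "\<dots> = (\<integral>\<^sup>+x. emeasure M {x} \<partial>count_space B)"
        by (rule nn_integral_count_space_eq_SUP_ball[symmetric])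
      finally show "emeasure M B = (\<integral>\<^sup>+x. emeasure M {x} \<partial>count_space B)" .
    qed
  qed
qed

text \<open>On bounded sets all masses are finite, so the additive identity with c \<ge> 0 can also
  be read as a subtraction. This serves both signs of the density difference.\<close>

lemma measure_eq_plus_scaledI:
  fixes M N D :: "(real ^ 'n) measure"
  assumes plus: "\<And>B. B \<in> sets borel \<Longrightarrow> emeasure N B = emeasure M B + ennreal c * emeasure D B"
    and fin: "\<And>B. bounded B \<Longrightarrow> emeasure N B < \<infinity>" "\<And>B. bounded B \<Longrightarrow> emeasure M B < \<infinity>"
      "\<And>B. bounded B \<Longrightarrow> emeasure D B < \<infinity>"
    and c: "0 \<le> c"
  shows "measure_eq_plus_scaled N M c D" "measure_eq_plus_scaled M N (- c) D"
proof -
  have "measure N B = measure M B + c * measure D B" if "B \<in> sets borel" "bounded B" for B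
  proof -
    have "emeasure M B < \<top>" "ennreal c * emeasure D B < \<top>"
      using fin(2,3)[OF that(2)] by (auto simp: ennreal_mult_less_top)
    then show ?thesis
      unfolding measure_def plus[OF that(1)] using c by (simp add: enn2real_plus enn2real_mult)
  qed
  then show "measure_eq_plus_scaled N M c D" "measure_eq_plus_scaled M N (- c) D"
    unfolding measure_eq_plus_scaled_def using fin by auto
qed

section \<open>Autocorrelation of the complement\<close>

context dual_charts begin

text \<open>Inclusion-exclusion: translation by t preserves the lattice, so the overlap of the two
  complements is the complement of the union of S and its translate. Both have density dens S, and
  they meet in density \<nu>(t).\<close>

lemma has_dens_complement:
  assumes S: "S \<subseteq> P.L" and ex: "\<And>u. autocorr_coeff_exists S u" and t: "t \<in> P.L"
  shows "has_dens ((P.L - S) \<inter> (+) t ` (P.L - S)) (dens P.L - 2 * dens S + autocorr_coeff S t)"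
proof -
  let ?I = "(P.L - S) \<inter> (+) t ` (P.L - S)" and ?v = "\<lambda>r. measure lborel (ball (0 :: real ^ 'n) r)"
  have d: "has_dens (S \<inter> (+) u ` S) (autocorr_coeff S u)" for u
    using ex[of u] unfolding autocorr_coeff_exists_def autocorr_coeff_def by (intro has_dens_dens)
  have dS: "has_dens S (dens S)" using d[of 0] by (simp add: autocorr_coeff_def)
  have dT: "has_dens ((+) t ` S) (dens S)" using dS by (rule has_dens_translate)
  have dL: "has_dens P.L (dens P.L)" using P.has_dens_L dens_eq by metis
  have TL: "(+) t ` S \<subseteq> P.L" using S t P.L_add by auto
  have memT: "x \<in> (+) t ` X \<longleftrightarrow> x - t \<in> X" for x X by (force simp: image_iff)
  have I: "?I = P.L - (S \<union> (+) t ` S)"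
    using t P.L_diff by (auto simp: memT)
  have card: "real (card (?I \<inter> ball 0 r)) = real (card (P.L \<inter> ball 0 r)) - real (card (S \<inter> ball 0 r))
      - real (card ((+) t ` S \<inter> ball 0 r)) + real (card (S \<inter> (+) t ` S \<inter> ball 0 r))" for r
  proof -
    let ?A = "S \<inter> ball 0 r" and ?B = "(+) t ` S \<inter> ball 0 r"
    have fin: "finite ?A" "finite ?B" using dS dT by (auto intro: has_dens_finite)
    have "card (?A \<union> ?B) + card (?A \<inter> ?B) = card ?A + card ?B"
      using card_Un_Int[OF fin] by simp
    moreover have "?A \<inter> ?B = S \<inter> (+) t ` S \<inter> ball 0 r" by auto
    moreover have "card (?I \<inter> ball 0 r) + card (?A \<union> ?B) = card (P.L \<inter> ball 0 r)"
    proof -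
      have "card ((?I \<inter> ball 0 r) \<union> (?A \<union> ?B)) = card (?I \<inter> ball 0 r) + card (?A \<union> ?B)"
        using fin P.locally_finite_L[of r] unfolding I
        by (intro card_Un_disjoint) (auto intro: finite_subset[OF _ P.locally_finite_L[of r]])
      moreover have "(?I \<inter> ball 0 r) \<union> (?A \<union> ?B) = P.L \<inter> ball 0 r"
        unfolding I using S TL by auto
      ultimately show ?thesis by simp
    qed
    ultimately have "card (?I \<inter> ball 0 r) + (card ?A + card ?B) = card (P.L \<inter> ball 0 r) + card (S \<inter> (+) t ` S \<inter> ball 0 r)"
      by simp
    then have "real (card (?I \<inter> ball 0 r) + (card ?A + card ?B))
        = real (card (P.L \<inter> ball 0 r) + card (S \<inter> (+) t ` S \<inter> ball 0 r))"
      by (simp only:)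
    then show ?thesis by (simp only: of_nat_add)
  qed
  have "((\<lambda>r. card (P.L \<inter> ball 0 r) / ?v r - card (S \<inter> ball 0 r) / ?v r
      - card ((+) t ` S \<inter> ball 0 r) / ?v r + card (S \<inter> (+) t ` S \<inter> ball 0 r) / ?v r)
      \<longlongrightarrow> dens P.L - dens S - dens S + autocorr_coeff S t) at_top"
    using dL dS dT d[of t] unfolding has_dens_def by (intro tendsto_intros) auto
  then have "((\<lambda>r. card (?I \<inter> ball 0 r) / ?v r) \<longlongrightarrow> dens P.L - 2 * dens S + autocorr_coeff S t) at_top"
    unfolding card by (simp add: add_divide_distrib diff_divide_distrib)
  moreover have "finite (?I \<inter> ball 0 r)" for r
    unfolding I by (rule finite_subset[OF _ P.locally_finite_L[of r]]) auto
  ultimately show ?thesis by (simp add: has_dens_def)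
qed

lemma autocorr_coeff_complement:
  assumes S: "S \<subseteq> P.L" and ex: "\<And>u. autocorr_coeff_exists S u"
  shows "autocorr_coeff_exists (P.L - S) z"
    and "z \<notin> P.L \<Longrightarrow> autocorr_coeff (P.L - S) z = 0"
    and "dens (P.L - S) = dens P.L - dens S"
    and "t \<in> P.L \<Longrightarrow> autocorr_coeff (P.L - S) t - dens (P.L - S) = autocorr_coeff S t - dens S"
proof -
  note c = has_dens_complement[OF S ex]
  show "autocorr_coeff_exists (P.L - S) z"
  proof (cases "z \<in> P.L")
    case True
    then show ?thesis using c unfolding autocorr_coeff_exists_def dens_exists_def by blast
  next
    case False
    then show ?thesis using has_dens_empty Int_translate_empty[of "P.L - S" z]
      unfolding autocorr_coeff_exists_def dens_exists_def by auto
  qed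
  show "autocorr_coeff (P.L - S) z = 0" if "z \<notin> P.L"
    using dens_eq[OF has_dens_empty] Int_translate_empty[of "P.L - S" z] that
    unfolding autocorr_coeff_def by auto
  \<comment> \<open>At t = 0 the coefficient of S is dens S, so dens \<Gamma> - 2 dens S + dens S
    remains.\<close>
  show dens: "dens (P.L - S) = dens P.L - dens S"
    using dens_eq[OF c[OF P.L_0]] by (simp add: autocorr_coeff_def)
  show "autocorr_coeff (P.L - S) t - dens (P.L - S) = autocorr_coeff S t - dens S" if "t \<in> P.L"
    unfolding dens using dens_eq[OF c[OF that]] by (simp add: autocorr_coeff_def)
qed

lemma tempered_comb: "tempered_measure (dirac_comb Q.L)"
  unfolding dirac_comb_def by (rule Q.tempered_weighted_comb[of _ 1]) auto

section \<open>From autocorrelations to diffraction measures\<close>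

lemma integrable_L_fourier:
  assumes f: "schwartz f" and w: "\<And>t. t \<in> P.L \<Longrightarrow> \<bar>w t\<bar> \<le> K"
  shows "integrable (count_space P.L) (\<lambda>t. of_real (w t) * fourier f t)"
proof -
  let ?k = "CARD('n) + 2"
  obtain D where D: "0 \<le> D" "\<And>u. norm (fourier f u) \<le> D / (1 + norm u) ^ ?k"
    using fourier_decay[OF f] by blast
  show ?thesis
  proof (rule Bochner_Integration.integrable_bound)
    show "integrable (count_space P.L) (\<lambda>u. K * D * (1 / (1 + norm u) ^ ?k))"
      using P.integrable_decay_L by (rule integrable_mult_right)
    have "norm (of_real (w t) * fourier f t) \<le> norm (K * D * (1 / (1 + norm t) ^ ?k))" if "t \<in> P.L" for t
    proof -
      have "norm (of_real (w t) * fourier f t) \<le> K * (D / (1 + norm t) ^ ?k)"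
        unfolding norm_mult norm_of_real using w[OF that] D(2)[of t]
        by (intro mult_mono) (auto intro: order_trans[OF abs_ge_zero])
      also have "\<dots> = K * D * (1 / (1 + norm t) ^ ?k)" by simp
      also have "\<dots> \<le> norm (K * D * (1 / (1 + norm t) ^ ?k))" unfolding real_norm_def by (rule abs_ge_self)
      finally show ?thesis .
    qed
    then show "AE t in count_space P.L. norm (of_real (w t) * fourier f t) \<le> norm (K * D * (1 / (1 + norm t) ^ ?k))"
      by (simp add: AE_count_space)
  qed simp
qed

lemma diffraction_is_fourier_transform:
  assumes "S \<subseteq> P.L" "\<And>u. autocorr_coeff_exists S u"
  shows "is_fourier_transform (autocorrelation P.L S) (diffraction P.L S)"
  using fourier_transform_autocorrelation_exists[OF assms] measure_fourier_eq
  unfolding diffraction_def by metis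

text \<open>The autocorrelations differ by \<delta> times the lattice comb, and Poisson summation
  turns this into \<delta> dens \<Gamma> times the dual comb. Absolute convergence over the lattice
  permits splitting the sum.\<close>

lemma diffraction_plus:
  assumes A: "A \<subseteq> P.L" "\<And>u. autocorr_coeff_exists A u"
    and A': "A' \<subseteq> P.L" "\<And>u. autocorr_coeff_exists A' u"
    and \<delta>: "0 \<le> \<delta>" "\<And>t. t \<in> P.L \<Longrightarrow> autocorr_coeff A' t = autocorr_coeff A t + \<delta>"
    and B: "B \<in> sets borel"
  shows "emeasure (diffraction P.L A') B
    = emeasure (diffraction P.L A) B + ennreal (\<delta> * dens P.L) * emeasure (dirac_comb Q.L) B"
proof (rule tempered_measure_eq_plusI[OF _ _ tempered_comb _ _ B])
  note FA = diffraction_is_fourier_transform[OF A] and FA' = diffraction_is_fourier_transform[OF A']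
  show "tempered_measure (diffraction P.L A')" "tempered_measure (diffraction P.L A)"
    using FA FA' by (auto simp: is_fourier_transform_def)
  show "0 \<le> \<delta> * dens P.L" using \<delta>(1) by (simp add: dens_P)
  fix f :: "real ^ 'n \<Rightarrow> complex" assume f: "schwartz f"
  note nu = autocorr_coeff_bounds[OF A] and nu' = autocorr_coeff_bounds[OF A']
  have int: "integrable (count_space P.L) (\<lambda>t. of_real (autocorr_coeff A t) * fourier f t)"
    "integrable (count_space P.L) (\<lambda>t. of_real \<delta> * fourier f t)"
    using nu by (intro integrable_L_fourier[OF f, where K = "dens A"], simp)
      (rule integrable_L_fourier[OF f, where K = "\<bar>\<delta>\<bar>"], simp)
  have "integral\<^sup>L (diffraction P.L A') f = (\<integral>x. fourier f x \<partial>autocorrelation P.L A')"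
    using FA' f by (simp add: is_fourier_transform_def)
  also have "\<dots> = (\<integral>t. of_real (autocorr_coeff A' t) * fourier f t \<partial>count_space P.L)"
    unfolding autocorrelation_def using nu' by (intro integral_weighted_comb measurable_fourier[OF f])
  also have "\<dots> = (\<integral>t. of_real (autocorr_coeff A t) * fourier f t + of_real \<delta> * fourier f t \<partial>count_space P.L)"
    using \<delta>(2) by (intro Bochner_Integration.integral_cong) (auto simp: algebra_simps)
  also have "\<dots> = (\<integral>t. of_real (autocorr_coeff A t) * fourier f t \<partial>count_space P.L)
      + (\<integral>t. of_real \<delta> * fourier f t \<partial>count_space P.L)"
    using int by (rule Bochner_Integration.integral_add)
  also have "(\<integral>t. of_real \<delta> * fourier f t \<partial>count_space P.L)
      = of_real \<delta> * (\<integral>t. of_real 1 * fourier f t \<partial>count_space P.L)"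
    by simp
  also have "(\<integral>t. of_real 1 * fourier f t \<partial>count_space P.L) = (\<integral>x. fourier f x \<partial>dirac_comb P.L)"
    unfolding dirac_comb_def by (rule integral_weighted_comb[symmetric, OF measurable_fourier[OF f]]) simp
  also have "\<dots> = of_real (dens P.L) * integral\<^sup>L (dirac_comb Q.L) f"
    using f by (rule poisson_summation)
  also have "(\<integral>t. of_real (autocorr_coeff A t) * fourier f t \<partial>count_space P.L)
      = (\<integral>x. fourier f x \<partial>autocorrelation P.L A)"
    unfolding autocorrelation_def using nu by (intro integral_weighted_comb[symmetric] measurable_fourier[OF f])
  also have "\<dots> = integral\<^sup>L (diffraction P.L A) f"
    using FA f by (simp add: is_fourier_transform_def)
  finally show "integral\<^sup>L (diffraction P.L A') f
    = integral\<^sup>L (diffraction P.L A) f + of_real (\<delta> * dens P.L) * integral\<^sup>L (dirac_comb Q.L) f"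
    by simp
qed

lemma diffraction_relation:
  assumes A: "A \<subseteq> P.L" "\<And>u. autocorr_coeff_exists A u"
    and A': "A' \<subseteq> P.L" "\<And>u. autocorr_coeff_exists A' u"
    and \<delta>: "0 \<le> \<delta>" "\<And>t. t \<in> P.L \<Longrightarrow> autocorr_coeff A' t = autocorr_coeff A t + \<delta>"
  shows "measure_eq_plus_scaled (diffraction P.L A') (diffraction P.L A) (\<delta> * dens P.L) (dirac_comb Q.L)"
    and "measure_eq_plus_scaled (diffraction P.L A) (diffraction P.L A') (- (\<delta> * dens P.L)) (dirac_comb Q.L)"
    and "pure_point (diffraction P.L A') \<longleftrightarrow> pure_point (diffraction P.L A)"
proof -
  note plus = diffraction_plus[OF A A' \<delta>]
  have T: "tempered_measure (diffraction P.L A)" "tempered_measure (diffraction P.L A')"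
    using diffraction_is_fourier_transform[OF A] diffraction_is_fourier_transform[OF A']
    by (auto simp: is_fourier_transform_def)
  note fin = emeasure_bounded_tempered[OF T(2)] emeasure_bounded_tempered[OF T(1)] emeasure_bounded_tempered[OF tempered_comb]
  have c: "0 \<le> \<delta> * dens P.L" using \<delta>(1) by (simp add: dens_P)
  show "measure_eq_plus_scaled (diffraction P.L A') (diffraction P.L A) (\<delta> * dens P.L) (dirac_comb Q.L)"
    "measure_eq_plus_scaled (diffraction P.L A) (diffraction P.L A') (- (\<delta> * dens P.L)) (dirac_comb Q.L)"
    using measure_eq_plus_scaledI[OF plus fin c] by blast+
  show "pure_point (diffraction P.L A') \<longleftrightarrow> pure_point (diffraction P.L A)"
    using T fin(3) by (intro pure_point_plus_iff[OF plus])
      (auto simp: tempered_measure_def dirac_comb_def pure_point_weighted_comb)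
qed

end

theorem theorem2:
  fixes \<Gamma> S S' :: "(real ^ 'n) set"
  assumes "is_lattice \<Gamma>"
    and "S \<subseteq> \<Gamma>"
    and "\<forall>z. autocorr_coeff_exists S z"
    and "S' = \<Gamma> - S"
  shows "((\<forall>z. autocorr_coeff_exists S' z) \<and>
          (\<forall>z. z \<notin> \<Gamma> \<longrightarrow> autocorr_coeff S' z = 0) \<and>
          (\<forall>t\<in>\<Gamma>. autocorr_coeff S' t - dens S' = autocorr_coeff S t - dens S)) \<and>
         (dens S = dens \<Gamma> / 2 \<longrightarrow> homometric \<Gamma> S S') \<and>
         (measure_eq_plus_scaled (diffraction \<Gamma> S') (diffraction \<Gamma> S)
            ((dens S' - dens S) * dens \<Gamma>) (dirac_comb (dual_lattice \<Gamma>)) \<and>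
          (dens S' = dens S \<longrightarrow> diffraction \<Gamma> S' = diffraction \<Gamma> S)) \<and>
         (pure_point (diffraction \<Gamma> S') \<longleftrightarrow> pure_point (diffraction \<Gamma> S))"
proof -
  obtain a b where charts: "lattice_chart a" "lattice_chart b" and L: "lattice_chart.L a = \<Gamma>"
    "lattice_chart.L b = dual_lattice \<Gamma>"
    "measure lborel (lattice_chart.cell a) * measure lborel (lattice_chart.cell b) = 1"
    using assms(1) by (rule is_lattice_charts)
  interpret dual_charts a b
    using charts L by (intro dual_charts.intro dual_charts_axioms.intro) simp_all
  have S: "S \<subseteq> P.L" "\<And>u. autocorr_coeff_exists S u" using assms L(1) by auto
  have S'_eq: "S' = P.L - S" using assms(4) L(1) by simp
  note compl = autocorr_coeff_complement[OF S, folded S'_eq]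
  have S': "S' \<subseteq> P.L" "\<And>u. autocorr_coeff_exists S' u" using compl(1) S'_eq by auto
  have auto_eq: "autocorrelation P.L S' = autocorrelation P.L S" if "dens S' = dens S"
    unfolding autocorrelation_def using compl(4) that by (intro weighted_comb_cong) auto
  have hom: "homometric P.L S S'" if "dens S = dens P.L / 2"
    unfolding homometric_def using auto_eq that compl(3) by (intro conjI allI S(2) S'(2)) simp
  have rel: "measure_eq_plus_scaled (diffraction P.L S') (diffraction P.L S)
      ((dens S' - dens S) * dens P.L) (dirac_comb Q.L) \<and>
    (pure_point (diffraction P.L S') \<longleftrightarrow> pure_point (diffraction P.L S))"
  \<comment> \<open>The sparser set is taken as \<open>A\<close> so that the excess \<delta> is
    nonnegative. If that is S', the wanted identity is the subtracted form, with the negative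
    factor.\<close>
  proof (cases "dens S \<le> dens S'")
    case True
    then show ?thesis
      using diffraction_relation[OF S S', of "dens S' - dens S"] compl(4) by fastforce
  next
    case False
    have "autocorr_coeff S t = autocorr_coeff S' t + (dens S - dens S')" if "t \<in> P.L" for t
      using compl(4)[OF that] by simp
    then show ?thesis
      using diffraction_relation[OF S' S, of "dens S - dens S'"] False by (simp add: algebra_simps)
  qed
  have "dens S' = dens S \<longrightarrow> diffraction P.L S' = diffraction P.L S"
    using auto_eq by (simp add: diffraction_def)
  then show ?thesis
    using compl(1,2,4) hom rel unfolding L by blast
qed

end
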